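(* Let $s\in\mathbb{Z}$ and let $D\ge2$ be a fixed number of frequency channels $\nu_1,\dots,\nu_D$. Suppose that one observes on $\mathbb{S}^2$ the spin-$s$ fields $P_{\nu_r}(x)=P(x)+N_{\nu_r}(x)$, $r=1,\dots,D$, where $P,N_{\nu_1},\dots,N_{\nu_D}$ are independent zero-mean Gaussian isotropic spin-$s$ random fields. Assume that the angular power spectrum $(C_l)$ of $P$ satisfies $C_l=l^{-\alpha}g(l)>0$, $c_0^{-1}\le g(l)\le c_0$, $\alpha>2$, and for every $n\in\mathbb{N}$ there is $c_n>0$ with $|\frac{d^n}{du^n}g(u)|\le c_nu^{-n}$ for $u\in(|s|,\infty)$; and that for each $r$ the angular power spectrum $(C_{lN_r})$ of $N_{\nu_r}$ satisfies $C_{lN_r}=l^{-\gamma}g_{N_r}(l)>0$, $c_{0N}^{-1}\le g_{N_r}(l)\le c_{0N}$, $\gamma>2$, and for every $n\in\mathbb{N}$ there is $c_{nN}>0$ with $|\frac{d^n}{du^n}g_{N_r}(u)|\le c_{nN}u^{-n}$ for $u\in(|s|,\infty)$. Let $$\beta_{jk;sr}=\int_{\mathbb{S}^2}P_{\nu_r}\overline{\psi_{jk;s}}\,dx,\qquad \beta_{jk;sP}=\int_{\mathbb{S}^2}P\,\overline{\psi_{jk;s}}\,dx,$$ $$\widetilde{\Gamma}^{CP}_j:=\frac1{D(D-1)}\sum_k\sum_{r_1\ne r_2}\beta_{jk;sr_1}\overline{\beta_{jk;sr_2}},\qquad \Gamma_j:=\sum_kE|\beta_{jk;sP}|^2 .$$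 Then, as $j\to\infty$, $$\frac{\widetilde{\Gamma}^{CP}_j-\Gamma_j}{\sqrt{\mathrm{Var}\{\widetilde{\Gamma}^{CP}_j\}}}\longrightarrow_dN(0,1),\qquad \mathrm{Var}\{\widetilde{\Gamma}^{CP}_j\}=O\big(B^{2(1-\min(\alpha,\gamma))j}\big).$$
   Context: $dx$ is surface measure on the unit sphere $\mathbb{S}^2$. Spin harmonics. For $s\in\mathbb{Z}$, $l\ge|s|$, $m=-l,\dots,l$, in the fixed chart with spherical coordinates $(\vartheta,\varphi)$ on $\mathbb{S}^2\setminus\{\text{poles}\}$, the spin-$s$ spherical harmonics are $Y_{l;ms}(\vartheta,\varphi)=(-1)^m\sqrt{\frac{2l+1}{4\pi}}\,e^{im\varphi}d^l_{-m,s}(\vartheta)$, where $d^l_{mn}$ are the Wigner (small) $d$-functions, i.e. the Wigner matrices of $SO(3)$ are $D^l_{mn}(\alpha,\beta,\gamma)=e^{-im\alpha}d^l_{mn}(\beta)e^{-in\gamma}$. They are orthonormal in $L^2(\mathbb{S}^2)$ and $\sum_m|Y_{l;ms}|^2=\frac{2l+1}{4\pi}$. A change of chart only multiplies spin-$s$ quantities by a unimodular phase, so the quadratic quantities considered do not depend on the chart. Put $e_{ls}=(l-s)(l+s+1)$. Sums over $l$ run over $l\ge|s|$ (and $l\geq 1$). Spin needlets. Fix $B>1$ and a nonnegative $b\in C^\infty$ with compact support in $[1/B,B]$, and $\sum_{j\in\mathbb{Z}}b^2(u/B^j)=1$ for all $u>0$. For each $j\ge0$ there are finitely many cubature points $\xi_{jk}\in\mathbb{S}^2$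 and weights $\lambda_{jk}>0$ (nested in $j$), with $\sum_k\lambda_{jk}=4\pi$ and $\sum_k\lambda_{jk}Y_{l;ms}(\xi_{jk})\overline{Y_{l';m's}(\xi_{jk})}=\delta_l^{l'}\delta_m^{m'}$ for all $l,l'$ with $\sqrt{e_{ls}},\sqrt{e_{l's}}\le B^{j+1}$; with constants independent of $j$, $cB^{-2j}\le\lambda_{jk}\le c'B^{-2j}$, the number of points is bounded above and below by constants times $B^{2j}$, distinct points are at distance $\ge\kappa'B^{-j}$, and each point of $\mathbb{S}^2$ is within $\kappa B^{-j}$ of some $\xi_{jk}$. The spin needlets are $\psi_{jk;s}(x)=\sqrt{\lambda_{jk}}\sum_l b\big(\frac{\sqrt{e_{ls}}}{B^j}\big)\sum_{m=-l}^lY_{l;ms}(x)\overline{Y_{l;ms}(\xi_{jk})}$. Sums over $k$ run over all cubature points of level $j$. Random fields. A Gaussian isotropic spin-$s$ field with (total) angular power spectrum $(C_l)$ is $\sum_{l}\sum_{m=-l}^l a_{l;ms}Y_{l;ms}$ (convergence in mean square), where $(a_{l;ms})$ are jointly Gaussian, zero-mean, complex with $E\,a_{l;ms}\overline{a_{l';m's}}=C_l\delta_l^{l'}\delta_m^{m'}$ and $E\,a_{l;ms}a_{l';m's}=0$. *)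

theory Defs
  imports "HOL-Probability.Probability" "HOL-Library.Landau_Symbols"
begin

section \<open>The sphere and its surface measure\<close>

definition sphere_point :: "real \<times> real \<Rightarrow> real^3" where
  "sphere_point = (\<lambda>(\<theta>, \<phi>). vector [sin \<theta> * cos \<phi>, sin \<theta> * sin \<phi>, cos \<theta>])"

text \<open>The surface measure is the image of \<open>sin \<theta> d\<theta> d\<phi>\<close> on
  \<open>[0, \<pi>] \<times> [0, 2\<pi>)\<close>; its underlying space is \<open>sphere 0 1\<close>.\<close>

definition sphere_measure :: "(real^3) measure" where
  "sphere_measure =
     distr (density lborel
              (\<lambda>(\<theta>, \<phi>). ennreal (indicator ({0..pi} \<times> {0..<2*pi}) (\<theta>, \<phi>) * sin \<theta>)))
           (restrict_space borel (sphere 0 1))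
           sphere_point"

definition sphere_dist :: "real^3 \<Rightarrow> real^3 \<Rightarrow> real" where
  "sphere_dist x y = arccos (x \<bullet> y)"


section \<open>Spin spherical harmonics\<close>

text \<open>The Wigner small d-function \<open>d\<^sup>l\<^sub>m\<^sub>n\<close>, for \<open>\<bar>m\<bar>, \<bar>n\<bar> \<le> l\<close>, by Wigner's explicit formula;
  the summation range is exactly the set of \<open>k\<close> for which all four factorials in the
  denominator have nonnegative arguments.\<close>

definition wigner_d :: "nat \<Rightarrow> int \<Rightarrow> int \<Rightarrow> real \<Rightarrow> real" where
  "wigner_d l m n \<beta> =
     sqrt (fact (nat (int l + m)) * fact (nat (int l - m)) *
           fact (nat (int l + n)) * fact (nat (int l - n))) *
     (\<Sum>k = nat (max 0 (n - m))..nat (min (int l + n) (int l - m)).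
        (-1) ^ nat (m - n + int k) /
          (fact (nat (int l + n - int k)) * fact k *
           fact (nat (m - n + int k)) * fact (nat (int l - m - int k))) *
        cos (\<beta> / 2) ^ nat (2 * int l + n - m - 2 * int k) *
        sin (\<beta> / 2) ^ nat (m - n + 2 * int k))"

text \<open>The harmonics \<open>Y\<^sub>l\<^sub>;\<^sub>m\<^sub>s\<close> in the fixed chart, as functions of the point \<open>x\<close> of the sphere:
  \<open>\<theta> = arccos x\<^sub>3\<close> and \<open>\<phi>\<close> is the argument of \<open>x\<^sub>1 + \<i> x\<^sub>2\<close>. The poles lie outside the chart;
  there \<open>Arg 0 = 0\<close> selects \<open>\<phi> = 0\<close>, which amounts to a choice of the unimodular phase by
  which charts differ.\<close>

definition spin_Y :: "int \<Rightarrow> nat \<Rightarrow> int \<Rightarrow> real^3 \<Rightarrow> complex" where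
  "spin_Y s l m x =
     (-1) powi m * complex_of_real (sqrt ((2 * real l + 1) / (4 * pi))) *
     cis (real_of_int m * Arg (Complex (x $ 1) (x $ 2))) *
     complex_of_real (wigner_d l (- m) s (arccos (x $ 3)))"

definition spin_e :: "int \<Rightarrow> nat \<Rightarrow> real" where
  "spin_e s l = (real l - real_of_int s) * (real l + real_of_int s + 1)"

text \<open>Sums over \<open>l\<close> run over \<open>l \<ge> \<bar>s\<bar>\<close>, \<open>l \<ge> 1\<close>.\<close>

definition lmin :: "int \<Rightarrow> nat" where
  "lmin s = max 1 (nat \<bar>s\<bar>)"


section \<open>Spin needlets\<close>

text \<open>Derivatives of all orders exist on \<open>S\<close>; meant for open \<open>S\<close>.\<close>

definition smooth_on :: "real set \<Rightarrow> (real \<Rightarrow> real) \<Rightarrow> bool" where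
  "smooth_on S f \<longleftrightarrow> (\<forall>n. \<forall>x\<in>S. (deriv ^^ n) f field_differentiable (at x))"

definition needlet_window :: "real \<Rightarrow> (real \<Rightarrow> real) \<Rightarrow> bool" where
  "needlet_window B b \<longleftrightarrow>
     (\<forall>u. b u \<ge> 0) \<and>
     smooth_on UNIV b \<and>
     closure {u. b u \<noteq> 0} \<subseteq> {1 / B..B} \<and>
     (\<forall>u>0. ((\<lambda>j::int. (b (u / B powi j))\<^sup>2) has_sum 1) UNIV)"

text \<open>Level \<open>j\<close> has the points \<open>\<xi> j k\<close> and weights \<open>w j k\<close>, \<open>k < K j\<close>.\<close>

definition cubature ::
  "int \<Rightarrow> real \<Rightarrow> (nat \<Rightarrow> nat) \<Rightarrow> (nat \<Rightarrow> nat \<Rightarrow> real^3) \<Rightarrow> (nat \<Rightarrow> nat \<Rightarrow> real) \<Rightarrow> bool" where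
  "cubature s B K \<xi> w \<longleftrightarrow>
     (\<forall>j. \<forall>k<K j. \<xi> j k \<in> sphere 0 1 \<and> w j k > 0) \<and>
     (\<forall>j. \<xi> j ` {..<K j} \<subseteq> \<xi> (Suc j) ` {..<K (Suc j)}) \<and>
     (\<forall>j. (\<Sum>k<K j. w j k) = 4 * pi) \<and>
     (\<forall>j l l' m m'.
        \<bar>s\<bar> \<le> int l \<and> \<bar>s\<bar> \<le> int l' \<and> \<bar>m\<bar> \<le> int l \<and> \<bar>m'\<bar> \<le> int l' \<and>
        sqrt (spin_e s l) \<le> B ^ (j + 1) \<and> sqrt (spin_e s l') \<le> B ^ (j + 1) \<longrightarrow>
        (\<Sum>k<K j. complex_of_real (w j k) * spin_Y s l m (\<xi> j k) * cnj (spin_Y s l' m' (\<xi> j k))) =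
        (if l = l' \<and> m = m' then 1 else 0)) \<and>
     (\<exists>c>0. \<exists>c'>0. \<forall>j. \<forall>k<K j. c / B ^ (2 * j) \<le> w j k \<and> w j k \<le> c' / B ^ (2 * j)) \<and>
     (\<exists>c>0. \<exists>c'>0. \<forall>j. c * B ^ (2 * j) \<le> real (K j) \<and> real (K j) \<le> c' * B ^ (2 * j)) \<and>
     (\<exists>\<kappa>'>0. \<forall>j. \<forall>k<K j. \<forall>k'<K j. k \<noteq> k' \<longrightarrow> sphere_dist (\<xi> j k) (\<xi> j k') \<ge> \<kappa>' / B ^ j) \<and>
     (\<exists>\<kappa>>0. \<forall>j. \<forall>x\<in>sphere 0 1. \<exists>k<K j. sphere_dist x (\<xi> j k) \<le> \<kappa> / B ^ j)"

definition needlet ::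
  "int \<Rightarrow> real \<Rightarrow> (real \<Rightarrow> real) \<Rightarrow> (nat \<Rightarrow> nat \<Rightarrow> real^3) \<Rightarrow> (nat \<Rightarrow> nat \<Rightarrow> real) \<Rightarrow>
   nat \<Rightarrow> nat \<Rightarrow> real^3 \<Rightarrow> complex" where
  "needlet s B b \<xi> w j k x =
     complex_of_real (sqrt (w j k)) *
     (\<Sum>\<^sub>\<infinity>l\<in>{lmin s..}. complex_of_real (b (sqrt (spin_e s l) / B ^ j)) *
        (\<Sum>m = - int l..int l. spin_Y s l m x * cnj (spin_Y s l m (\<xi> j k))))"

definition needlet_coeff ::
  "int \<Rightarrow> real \<Rightarrow> (real \<Rightarrow> real) \<Rightarrow> (nat \<Rightarrow> nat \<Rightarrow> real^3) \<Rightarrow> (nat \<Rightarrow> nat \<Rightarrow> real) \<Rightarrow>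
   nat \<Rightarrow> nat \<Rightarrow> (real^3 \<Rightarrow> complex) \<Rightarrow> complex" where
  "needlet_coeff s B b \<xi> w j k f =
     (LINT x|sphere_measure. f x * cnj (needlet s B b \<xi> w j k x))"


section \<open>Gaussian isotropic spin fields\<close>

text \<open>Real Gaussian random variables, including the degenerate (constant) ones.\<close>

definition gaussian_rv :: "'w measure \<Rightarrow> ('w \<Rightarrow> real) \<Rightarrow> bool" where
  "gaussian_rv M X \<longleftrightarrow>
     X \<in> borel_measurable M \<and>
     (\<exists>\<mu>. (AE \<omega> in M. X \<omega> = \<mu>) \<or>
          (\<exists>\<sigma>>0. distributed M lborel X (\<lambda>x. ennreal (normal_density \<mu> \<sigma> x))))"

text \<open>Since \<open>Re ((p - \<i> q) z) = p Re z + q Im z\<close>, the combinations below are exactly the finite real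
  linear combinations of the real and imaginary parts of the family.\<close>

definition jointly_gaussian :: "'w measure \<Rightarrow> 'i set \<Rightarrow> ('i \<Rightarrow> 'w \<Rightarrow> complex) \<Rightarrow> bool" where
  "jointly_gaussian M I a \<longleftrightarrow>
     (\<forall>i\<in>I. a i \<in> borel_measurable M) \<and>
     (\<forall>J c. finite J \<and> J \<subseteq> I \<longrightarrow> gaussian_rv M (\<lambda>\<omega>. Re (\<Sum>i\<in>J. c i * a i \<omega>)))"

definition harmonic_indices :: "int \<Rightarrow> (nat \<times> int) set" where
  "harmonic_indices s = {(l, m). lmin s \<le> l \<and> \<bar>m\<bar> \<le> int l}"

text \<open>The expansion converges in mean square over the product of the probability space and the
  sphere. When \<open>\<Sum>\<^sub>l (2l+1) C\<^sub>l < \<infinity>\<close>, jointly measurable fields for which it converges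
  in mean square at each point are included, the pointwise tails being bounded by
  \<open>\<Sum>\<^sub>l\<^sub>>\<^sub>L C\<^sub>l (2l+1) / (4\<pi>)\<close>.\<close>

definition gaussian_spin_field ::
  "'w measure \<Rightarrow> int \<Rightarrow> (nat \<Rightarrow> real) \<Rightarrow> ('w \<Rightarrow> real^3 \<Rightarrow> complex) \<Rightarrow> bool" where
  "gaussian_spin_field M s C F \<longleftrightarrow>
     (\<lambda>(\<omega>, x). F \<omega> x) \<in> borel_measurable (M \<Otimes>\<^sub>M sphere_measure) \<and>
     (\<exists>a :: nat \<times> int \<Rightarrow> 'w \<Rightarrow> complex.
        jointly_gaussian M (harmonic_indices s) a \<and>
        (\<forall>i\<in>harmonic_indices s. (LINT \<omega>|M. a i \<omega>) = 0) \<and>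
        (\<forall>i\<in>harmonic_indices s. \<forall>i'\<in>harmonic_indices s.
           (LINT \<omega>|M. a i \<omega> * cnj (a i' \<omega>)) = (if i = i' then complex_of_real (C (fst i)) else 0) \<and>
           (LINT \<omega>|M. a i \<omega> * a i' \<omega>) = 0) \<and>
        (\<lambda>L. \<integral>\<^sup>+ (\<omega>, x). ennreal ((cmod (F \<omega> x -
             (\<Sum>l = lmin s..L. \<Sum>m = - int l..int l. a (l, m) \<omega> * spin_Y s l m x)))\<^sup>2)
             \<partial>(M \<Otimes>\<^sub>M sphere_measure)) \<longlonglongrightarrow> 0)"

text \<open>The case \<open>n = 0\<close> is left out: the size of \<open>g\<close> is only constrained at the integers,
  by \<open>c\<^sub>0\<close>. The constants do not depend on \<open>u\<close> or \<open>l\<close>.\<close>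

definition regular_spectrum :: "int \<Rightarrow> real \<Rightarrow> (nat \<Rightarrow> real) \<Rightarrow> bool" where
  "regular_spectrum s \<alpha> C \<longleftrightarrow>
     (\<exists>g :: real \<Rightarrow> real.
        (\<forall>l\<ge>lmin s. C l = real l powr (- \<alpha>) * g (real l) \<and> C l > 0) \<and>
        (\<exists>c\<^sub>0>0. \<forall>l\<ge>lmin s. inverse c\<^sub>0 \<le> g (real l) \<and> g (real l) \<le> c\<^sub>0) \<and>
        smooth_on {\<bar>real_of_int s\<bar><..} g \<and>
        (\<forall>n\<ge>1. \<exists>c>0. \<forall>u>\<bar>real_of_int s\<bar>. \<bar>(deriv ^^ n) g u\<bar> \<le> c * u powr (- real n)))"


section \<open>The cross-power-spectrum estimator\<close>

definition cp_sum ::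
  "int \<Rightarrow> real \<Rightarrow> (real \<Rightarrow> real) \<Rightarrow> (nat \<Rightarrow> nat) \<Rightarrow> (nat \<Rightarrow> nat \<Rightarrow> real^3) \<Rightarrow> (nat \<Rightarrow> nat \<Rightarrow> real) \<Rightarrow>
   nat \<Rightarrow> (nat \<Rightarrow> 'w \<Rightarrow> real^3 \<Rightarrow> complex) \<Rightarrow> nat \<Rightarrow> 'w \<Rightarrow> complex" where
  "cp_sum s B b K \<xi> w D T j \<omega> =
     1 / (of_nat D * (of_nat D - 1)) *
     (\<Sum>k<K j. \<Sum>r\<^sub>1 = 1..D. \<Sum>r\<^sub>2\<in>{1..D} - {r\<^sub>1}.
        needlet_coeff s B b \<xi> w j k (T r\<^sub>1 \<omega>) * cnj (needlet_coeff s B b \<xi> w j k (T r\<^sub>2 \<omega>)))"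

text \<open>The estimator is real, since the sum is symmetric in \<open>r\<^sub>1\<close> and \<open>r\<^sub>2\<close> (\<open>cp_estimator_eq\<close>).\<close>

definition cp_estimator ::
  "int \<Rightarrow> real \<Rightarrow> (real \<Rightarrow> real) \<Rightarrow> (nat \<Rightarrow> nat) \<Rightarrow> (nat \<Rightarrow> nat \<Rightarrow> real^3) \<Rightarrow> (nat \<Rightarrow> nat \<Rightarrow> real) \<Rightarrow>
   nat \<Rightarrow> (nat \<Rightarrow> 'w \<Rightarrow> real^3 \<Rightarrow> complex) \<Rightarrow> nat \<Rightarrow> 'w \<Rightarrow> real" where
  "cp_estimator s B b K \<xi> w D T j \<omega> = Re (cp_sum s B b K \<xi> w D T j \<omega>)"

lemma cp_estimator_eq:
  "complex_of_real (cp_estimator s B b K \<xi> w D T j \<omega>) = cp_sum s B b K \<xi> w D T j \<omega>"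
proof -
  have sym: "cnj (\<Sum>r\<^sub>1 = 1..D. \<Sum>r\<^sub>2\<in>{1..D} - {r\<^sub>1}. z r\<^sub>1 * cnj (z r\<^sub>2)) =
        (\<Sum>r\<^sub>1 = 1..D. \<Sum>r\<^sub>2\<in>{1..D} - {r\<^sub>1}. z r\<^sub>1 * cnj (z r\<^sub>2))" for z :: "nat \<Rightarrow> complex"
  proof -
    have diag: "(\<Sum>r\<^sub>2\<in>{1..D} - {r\<^sub>1}. z r\<^sub>1 * cnj (z r\<^sub>2)) =
          z r\<^sub>1 * (\<Sum>r = 1..D. cnj (z r)) - z r\<^sub>1 * cnj (z r\<^sub>1)" if "r\<^sub>1 \<in> {1..D}" for r\<^sub>1
      using that by (simp add: sum_diff1 sum_distrib_left)
    have "(\<Sum>r\<^sub>1 = 1..D. \<Sum>r\<^sub>2\<in>{1..D} - {r\<^sub>1}. z r\<^sub>1 * cnj (z r\<^sub>2)) =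
          (\<Sum>r = 1..D. z r) * cnj (\<Sum>r = 1..D. z r) - (\<Sum>r = 1..D. z r * cnj (z r))"
      using sum.cong[OF refl diag, of "{1..D}"] by (simp add: sum_subtractf sum_distrib_right)
    then show ?thesis
      by (simp add: mult.commute)
  qed
  have "cnj (cp_sum s B b K \<xi> w D T j \<omega>) = cp_sum s B b K \<xi> w D T j \<omega>"
    unfolding cp_sum_def complex_cnj_mult cnj_sum[of _ "{..<K j}"] sym by simp
  then show ?thesis
    by (simp add: cp_estimator_def complex_eq_iff)
qed

definition needlet_power ::
  "'w measure \<Rightarrow> int \<Rightarrow> real \<Rightarrow> (real \<Rightarrow> real) \<Rightarrow> (nat \<Rightarrow> nat) \<Rightarrow> (nat \<Rightarrow> nat \<Rightarrow> real^3) \<Rightarrow>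
   (nat \<Rightarrow> nat \<Rightarrow> real) \<Rightarrow> ('w \<Rightarrow> real^3 \<Rightarrow> complex) \<Rightarrow> nat \<Rightarrow> real" where
  "needlet_power M s B b K \<xi> w P j =
     (\<Sum>k<K j. LINT \<omega>|M. (cmod (needlet_coeff s B b \<xi> w j k (P \<omega>)))\<^sup>2)"

end

theory Submission
  imports Defs
begin

text \<open>Write \<open>a r\<close> for the harmonic coefficients of the signal (\<open>r = 0\<close>) and of the noise fields
  (\<open>1 \<le> r \<le> D\<close>). Since the window confines level \<open>j\<close> to multipoles for which the cubature is exact, summing
  over the cubature points turns the estimator, exactly, into a sum over the pairs \<open>(l, m)\<close> and over real and
  imaginary parts of independent quadratic forms, each in \<open>D + 1\<close> independent centred Gaussian variables (the
  parts of \<open>a r (l, m)\<close>). Quadratic forms in a fixed number of Gaussians have fourth central moment bounded by the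
  squared variance, and the \<open>2 (2l + 1)\<close> forms belonging to one \<open>l\<close> have the same variance. As \<open>l\<close> is of the
  order of \<open>B\<^sup>j\<close> in level \<open>j\<close>, no summand dominates and Lyapunov's criterion applies. There are of the order
  of \<open>B\<^sup>2\<^sup>j\<close> summands, with variances \<open>O(l\<^sup>-\<^sup>2\<^sup>\<mu>)\<close>, \<open>\<mu> = min \<alpha> \<gamma>\<close>.\<close>

section \<open>A central limit theorem for triangular arrays\<close>

text \<open>Leaving out \<open>r\<^sub>1 = r\<^sub>2\<close> removes every squared noise term, so
  the estimator has mean exactly \<open>needlet_power\<close> and there is no bias to control. The
  effort lies in reaching independent Gaussian variables. A needlet coefficient is an integral of a
  path over the sphere, whereas a field is given by a mean-square expansion; integral orthonormality
  of the spin harmonics, derived from Wigner's formula, and Bessel's inequality identify the path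
  integrals with the coefficients almost surely. Joint Gaussianity is known inside each field only,
  and independence across fields concerns the families of point values, for which a path integral
  need not be measurable; conditional expectations repair this. Both sources of independence are
  then merged in a single factorization of a joint characteristic function. Real and imaginary parts
  of one coefficient are independent with variance \<open>C l / 2\<close> each, because the
  expectations of the products without conjugation vanish.\<close>

lemma exp_minus_quadratic_approx:
  fixes y :: real
  assumes "y \<ge> 0"
  shows "\<bar>exp (- y) - (1 - y)\<bar> \<le> y\<^sup>2"
proof -
  have "exp (- y) \<le> 1 / (1 + y)"
    using exp_ge_add_one_self[of y] assms by (simp add: exp_minus field_simps)
  also have "\<dots> \<le> 1 - y + y\<^sup>2"
  proof -
    have "1 \<le> (1 - y + y\<^sup>2) * (1 + y)"
      using assms by (simp add: algebra_simps power2_eq_square)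
    then show ?thesis
      using assms by (simp add: pos_divide_le_eq)
  qed
  finally show ?thesis
    using exp_ge_add_one_self[of "-y"] by simp
qed

lemma power_le_one_plus_power4:
  fixes x :: real
  assumes "k \<le> 4"
  shows "\<bar>x ^ k\<bar> \<le> 1 + x ^ 4"
proof (cases "\<bar>x\<bar> \<le> 1")
  case True
  then have "\<bar>x\<bar> ^ k \<le> 1" by (simp add: power_le_one)
  then show ?thesis by (simp add: power_abs add_increasing2)
next
  case False
  then have "\<bar>x\<bar> ^ k \<le> \<bar>x\<bar> ^ 4" using assms by (intro power_increasing) auto
  then show ?thesis by (simp add: power_abs)
qed

lemma (in prob_space) integrable_power_le_4:
  fixes X :: "'a \<Rightarrow> real"
  assumes [measurable]: "X \<in> borel_measurable M" and "integrable M (\<lambda>\<omega>. X \<omega> ^ 4)" "k \<le> 4"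
  shows "integrable M (\<lambda>\<omega>. X \<omega> ^ k)"
proof (rule Bochner_Integration.integrable_bound)
  show "integrable M (\<lambda>\<omega>. 1 + X \<omega> ^ 4)" using assms by simp
  show "AE \<omega> in M. norm (X \<omega> ^ k) \<le> norm (1 + X \<omega> ^ 4)"
  proof (rule AE_I2)
    fix \<omega>
    show "norm (X \<omega> ^ k) \<le> norm (1 + X \<omega> ^ 4)"
      using power_le_one_plus_power4[OF assms(3), of "X \<omega>"] by simp
  qed
qed measurable

text \<open>Both functions are compared with 1 - t^2 v / 2, by the third-order Taylor bound for
  characteristic functions and by \<open>exp_minus_quadratic_approx\<close>. The bound keeps a
  factor \<open>v\<close>, so that errors can be summed over an array whose variances have a fixed
  total; the remaining factor is small with \<open>e\<close>.\<close>

lemma (in prob_space) char_gaussian_approx: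
  fixes X :: "'a \<Rightarrow> real"
  assumes X[measurable]: "X \<in> borel_measurable M" and int4: "integrable M (\<lambda>\<omega>. X \<omega> ^ 4)"
    and mean: "expectation X = 0" and v: "expectation (\<lambda>\<omega>. (X \<omega>)\<^sup>2) = v"
    and fourth: "expectation (\<lambda>\<omega>. X \<omega> ^ 4) \<le> \<kappa> * v\<^sup>2" and e: "v \<le> e" "0 < e" and \<kappa>: "0 \<le> \<kappa>"
  shows "cmod (char (distr M borel X) t - complex_of_real (exp (- (t\<^sup>2 * v / 2)))) \<le>
           (\<bar>t\<bar> ^ 3 * (1 + \<kappa>) * sqrt e + t ^ 4 * e) * v"
proof -
  interpret D: real_distribution "distr M borel X" by simp
  note int = integrable_power_le_4[OF X int4]
  have iX: "integrable M X" using int[of 1] by simp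
  have iX2: "integrable M (\<lambda>\<omega>. (X \<omega>)\<^sup>2)" using int[of 2] by simp
  have v0: "v \<ge> 0" unfolding v[symmetric] by (rule integral_nonneg_AE) simp
  have "cmod (char (distr M borel X) t - complex_of_real (1 - t\<^sup>2 * v / 2)) \<le>
      (t\<^sup>2 / 6) * D.expectation (\<lambda>x. min (6 * x\<^sup>2) (\<bar>t\<bar> * \<bar>x\<bar> ^ 3))"
    by (rule D.char_approx3) (use mean v iX iX2 in \<open>auto simp: integrable_distr_eq integral_distr\<close>)
  also have "D.expectation (\<lambda>x. min (6 * x\<^sup>2) (\<bar>t\<bar> * \<bar>x\<bar> ^ 3)) =
      expectation (\<lambda>\<omega>. min (6 * (X \<omega>)\<^sup>2) (\<bar>t\<bar> * \<bar>X \<omega>\<bar> ^ 3))"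
    by (rule integral_distr) auto
  \<comment> \<open>The third absolute moment is traded for the second and fourth: 2 x^3 <= sqrt e
    x^2 + x^4 / sqrt e is (sqrt e - x)^2 >= 0 in disguise. The weight sqrt e balances the terms, as
    the fourth moment is at most \<kappa> v^2 <= \<kappa> e v.\<close>
  also have "\<dots> \<le> expectation (\<lambda>\<omega>. \<bar>t\<bar> * ((sqrt e * (X \<omega>)\<^sup>2 + X \<omega> ^ 4 / sqrt e) / 2))"
  proof (rule integral_mono)
    show "integrable M (\<lambda>\<omega>. min (6 * (X \<omega>)\<^sup>2) (\<bar>t\<bar> * \<bar>X \<omega>\<bar> ^ 3))"
      by (rule Bochner_Integration.integrable_bound[where f="\<lambda>\<omega>. 6 * (X \<omega>)\<^sup>2"]) (use iX2 in auto)
    show "integrable M (\<lambda>\<omega>. \<bar>t\<bar> * ((sqrt e * (X \<omega>)\<^sup>2 + X \<omega> ^ 4 / sqrt e) / 2))"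
      using iX2 int4 by simp
    fix \<omega>
    define x where "x = \<bar>X \<omega>\<bar>"
    have x: "(X \<omega>)\<^sup>2 = x\<^sup>2" "X \<omega> ^ 4 = x ^ 4" by (simp_all add: x_def)
    have "0 \<le> x\<^sup>2 * (sqrt e - x)\<^sup>2" by simp
    also have "x\<^sup>2 * (sqrt e - x)\<^sup>2 = e * x\<^sup>2 + x ^ 4 - 2 * sqrt e * x ^ 3"
      using e by (simp add: power2_diff algebra_simps eval_nat_numeral)
    also have "\<dots> = (sqrt e * x\<^sup>2 + x ^ 4 / sqrt e - 2 * x ^ 3) * sqrt e"
    proof -
      have "sqrt e * sqrt e = e" using e by simp
      then show ?thesis using e by (simp add: algebra_simps)
    qed
    finally have "x ^ 3 \<le> (sqrt e * x\<^sup>2 + x ^ 4 / sqrt e) / 2"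
      using e by (simp add: zero_le_mult_iff)
    then have "\<bar>t\<bar> * x ^ 3 \<le> \<bar>t\<bar> * ((sqrt e * x\<^sup>2 + x ^ 4 / sqrt e) / 2)"
      by (intro mult_left_mono) auto
    then show "min (6 * (X \<omega>)\<^sup>2) (\<bar>t\<bar> * \<bar>X \<omega>\<bar> ^ 3) \<le> \<bar>t\<bar> * ((sqrt e * (X \<omega>)\<^sup>2 + X \<omega> ^ 4 / sqrt e) / 2)"
      unfolding x by (simp add: x_def)
  qed
  also have "\<dots> = \<bar>t\<bar> * ((sqrt e * v + expectation (\<lambda>\<omega>. X \<omega> ^ 4) / sqrt e) / 2)"
    using iX2 int4 v by simp
  also have "\<dots> \<le> \<bar>t\<bar> * ((1 + \<kappa>) * sqrt e * v)"
  proof (intro mult_left_mono)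
    have "expectation (\<lambda>\<omega>. X \<omega> ^ 4) / sqrt e \<le> \<kappa> * v\<^sup>2 / sqrt e"
      using fourth e by (intro divide_right_mono) auto
    also have "\<dots> \<le> \<kappa> * (e * v) / sqrt e"
      using e v0 \<kappa> by (intro divide_right_mono mult_left_mono) (auto simp: power2_eq_square mult_right_mono)
    also have "\<dots> = \<kappa> * sqrt e * v"
    proof -
      have "e / sqrt e = sqrt e" using e by (simp add: real_div_sqrt)
      then show ?thesis by (metis mult.assoc times_divide_eq_left times_divide_eq_right mult.commute)
    qed
    finally have "expectation (\<lambda>\<omega>. X \<omega> ^ 4) / sqrt e \<le> \<kappa> * sqrt e * v" .
    moreover have "0 \<le> sqrt e * v" "0 \<le> \<kappa> * sqrt e * v" using e v0 \<kappa> by auto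
    ultimately show "(sqrt e * v + expectation (\<lambda>\<omega>. X \<omega> ^ 4) / sqrt e) / 2 \<le> (1 + \<kappa>) * sqrt e * v"
      by (simp add: algebra_simps)
  qed simp
  finally have 1: "cmod (char (distr M borel X) t - complex_of_real (1 - t\<^sup>2 * v / 2)) \<le>
      t\<^sup>2 / 6 * (\<bar>t\<bar> * ((1 + \<kappa>) * sqrt e * v))"
    by (simp add: mult_left_mono)
  have 1: "cmod (char (distr M borel X) t - complex_of_real (1 - t\<^sup>2 * v / 2)) \<le> \<bar>t\<bar> ^ 3 * (1 + \<kappa>) * sqrt e * v"
  proof -
    have "t\<^sup>2 / 6 * (\<bar>t\<bar> * ((1 + \<kappa>) * sqrt e * v)) = (\<bar>t\<bar> ^ 3 * (1 + \<kappa>) * sqrt e * v) / 6"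
    proof -
      have "t\<^sup>2 = \<bar>t\<bar>\<^sup>2" by simp
      then show ?thesis by (simp only:) (simp add: power2_eq_square power3_eq_cube)
    qed
    moreover have "0 \<le> \<bar>t\<bar> ^ 3 * (1 + \<kappa>) * sqrt e * v" using v0 \<kappa> e by simp
    ultimately show ?thesis using 1 by linarith
  qed
  have "cmod (complex_of_real (1 - t\<^sup>2 * v / 2) - complex_of_real (exp (- (t\<^sup>2 * v / 2)))) =
      \<bar>exp (- (t\<^sup>2 * v / 2)) - (1 - t\<^sup>2 * v / 2)\<bar>"
    by (subst norm_minus_commute, subst norm_of_real[symmetric, where 'a=complex]) simp
  also have "\<dots> \<le> (t\<^sup>2 * v / 2)\<^sup>2"
    using v0 by (intro exp_minus_quadratic_approx) simp
  also have "\<dots> = (t ^ 4 * v / 4) * v"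
    by (simp add: power2_eq_square eval_nat_numeral)
  also have "\<dots> \<le> t ^ 4 * e * v"
  proof (intro mult_right_mono v0)
    have "t ^ 4 * v \<le> t ^ 4 * e" using e by (intro mult_left_mono) auto
    moreover have "0 \<le> t ^ 4 * v" using v0 by simp
    ultimately show "t ^ 4 * v / 4 \<le> t ^ 4 * e" by linarith
  qed
  finally have 2: "cmod (complex_of_real (1 - t\<^sup>2 * v / 2) - complex_of_real (exp (- (t\<^sup>2 * v / 2)))) \<le> t ^ 4 * e * v" .
  have "cmod (char (distr M borel X) t - complex_of_real (exp (- (t\<^sup>2 * v / 2)))) \<le>
    cmod (char (distr M borel X) t - complex_of_real (1 - t\<^sup>2 * v / 2)) +
    cmod (complex_of_real (1 - t\<^sup>2 * v / 2) - complex_of_real (exp (- (t\<^sup>2 * v / 2))))"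
    by (rule order_trans[OF _ norm_triangle_ineq]) simp
  then show ?thesis using 1 2 by (simp add: algebra_simps)
qed

text \<open>With fourth moments bounded by squared variances, Lyapunov's condition reduces to
  uniform smallness of each variance relative to the total. The total is asked to be positive only
  eventually, since low needlet levels may contain no multipole. The proof is Levy's continuity
  theorem.\<close>

theorem (in prob_space) lyapunov_central_limit:
  fixes I :: "nat \<Rightarrow> 'i set" and Y :: "nat \<Rightarrow> 'i \<Rightarrow> 'a \<Rightarrow> real" and \<kappa> :: real
  defines "v \<equiv> \<lambda>n i. expectation (\<lambda>\<omega>. (Y n i \<omega>)\<^sup>2)"
  assumes indep: "\<And>n. indep_vars (\<lambda>_. borel) (Y n) (I n)"
    and fin: "\<And>n. finite (I n)"
    and int4: "\<And>n i. i \<in> I n \<Longrightarrow> integrable M (\<lambda>\<omega>. Y n i \<omega> ^ 4)"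
    and mean: "\<And>n i. i \<in> I n \<Longrightarrow> expectation (Y n i) = 0"
    and fourth: "\<And>n i. i \<in> I n \<Longrightarrow> expectation (\<lambda>\<omega>. Y n i \<omega> ^ 4) \<le> \<kappa> * (v n i)\<^sup>2"
    and pos: "eventually (\<lambda>n. (\<Sum>i\<in>I n. v n i) > 0) sequentially"
    and negl: "\<And>n i. i \<in> I n \<Longrightarrow> v n i \<le> \<epsilon> n * (\<Sum>i\<in>I n. v n i)"
    and \<epsilon>: "\<And>n. \<epsilon> n > 0" "\<epsilon> \<longlonglongrightarrow> 0" and \<kappa>: "\<kappa> \<ge> 0"
  shows "weak_conv_m (\<lambda>n. distr M borel (\<lambda>\<omega>. (\<Sum>i\<in>I n. Y n i \<omega>) / sqrt (\<Sum>i\<in>I n. v n i)))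
           std_normal_distribution"
proof (rule levy_continuity)
  have meas[measurable]: "Y n i \<in> borel_measurable M" if "i \<in> I n" for n i
    using indep[of n] that by (auto simp: indep_vars_def)
  show "real_distribution (distr M borel (\<lambda>\<omega>. (\<Sum>i\<in>I n. Y n i \<omega>) / sqrt (\<Sum>i\<in>I n. v n i)))" for n
    by (rule real_distribution_distr) measurable
  show "real_distribution std_normal_distribution" by (rule real_dist_normal_dist)
  fix t :: real
  define s where "s n = (\<Sum>i\<in>I n. v n i)" for n
  let ?\<phi> = "\<lambda>n. char (distr M borel (\<lambda>\<omega>. (\<Sum>i\<in>I n. Y n i \<omega>) / sqrt (\<Sum>i\<in>I n. v n i))) t"
  have bound: "cmod (?\<phi> n - complex_of_real (exp (- (t\<^sup>2 / 2)))) \<le>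
      \<bar>t\<bar> ^ 3 * (1 + \<kappa>) * sqrt (\<epsilon> n) + t ^ 4 * \<epsilon> n" if s: "s n > 0" for n
  proof -
    let ?Z = "\<lambda>i \<omega>. Y n i \<omega> / sqrt (s n)"
    let ?w = "\<lambda>i. v n i / s n"
    have "?\<phi> n = char (distr M borel (\<lambda>\<omega>. \<Sum>i\<in>I n. ?Z i \<omega>)) t"
      by (simp add: s_def sum_divide_distrib)
    also have "\<dots> = (\<Prod>i\<in>I n. char (distr M borel (?Z i)) t)"
      by (rule char_distr_sum, rule indep_vars_compose2[where X="Y n", OF indep]) auto
    finally have 1: "?\<phi> n = (\<Prod>i\<in>I n. char (distr M borel (?Z i)) t)" .
    have sw: "(\<Sum>i\<in>I n. ?w i) = 1"
      using s by (simp add: s_def flip: sum_divide_distrib)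
    have 2: "complex_of_real (exp (- (t\<^sup>2 / 2))) = (\<Prod>i\<in>I n. complex_of_real (exp (- (t\<^sup>2 * ?w i / 2))))"
    proof -
      have "(\<Prod>i\<in>I n. exp (- (t\<^sup>2 * ?w i / 2))) = exp (\<Sum>i\<in>I n. - (t\<^sup>2 * ?w i / 2))"
        by (simp add: exp_sum fin)
      also have "(\<Sum>i\<in>I n. - (t\<^sup>2 * ?w i / 2)) = - (t\<^sup>2 / 2) * (\<Sum>i\<in>I n. ?w i)"
        unfolding sum_distrib_left by (rule sum.cong) (auto simp: field_simps)
      finally show ?thesis by (simp add: sw flip: of_real_prod)
    qed
    have v0: "v n i \<ge> 0" for i unfolding v_def by (rule integral_nonneg_AE) simp
    \<comment> \<open>Products of numbers of modulus at most 1 differ by at most the sum of the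
      differences of their factors. Each of these differences is a small constant times
      \<open>?w i\<close>, and the weights \<open>?w i\<close> sum to 1.\<close>
    have "cmod (?\<phi> n - complex_of_real (exp (- (t\<^sup>2 / 2)))) \<le>
      (\<Sum>i\<in>I n. cmod (char (distr M borel (?Z i)) t - complex_of_real (exp (- (t\<^sup>2 * ?w i / 2)))))"
      unfolding 1 2
    proof (rule norm_prod_diff)
      fix i assume i: "i \<in> I n"
      interpret D: real_distribution "distr M borel (?Z i)"
        by (rule real_distribution_distr) (use i in measurable)
      show "cmod (char (distr M borel (?Z i)) t) \<le> 1" by (rule D.cmod_char_le_1)
      have "exp (- (t\<^sup>2 * ?w i / 2)) \<le> 1" using v0[of i] s by simp
      then show "cmod (complex_of_real (exp (- (t\<^sup>2 * ?w i / 2)))) \<le> 1"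
        by (subst norm_of_real) simp
    qed
    also have "\<dots> \<le> (\<Sum>i\<in>I n. (\<bar>t\<bar> ^ 3 * (1 + \<kappa>) * sqrt (\<epsilon> n) + t ^ 4 * \<epsilon> n) * ?w i)"
    proof (rule sum_mono, rule char_gaussian_approx)
      fix i assume i: "i \<in> I n"
      show "?Z i \<in> borel_measurable M" using i by measurable
      show "integrable M (\<lambda>\<omega>. ?Z i \<omega> ^ 4)" using int4[OF i] by (simp add: power_divide)
      show "expectation (?Z i) = 0" using mean[OF i] by simp
      show "expectation (\<lambda>\<omega>. (?Z i \<omega>)\<^sup>2) = ?w i" using s by (simp add: power_divide v_def)
      have "sqrt (s n) ^ 4 = (s n)\<^sup>2"
        using s power_mult[of "sqrt (s n)" 2 2] by simp
      then have "expectation (\<lambda>\<omega>. ?Z i \<omega> ^ 4) = expectation (\<lambda>\<omega>. Y n i \<omega> ^ 4) / (s n)\<^sup>2"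
        by (simp add: power_divide)
      also have "\<dots> \<le> \<kappa> * (v n i)\<^sup>2 / (s n)\<^sup>2"
        by (rule divide_right_mono[OF fourth[OF i]]) simp
      finally show "expectation (\<lambda>\<omega>. ?Z i \<omega> ^ 4) \<le> \<kappa> * (?w i)\<^sup>2"
        by (simp add: power_divide)
      show "?w i \<le> \<epsilon> n" using negl[OF i] s by (simp add: s_def divide_le_eq)
    qed (use \<epsilon> \<kappa> in auto)
    also have "\<dots> = \<bar>t\<bar> ^ 3 * (1 + \<kappa>) * sqrt (\<epsilon> n) + t ^ 4 * \<epsilon> n"
      by (simp only: sum_distrib_left[symmetric] sw mult_1_right)
    finally show ?thesis .
  qed
  have lim: "(\<lambda>n. \<bar>t\<bar> ^ 3 * (1 + \<kappa>) * sqrt (\<epsilon> n) + t ^ 4 * \<epsilon> n) \<longlonglongrightarrow> 0"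
    using \<epsilon>(2) by (auto intro!: tendsto_eq_intros)
  have "(\<lambda>n. ?\<phi> n - complex_of_real (exp (- (t\<^sup>2 / 2)))) \<longlonglongrightarrow> 0"
    by (rule Lim_null_comparison[OF _ lim], rule eventually_mono[OF pos])
       (use bound in \<open>simp add: s_def\<close>)
  then show "?\<phi> \<longlonglongrightarrow> char std_normal_distribution t"
    by (simp add: LIM_zero_cancel char_std_normal_distribution)
qed

section \<open>Independence from characteristic functions\<close>

text \<open>After normalization \<open>u\<close> is a probability density. The hypothesis
  \<open>char\<close> says that \<open>X\<close> has the same characteristic function under the
  tilted measure as under \<open>M\<close>, hence the same law.\<close>

lemma (in prob_space) decouple_from_char_nonneg:
  fixes X u :: "'a \<Rightarrow> real"
  assumes [measurable]: "X \<in> borel_measurable M" "u \<in> borel_measurable M" and A[measurable]: "A \<in> sets borel"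
    and u: "\<And>\<omega>. u \<omega> \<ge> 0" "integrable M u" and pos: "expectation u > 0"
    and char: "\<And>t. (CLINT \<omega>|M. complex_of_real (u \<omega>) * iexp (t * X \<omega>)) =
                 complex_of_real (expectation u) * (CLINT \<omega>|M. iexp (t * X \<omega>))"
  shows "expectation (\<lambda>\<omega>. u \<omega> * indicator A (X \<omega>)) = expectation u * prob (X -` A \<inter> space M)"
proof -
  define m where "m = expectation u"
  let ?d = "\<lambda>\<omega>. ennreal (u \<omega> / m)"
  have m: "m > 0" using pos by (simp add: m_def)
  have "(\<integral>\<^sup>+\<omega>. ennreal (u \<omega> / m) \<partial>M) = ennreal (expectation (\<lambda>\<omega>. u \<omega> / m))"
    using u m by (intro nn_integral_eq_integral) auto
  then have one: "(\<integral>\<^sup>+\<omega>. ?d \<omega> \<partial>M) = 1" using m by (simp add: m_def)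
  interpret N: prob_space "density M ?d"
    by standard (simp add: emeasure_density one cong: nn_integral_cong)
  have real1: "real_distribution (distr (density M ?d) borel X)"
    by (rule N.real_distribution_distr) simp
  have real2: "real_distribution (distr M borel X)"
    by (rule real_distribution_distr) simp
  have "char (distr (density M ?d) borel X) = char (distr M borel X)"
  proof
    fix t
    have "char (distr (density M ?d) borel X) t = (CLINT \<omega>|density M ?d. iexp (t * X \<omega>))"
      by (simp add: char_def integral_distr)
    also have "\<dots> = (CLINT \<omega>|M. (u \<omega> / m) *\<^sub>R iexp (t * X \<omega>))"
      by (rule integral_density) (use u m in auto)
    also have "\<dots> = (CLINT \<omega>|M. (1 / complex_of_real m) * (complex_of_real (u \<omega>) * iexp (t * X \<omega>)))"
      by (rule Bochner_Integration.integral_cong) (auto simp: scaleR_conv_of_real)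
    also have "\<dots> = (1 / complex_of_real m) * (complex_of_real m * (CLINT \<omega>|M. iexp (t * X \<omega>)))"
      by (subst integral_mult_right_zero, subst char) (simp add: m_def)
    finally show "char (distr (density M ?d) borel X) t = char (distr M borel X) t"
      using m by (simp add: char_def integral_distr)
  qed
  then have "distr (density M ?d) borel X = distr M borel X"
    by (rule Levy_uniqueness[OF real1 real2])
  then have "measure (distr (density M ?d) borel X) A = prob (X -` A \<inter> space M)"
    by (simp add: measure_distr)
  moreover have "measure (distr (density M ?d) borel X) A = (LINT \<omega>|density M ?d. indicator A (X \<omega>))"
  proof -
    have "(LINT \<omega>|density M ?d. indicator A (X \<omega>) :: real) = (LINT x|distr (density M ?d) borel X. indicator A x)"
      by (subst integral_distr) auto
    then show ?thesis by simp
  qed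
  moreover have "\<dots> = (LINT \<omega>|M. (u \<omega> / m) * indicator A (X \<omega>))"
    by (subst integral_density) (use u m in auto)
  moreover have "\<dots> = expectation (\<lambda>\<omega>. u \<omega> * indicator A (X \<omega>)) / m"
    by simp
  ultimately show ?thesis using m by (simp add: m_def field_simps)
qed

text \<open>The claim is linear in \<open>u\<close> and trivial for constants, so \<open>u\<close>
  may be replaced by \<open>u + 2\<close>, which is a weight bounded below by 1.\<close>

lemma (in prob_space) decouple_from_char_real:
  fixes X u :: "'a \<Rightarrow> real"
  assumes [measurable]: "X \<in> borel_measurable M" "u \<in> borel_measurable M" and A[measurable]: "A \<in> sets borel"
    and u: "\<And>\<omega>. \<bar>u \<omega>\<bar> \<le> 1"
    and char: "\<And>t. (CLINT \<omega>|M. complex_of_real (u \<omega>) * iexp (t * X \<omega>)) =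
                 complex_of_real (expectation u) * (CLINT \<omega>|M. iexp (t * X \<omega>))"
  shows "expectation (\<lambda>\<omega>. u \<omega> * indicator A (X \<omega>)) = expectation u * prob (X -` A \<inter> space M)"
proof -
  have iu: "integrable M u"
    by (rule integrable_const_bound[where B=1]) (use u in auto)
  have iexpi: "integrable M (\<lambda>\<omega>. iexp (t * X \<omega>))" for t
    by (rule integrable_const_bound[where B=1]) (auto simp del: of_real_mult)
  have iuexp: "integrable M (\<lambda>\<omega>. complex_of_real (u \<omega>) * iexp (t * X \<omega>))" for t
    by (rule integrable_const_bound[where B=1]) (use u in \<open>auto simp: norm_mult simp del: of_real_mult\<close>)
  have iA: "integrable M (\<lambda>\<omega>. indicator A (X \<omega>) :: real)"
    by (rule integrable_const_bound[where B=1]) auto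
  have iuA: "integrable M (\<lambda>\<omega>. u \<omega> * indicator A (X \<omega>))"
    by (rule integrable_const_bound[where B=1]) (use u in \<open>auto simp: indicator_def\<close>)
  have "expectation u \<ge> expectation (\<lambda>_. -1)"
    by (rule integral_mono) (use iu u in \<open>auto simp: abs_le_iff minus_le_iff\<close>)
  then have e: "expectation (\<lambda>\<omega>. u \<omega> + 2) > 0" using iu by (simp add: prob_space)
  have "expectation (\<lambda>\<omega>. (u \<omega> + 2) * indicator A (X \<omega>)) = expectation (\<lambda>\<omega>. u \<omega> + 2) * prob (X -` A \<inter> space M)"
  proof (rule decouple_from_char_nonneg)
    show "0 \<le> u \<omega> + 2" for \<omega> using u[of \<omega>] by linarith
    fix t
    show "(CLINT \<omega>|M. complex_of_real (u \<omega> + 2) * iexp (t * X \<omega>)) =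
                 complex_of_real (expectation (\<lambda>\<omega>. u \<omega> + 2)) * (CLINT \<omega>|M. iexp (t * X \<omega>))"
      using iu iexpi[of t] iuexp[of t] char[of t] by (simp add: prob_space distrib_right)
  qed (use iu e in auto)
  moreover have "expectation (\<lambda>\<omega>. indicator A (X \<omega>)) = prob (X -` A \<inter> space M)"
  proof -
    have "expectation (\<lambda>\<omega>. indicator A (X \<omega>) :: real) = (LINT x|distr M borel X. indicator A x)"
      by (subst integral_distr) auto
    then show ?thesis by (simp add: measure_distr)
  qed
  ultimately show ?thesis using iu iA iuA by (simp add: prob_space distrib_right)
qed

text \<open>Real and imaginary parts are treated separately. They are combinations of
  \<open>w\<close> and its conjugate, and the factorization for the conjugate at \<open>t\<close> is
  the conjugate of the one for \<open>w\<close> at \<open>- t\<close>.\<close>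

lemma (in prob_space) decouple_from_char:
  fixes X :: "'a \<Rightarrow> real" and w :: "'a \<Rightarrow> complex"
  assumes [measurable]: "X \<in> borel_measurable M" "w \<in> borel_measurable M" and A[measurable]: "A \<in> sets borel"
    and w: "\<And>\<omega>. cmod (w \<omega>) \<le> 1"
    and char: "\<And>t. (CLINT \<omega>|M. w \<omega> * iexp (t * X \<omega>)) = expectation w * (CLINT \<omega>|M. iexp (t * X \<omega>))"
  shows "(CLINT \<omega>|M. w \<omega> * indicator A (X \<omega>)) = expectation w * prob (X -` A \<inter> space M)"
proof -
  let ?e = "\<lambda>t \<omega>. iexp (t * X \<omega>)"
  have iw: "integrable M w" by (rule integrable_const_bound[where B=1]) (use w in auto)
  have iwe: "integrable M (\<lambda>\<omega>. w \<omega> * ?e t \<omega>)" for t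
    by (rule integrable_const_bound[where B=1]) (use w in \<open>auto simp: norm_mult simp del: of_real_mult\<close>)
  have [measurable]: "(\<lambda>\<omega>. cnj (w \<omega>)) \<in> borel_measurable M"
    by (rule measurable_compose[OF assms(2) borel_measurable_continuous_onI]) (intro continuous_intros)
  have iwe': "integrable M (\<lambda>\<omega>. cnj (w \<omega>) * ?e t \<omega>)" for t
    by (rule integrable_const_bound[where B=1]) (use w in \<open>auto simp: norm_mult simp del: of_real_mult\<close>)
  have cnj_e: "?e t \<omega> = cnj (?e (- t) \<omega>)" for t \<omega>
    by (simp add: exp_cnj)
  have char': "(CLINT \<omega>|M. cnj (w \<omega>) * ?e t \<omega>) = cnj (expectation w) * (CLINT \<omega>|M. ?e t \<omega>)" for t
  proof -
    have "(CLINT \<omega>|M. cnj (w \<omega>) * ?e t \<omega>) = (CLINT \<omega>|M. cnj (w \<omega> * ?e (- t) \<omega>))"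
      unfolding cnj_e[of t] by simp
    also have "\<dots> = cnj (CLINT \<omega>|M. w \<omega> * ?e (- t) \<omega>)" by (simp only: Bochner_Integration.integral_cnj)
    also have "\<dots> = cnj (expectation w) * cnj (CLINT \<omega>|M. ?e (- t) \<omega>)" unfolding char by simp
    also have "cnj (CLINT \<omega>|M. ?e (- t) \<omega>) = (CLINT \<omega>|M. ?e t \<omega>)"
      unfolding cnj_e[of t] by (simp flip: Bochner_Integration.integral_cnj)
    finally show ?thesis .
  qed
  have re: "expectation (\<lambda>\<omega>. Re (w \<omega>) * indicator A (X \<omega>)) = expectation (\<lambda>\<omega>. Re (w \<omega>)) * prob (X -` A \<inter> space M)"
  proof (rule decouple_from_char_real)
    show "\<bar>Re (w \<omega>)\<bar> \<le> 1" for \<omega> using w[of \<omega>] abs_Re_le_cmod[of "w \<omega>"] by linarith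
    fix t
    have "(CLINT \<omega>|M. complex_of_real (Re (w \<omega>)) * ?e t \<omega>) = (CLINT \<omega>|M. (w \<omega> * ?e t \<omega> + cnj (w \<omega>) * ?e t \<omega>) / 2)"
      by (rule Bochner_Integration.integral_cong) (auto simp: complex_eq_iff algebra_simps)
    also have "\<dots> = ((CLINT \<omega>|M. w \<omega> * ?e t \<omega>) + (CLINT \<omega>|M. cnj (w \<omega>) * ?e t \<omega>)) / 2"
      using iwe[of t] iwe'[of t] by simp
    also have "\<dots> = ((expectation w + cnj (expectation w)) / 2) * (CLINT \<omega>|M. ?e t \<omega>)"
      unfolding char char' by (simp add: algebra_simps)
    also have "(expectation w + cnj (expectation w)) / 2 = complex_of_real (expectation (\<lambda>\<omega>. Re (w \<omega>)))"
      using iw by (simp add: complex_eq_iff)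
    finally show "(CLINT \<omega>|M. complex_of_real (Re (w \<omega>)) * ?e t \<omega>) =
      complex_of_real (expectation (\<lambda>\<omega>. Re (w \<omega>))) * (CLINT \<omega>|M. ?e t \<omega>)" .
  qed auto
  have im: "expectation (\<lambda>\<omega>. Im (w \<omega>) * indicator A (X \<omega>)) = expectation (\<lambda>\<omega>. Im (w \<omega>)) * prob (X -` A \<inter> space M)"
  proof (rule decouple_from_char_real)
    show "\<bar>Im (w \<omega>)\<bar> \<le> 1" for \<omega> using w[of \<omega>] abs_Im_le_cmod[of "w \<omega>"] by linarith
    fix t
    have "(CLINT \<omega>|M. complex_of_real (Im (w \<omega>)) * ?e t \<omega>) = (CLINT \<omega>|M. (w \<omega> * ?e t \<omega> - cnj (w \<omega>) * ?e t \<omega>) / (2 * \<i>))"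
      by (rule Bochner_Integration.integral_cong) (auto simp: complex_eq_iff Re_divide Im_divide algebra_simps power2_eq_square)
    also have "\<dots> = ((CLINT \<omega>|M. w \<omega> * ?e t \<omega>) - (CLINT \<omega>|M. cnj (w \<omega>) * ?e t \<omega>)) / (2 * \<i>)"
      using iwe[of t] iwe'[of t] by simp
    also have "\<dots> = ((expectation w - cnj (expectation w)) / (2 * \<i>)) * (CLINT \<omega>|M. ?e t \<omega>)"
      unfolding char char' by (simp add: algebra_simps diff_divide_distrib)
    also have "(expectation w - cnj (expectation w)) / (2 * \<i>) = complex_of_real (expectation (\<lambda>\<omega>. Im (w \<omega>)))"
      using iw by (simp add: complex_eq_iff Re_divide Im_divide power2_eq_square)
    finally show "(CLINT \<omega>|M. complex_of_real (Im (w \<omega>)) * ?e t \<omega>) =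
      complex_of_real (expectation (\<lambda>\<omega>. Im (w \<omega>))) * (CLINT \<omega>|M. ?e t \<omega>)" .
  qed auto
  have iwA: "integrable M (\<lambda>\<omega>. w \<omega> * indicator A (X \<omega>))"
    by (rule integrable_const_bound[where B=1]) (use w in \<open>auto simp: indicator_def\<close>)
  have ind: "indicator A x = complex_of_real (indicator A x)" for x by (simp add: indicator_def)
  have "Re (CLINT \<omega>|M. w \<omega> * indicator A (X \<omega>)) = expectation (\<lambda>\<omega>. Re (w \<omega>) * indicator A (X \<omega>))"
    unfolding integral_Re[OF iwA, symmetric] by (rule Bochner_Integration.integral_cong) (auto simp: ind)
  moreover have "Im (CLINT \<omega>|M. w \<omega> * indicator A (X \<omega>)) = expectation (\<lambda>\<omega>. Im (w \<omega>) * indicator A (X \<omega>))"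
    unfolding integral_Im[OF iwA, symmetric] by (rule Bochner_Integration.integral_cong) (auto simp: ind)
  ultimately show ?thesis
    using iw re im by (simp add: complex_eq_iff)
qed


text \<open>One coordinate at a time, the exponentials \<open>e\<^sup>i\<^sup>t\<^sup>X\<close> are exchanged for indicators, each time by
  uniqueness of one-dimensional characteristic functions under a tilted measure.\<close>

lemma (in prob_space) indep_vars_if_char_factorizes:
  fixes X :: "'i \<Rightarrow> 'a \<Rightarrow> real"
  assumes Q: "finite Q" and meas: "\<And>q. q \<in> Q \<Longrightarrow> X q \<in> borel_measurable M"
    and char: "\<And>t. (CLINT \<omega>|M. iexp (\<Sum>q\<in>Q. t q * X q \<omega>)) = (\<Prod>q\<in>Q. CLINT \<omega>|M. iexp (t q * X q \<omega>))"
  shows "indep_vars (\<lambda>_. borel) X Q"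
proof (cases "Q = {}")
  \<comment> \<open>Treated apart because the empty intersection of events below would be
    \<open>UNIV\<close> and not \<open>space M\<close>.\<close>
  case True
  then show ?thesis by (simp add: indep_vars_def indep_sets_def)
next
  case False
  define \<phi> where "\<phi> q t = (CLINT \<omega>|M. iexp (t * X q \<omega>))" for q t
  define \<pi> where "\<pi> q A = prob (X q -` A \<inter> space M)" for q A
  have step: "(CLINT \<omega>|M. (\<Prod>q\<in>S. indicator (A q) (X q \<omega>)) * (\<Prod>q\<in>Q - S. iexp (t q * X q \<omega>))) =
        (\<Prod>q\<in>S. complex_of_real (\<pi> q (A q))) * (\<Prod>q\<in>Q - S. \<phi> q (t q))"
    if "S \<subseteq> Q" "\<And>q. q \<in> Q \<Longrightarrow> A q \<in> sets borel" for S A t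
    using finite_subset[OF that(1) Q] that
  proof (induction S arbitrary: t rule: finite_induct)
    case empty
    have "(CLINT \<omega>|M. (\<Prod>q\<in>Q. iexp (t q * X q \<omega>))) = (CLINT \<omega>|M. iexp (\<Sum>q\<in>Q. t q * X q \<omega>))"
      by (simp add: exp_sum Q sum_distrib_left)
    then show ?case using char[of t] by (simp add: \<phi>_def)
  next
    case (insert p S)
    then have p: "p \<in> Q" "p \<notin> S" "p \<in> Q - S" and S: "S \<subseteq> Q" and A: "\<And>q. q \<in> Q \<Longrightarrow> A q \<in> sets borel" by auto
    have [measurable]: "X q \<in> borel_measurable M" if "q \<in> Q" for q using meas that .
    have [measurable]: "X q \<in> borel_measurable M" if "q \<in> S" for q using meas that S by auto
    have [measurable]: "X p \<in> borel_measurable M" using p meas by auto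
    have [measurable]: "A q \<in> sets borel" if "q \<in> S" for q using A that S by auto
    have [measurable]: "A p \<in> sets borel" using A p by auto
    let ?R = "Q - insert p S"
    have R: "Q - S = insert p ?R" "finite ?R" "p \<notin> ?R" using p Q by auto
    define w where "w \<omega> = (\<Prod>q\<in>S. indicator (A q) (X q \<omega>)) * (\<Prod>q\<in>?R. iexp (t q * X q \<omega>))" for \<omega>
    have w[measurable]: "w \<in> borel_measurable M" unfolding w_def by measurable
    have wb: "cmod (w \<omega>) \<le> 1" for \<omega>
    proof -
      have "(\<Prod>q\<in>S. cmod (indicator (A q) (X q \<omega>))) \<le> 1" by (rule prod_le_1) (auto simp: indicator_def)
      moreover have "(\<Prod>q\<in>?R. cmod (iexp (t q * X q \<omega>))) = 1" by (rule prod.neutral) (auto simp del: of_real_mult)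
      ultimately show ?thesis unfolding w_def norm_mult prod_norm[symmetric] by simp
    qed
    let ?C = "(\<Prod>q\<in>S. complex_of_real (\<pi> q (A q))) * (\<Prod>q\<in>?R. \<phi> q (t q))"
    \<comment> \<open>The induction hypothesis with the frequency of coordinate \<open>p\<close>
      left free: all other factors are collected in \<open>w\<close>, and varying \<open>u\<close>
      gives exactly the decoupling hypothesis. The value \<open>u = 0\<close> identifies the
      constant as the mean of \<open>w\<close>.\<close>
    have eq: "(CLINT \<omega>|M. w \<omega> * iexp (u * X p \<omega>)) = ?C * \<phi> p u" for u
    proof -
      let ?t = "t(p := u)"
      have "(CLINT \<omega>|M. (\<Prod>q\<in>S. indicator (A q) (X q \<omega>)) * (\<Prod>q\<in>Q - S. iexp (?t q * X q \<omega>))) =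
        (\<Prod>q\<in>S. complex_of_real (\<pi> q (A q))) * (\<Prod>q\<in>Q - S. \<phi> q (?t q))"
        by (rule insert.IH[OF S A])
      moreover have "(\<Prod>q\<in>Q - S. \<phi> q (?t q)) = \<phi> p u * (\<Prod>q\<in>?R. \<phi> q (t q))"
      proof -
        have "(\<Prod>q\<in>?R. \<phi> q (?t q)) = (\<Prod>q\<in>?R. \<phi> q (t q))" by (rule prod.cong) auto
        then show ?thesis unfolding R(1) prod.insert[OF R(2,3)] by simp
      qed
      moreover have "(\<Prod>q\<in>Q - S. iexp (?t q * X q \<omega>)) = iexp (u * X p \<omega>) * (\<Prod>q\<in>?R. iexp (t q * X q \<omega>))" for \<omega>
      proof -
        have "(\<Prod>q\<in>?R. iexp (?t q * X q \<omega>)) = (\<Prod>q\<in>?R. iexp (t q * X q \<omega>))" by (rule prod.cong) auto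
        then show ?thesis unfolding R(1) prod.insert[OF R(2,3)] by simp
      qed
      ultimately show ?thesis unfolding w_def by (simp only: mult_ac)
    qed
    have Ew: "expectation w = ?C"
      using eq[of 0] by (simp add: \<phi>_def prob_space)
    have "(CLINT \<omega>|M. w \<omega> * indicator (A p) (X p \<omega>)) = expectation w * prob (X p -` A p \<inter> space M)"
      by (rule decouple_from_char) (use wb eq Ew in \<open>auto simp: \<phi>_def\<close>)
    moreover have "(\<Prod>q\<in>insert p S. indicator (A q) (X q \<omega>)) * (\<Prod>q\<in>?R. iexp (t q * X q \<omega>)) =
        w \<omega> * indicator (A p) (X p \<omega>)" for \<omega>
      unfolding w_def prod.insert[OF insert.hyps(1) p(2)] by (simp only: mult_ac)
    moreover have "(\<Prod>q\<in>insert p S. complex_of_real (\<pi> q (A q))) = \<pi> p (A p) * (\<Prod>q\<in>S. complex_of_real (\<pi> q (A q)))"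
      by (rule prod.insert[OF insert.hyps(1) p(2)])
    ultimately show ?case
      unfolding Ew \<pi>_def[symmetric] by (simp only: mult_ac)
  qed
  have "prob (\<Inter>q\<in>Q. X q -` A q \<inter> space M) = (\<Prod>q\<in>Q. \<pi> q (A q))"
    if A: "\<And>q. q \<in> Q \<Longrightarrow> A q \<in> sets borel" for A
  proof -
    have "(CLINT \<omega>|M. (\<Prod>q\<in>Q. indicator (A q) (X q \<omega>))) = (\<Prod>q\<in>Q. complex_of_real (\<pi> q (A q)))"
      using step[OF order_refl A] by simp
    moreover have "(CLINT \<omega>|M. (\<Prod>q\<in>Q. indicator (A q) (X q \<omega>))) =
        (CLINT \<omega>|M. complex_of_real (indicator (\<Inter>q\<in>Q. X q -` A q \<inter> space M) \<omega>))"
    proof (rule Bochner_Integration.integral_cong[OF refl])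
      fix \<omega> assume "\<omega> \<in> space M"
      then show "(\<Prod>q\<in>Q. indicator (A q) (X q \<omega>)) = complex_of_real (indicator (\<Inter>q\<in>Q. X q -` A q \<inter> space M) \<omega>)"
        using False by (auto simp: indicator_def Q)
    qed
    moreover have "(\<Inter>q\<in>Q. X q -` A q \<inter> space M) \<in> events"
      using A meas Q False by (intro sets.finite_INT measurable_sets) auto
    ultimately show ?thesis by (simp flip: of_real_prod)
  qed
  note prods = this
  have "indep_sets (\<lambda>q. {X q -` A \<inter> space M |A. A \<in> sets borel}) Q"
  proof (subst indep_sets_finite[OF False Q])
    show "{X q -` A \<inter> space M |A. A \<in> sets borel} \<subseteq> events" if "q \<in> Q" for q
      using meas[OF that] by auto
    show "space M \<in> {X q -` A \<inter> space M |A. A \<in> sets borel}" if "q \<in> Q" for q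
      by (auto intro!: exI[of _ UNIV])
    show "\<forall>E\<in>\<Pi> q\<in>Q. {X q -` A \<inter> space M |A. A \<in> sets borel}. prob (\<Inter>j\<in>Q. E j) = (\<Prod>j\<in>Q. prob (E j))"
    proof
      fix E assume "E \<in> (\<Pi> q\<in>Q. {X q -` A \<inter> space M |A. A \<in> sets borel})"
      then have "\<forall>q\<in>Q. \<exists>A. A \<in> sets borel \<and> E q = X q -` A \<inter> space M" by (auto simp: Pi_iff)
      then obtain A where A: "\<And>q. q \<in> Q \<Longrightarrow> A q \<in> sets borel" "\<And>q. q \<in> Q \<Longrightarrow> E q = X q -` A q \<inter> space M"
        by metis
      then show "prob (\<Inter>j\<in>Q. E j) = (\<Prod>j\<in>Q. prob (E j))"
        using prods[of A] by (simp add: \<pi>_def)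
    qed
  qed
  then show ?thesis using meas by (simp add: indep_vars_def2)
qed


section \<open>Centred Gaussian variables\<close>

text \<open>A positive variance excludes the constant variables that \<open>gaussian_rv\<close>
  admits.\<close>

lemma (in prob_space) gaussian_rv_distributed:
  assumes X: "gaussian_rv M X" and mean: "expectation X = 0" and v: "expectation (\<lambda>\<omega>. (X \<omega>)\<^sup>2) = v" "v > 0"
  shows "distributed M lborel X (normal_density 0 (sqrt v))"
proof -
  have [measurable]: "X \<in> borel_measurable M" using X by (simp add: gaussian_rv_def)
  from X consider \<mu> where "AE \<omega> in M. X \<omega> = \<mu>"
    | \<mu> \<sigma> where "\<sigma> > 0" "distributed M lborel X (\<lambda>x. ennreal (normal_density \<mu> \<sigma> x))"
    by (auto simp: gaussian_rv_def)
  then show ?thesis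
  proof cases
    case (1 \<mu>)
    then have "expectation X = expectation (\<lambda>_. \<mu>)" by (intro integral_cong_AE) auto
    then have "\<mu> = 0" using mean by (simp add: prob_space)
    then have "expectation (\<lambda>\<omega>. (X \<omega>)\<^sup>2) = expectation (\<lambda>_. 0)" using 1 by (intro integral_cong_AE) auto
    then show ?thesis using v by simp
  next
    case (2 \<mu> \<sigma>)
    have \<mu>: "\<mu> = 0" using normal_distributed_expectation[OF 2(1,2)] mean by simp
    have "\<sigma>\<^sup>2 = v" using normal_distributed_variance[OF 2] mean v by simp
    then have "sqrt v = \<sigma>" using 2 by auto
    then show ?thesis using 2 \<mu> by simp
  qed
qed

text \<open>Degenerate variables have to be covered, since the frequencies at which this is applied
  may all vanish.\<close>

lemma (in prob_space) char_gaussian_rv: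
  assumes X: "gaussian_rv M X" and mean: "expectation X = 0" and v: "expectation (\<lambda>\<omega>. (X \<omega>)\<^sup>2) = v"
    and int: "integrable M (\<lambda>\<omega>. (X \<omega>)\<^sup>2)"
  shows "(CLINT \<omega>|M. iexp (X \<omega>)) = complex_of_real (exp (- v / 2))"
proof -
  have [measurable]: "X \<in> borel_measurable M" using X by (simp add: gaussian_rv_def)
  have "v \<ge> 0" unfolding v[symmetric] by (rule integral_nonneg_AE) simp
  show ?thesis
  proof (cases "v = 0")
    case True
    then have "AE \<omega> in M. (X \<omega>)\<^sup>2 = 0" using v int by (subst integral_nonneg_eq_0_iff_AE[symmetric]) auto
    then have "(CLINT \<omega>|M. iexp (X \<omega>)) = (CLINT \<omega>|M. 1)" by (intro integral_cong_AE) auto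
    then show ?thesis using True by (simp add: prob_space)
  next
    case False
    then have vp: "v > 0" using \<open>v \<ge> 0\<close> by simp
    have "distributed M lborel X (normal_density 0 (sqrt v))"
      by (rule gaussian_rv_distributed[OF X mean v vp])
    then have d: "distributed M lborel (\<lambda>\<omega>. X \<omega> / sqrt v) std_normal_density"
      using normal_standard_normal_convert[of "sqrt v" X 0] vp by simp
    then have "distr M lborel (\<lambda>\<omega>. X \<omega> / sqrt v) = std_normal_distribution"
      by (simp add: distributed_distr_eq_density)
    then have "char std_normal_distribution (sqrt v) = (CLINT \<omega>|M. iexp (X \<omega>))"
      using vp by (simp add: char_def integral_distr flip: \<open>distr M lborel _ = _\<close>)
    then show ?thesis using vp by (simp add: char_std_normal_distribution)
  qed
qed

lemma (in prob_space) centred_normal_moments: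
  assumes d: "distributed M lborel X (normal_density 0 \<sigma>)" and \<sigma>: "\<sigma> > 0"
  shows "integrable M (\<lambda>\<omega>. X \<omega> ^ k)"
    and "expectation (\<lambda>\<omega>. X \<omega> ^ (2 * n)) = fact (2 * n) / (2 ^ n * fact n) * \<sigma> ^ (2 * n)"
    and "expectation (\<lambda>\<omega>. X \<omega> ^ (2 * n + 1)) = 0"
proof -
  show "integrable M (\<lambda>\<omega>. X \<omega> ^ k)"
    using integrable_normal_moment[OF \<sigma>, of 0 k] distributed_integrable[OF d, of "\<lambda>x. x ^ k"] by simp
  show "expectation (\<lambda>\<omega>. X \<omega> ^ (2 * n)) = fact (2 * n) / (2 ^ n * fact n) * \<sigma> ^ (2 * n)"
    using integral_normal_moment_even[OF \<sigma>, of 0 n] distributed_integral[OF d, of "\<lambda>x. x ^ (2 * n)"] \<sigma>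
    by (simp add: power_divide power_mult)
  show "expectation (\<lambda>\<omega>. X \<omega> ^ (2 * n + 1)) = 0"
    using integral_normal_moment_odd[OF \<sigma>, of 0 n] distributed_integral[OF d, of "\<lambda>x. x ^ (2 * n + 1)"]
    by simp
qed

section \<open>Quadratic forms in independent Gaussian variables\<close>

text \<open>The Cauchy-Schwarz inequality, applied to the sum and then to the sum of
  squares.\<close>

lemma sum_power4_le:
  fixes x :: "'p \<Rightarrow> real"
  shows "(\<Sum>p\<in>P. x p) ^ 4 \<le> real (card P) ^ 3 * (\<Sum>p\<in>P. x p ^ 4)"
proof -
  have "((\<Sum>p\<in>P. x p)\<^sup>2)\<^sup>2 \<le> ((\<Sum>p\<in>P. (x p)\<^sup>2) * card P)\<^sup>2"
    by (rule power_mono[OF sum_squared_le_sum_of_squares]) auto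
  also have "\<dots> = (real (card P))\<^sup>2 * (\<Sum>p\<in>P. (x p)\<^sup>2)\<^sup>2"
    by (simp add: power_mult_distrib)
  also have "\<dots> \<le> (real (card P))\<^sup>2 * ((\<Sum>p\<in>P. ((x p)\<^sup>2)\<^sup>2) * card P)"
    by (rule mult_left_mono[OF sum_squared_le_sum_of_squares]) auto
  finally show ?thesis
    by (simp add: eval_nat_numeral mult_ac)
qed

lemma sum_power2_le_power2_sum:
  fixes x :: "'p \<Rightarrow> real"
  assumes "finite P" "\<And>p. p \<in> P \<Longrightarrow> x p \<ge> 0"
  shows "(\<Sum>p\<in>P. (x p)\<^sup>2) \<le> (\<Sum>p\<in>P. x p)\<^sup>2"
proof -
  have "(\<Sum>p\<in>P. (x p)\<^sup>2) \<le> (\<Sum>p\<in>P. x p * (\<Sum>p\<in>P. x p))"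
    using assms by (intro sum_mono) (auto simp: power2_eq_square intro!: mult_left_mono member_le_sum)
  then show ?thesis by (simp add: power2_eq_square sum_distrib_right)
qed

locale independent_normals = prob_space +
  fixes Q :: "'q set" and V :: "'q \<Rightarrow> 'a \<Rightarrow> real" and \<sigma> :: "'q \<Rightarrow> real"
  assumes fin: "finite Q" and indep: "indep_vars (\<lambda>_. borel) V Q"
    and normal: "\<And>q. q \<in> Q \<Longrightarrow> distributed M lborel (V q) (normal_density 0 (\<sigma> q))"
    and pos: "\<And>q. q \<in> Q \<Longrightarrow> \<sigma> q > 0"
begin

lemma measV[measurable]: "q \<in> Q \<Longrightarrow> V q \<in> borel_measurable M"
  using indep by (auto simp: indep_vars_def)

lemma moment_prod:
  shows "integrable M (\<lambda>\<omega>. \<Prod>q\<in>Q. V q \<omega> ^ n q)"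
    and "expectation (\<lambda>\<omega>. \<Prod>q\<in>Q. V q \<omega> ^ n q) = (\<Prod>q\<in>Q. expectation (\<lambda>\<omega>. V q \<omega> ^ n q))"
proof -
  have i: "indep_vars (\<lambda>_. borel) (\<lambda>q \<omega>. V q \<omega> ^ n q) Q"
    by (rule indep_vars_compose2[OF indep]) auto
  have int: "integrable M (\<lambda>\<omega>. V q \<omega> ^ n q)" if "q \<in> Q" for q
    by (rule centred_normal_moments(1)[OF normal[OF that] pos[OF that]])
  show "integrable M (\<lambda>\<omega>. \<Prod>q\<in>Q. V q \<omega> ^ n q)"
    by (rule indep_vars_integrable[OF fin i int])
  show "expectation (\<lambda>\<omega>. \<Prod>q\<in>Q. V q \<omega> ^ n q) = (\<Prod>q\<in>Q. expectation (\<lambda>\<omega>. V q \<omega> ^ n q))"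
    by (rule indep_vars_lebesgue_integral[OF fin i int])
qed

text \<open>A single factor is encoded as a product over all of \<open>Q\<close>. Multiplying
  several such products adds the exponents, so coinciding indices need no separate treatment and
  every mixed moment becomes an instance of \<open>moment_prod\<close>.\<close>

lemma prod_delta_power:
  assumes "a \<in> Q"
  shows "(\<Prod>q\<in>Q. V q \<omega> ^ (of_bool (a = q) * k)) = V a \<omega> ^ k"
proof -
  have "(\<Prod>q\<in>Q. V q \<omega> ^ (of_bool (a = q) * k)) = (\<Prod>q\<in>Q. if a = q then V q \<omega> ^ k else 1)"
    by (rule prod.cong) auto
  then show ?thesis using assms fin by (simp add: prod.delta')
qed

lemma moment_values:
  assumes "q \<in> Q"
  shows "expectation (\<lambda>\<omega>. V q \<omega> ^ 0) = 1" "expectation (\<lambda>\<omega>. V q \<omega> ^ Suc 0) = 0"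
    "expectation (\<lambda>\<omega>. V q \<omega> ^ 2) = (\<sigma> q)\<^sup>2" "expectation (\<lambda>\<omega>. V q \<omega> ^ 3) = 0"
    "expectation (\<lambda>\<omega>. V q \<omega> ^ 4) = 3 * ((\<sigma> q)\<^sup>2)\<^sup>2" "expectation (\<lambda>\<omega>. V q \<omega> ^ 8) = 105 * ((\<sigma> q)\<^sup>2) ^ 4"
proof -
  note m = centred_normal_moments(2,3)[OF normal[OF assms] pos[OF assms]]
  show "expectation (\<lambda>\<omega>. V q \<omega> ^ 0) = 1" by (simp add: prob_space)
  show "expectation (\<lambda>\<omega>. V q \<omega> ^ Suc 0) = 0" using m(2)[of 0] by simp
  show "expectation (\<lambda>\<omega>. V q \<omega> ^ 2) = (\<sigma> q)\<^sup>2" using m(1)[of 1] by (simp add: fact_numeral)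
  show "expectation (\<lambda>\<omega>. V q \<omega> ^ 3) = 0" using m(2)[of 1] by (simp add: numeral_3_eq_3)
  show "expectation (\<lambda>\<omega>. V q \<omega> ^ 4) = 3 * ((\<sigma> q)\<^sup>2)\<^sup>2" using m(1)[of 2] by (simp add: fact_numeral)
  show "expectation (\<lambda>\<omega>. V q \<omega> ^ 8) = 105 * ((\<sigma> q)\<^sup>2) ^ 4" using m(1)[of 4] by (simp add: fact_numeral)
qed

text \<open>The exponent \<open>?n q\<close> counts the occurrences of \<open>q\<close> among the
  four indices. An index occurring once contributes a vanishing first moment; otherwise the indices
  pair up. If all four coincide, the three pairings together give the fourth moment 3
  \<sigma>^4.\<close>

lemma isserlis:
  assumes "a \<in> Q" "b \<in> Q" "c \<in> Q" "d \<in> Q"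
  shows "integrable M (\<lambda>\<omega>. V a \<omega> * V b \<omega> * (V c \<omega> * V d \<omega>))" (is ?int)
    and "expectation (\<lambda>\<omega>. V a \<omega> * V b \<omega> * (V c \<omega> * V d \<omega>)) =
          of_bool (a = b \<and> c = d) * ((\<sigma> a)\<^sup>2 * (\<sigma> c)\<^sup>2) +
          (of_bool (a = c \<and> b = d) + of_bool (a = d \<and> b = c)) * ((\<sigma> a)\<^sup>2 * (\<sigma> b)\<^sup>2)" (is ?eq)
proof -
  let ?n = "\<lambda>q. of_bool (a = q) * 1 + of_bool (b = q) * 1 + (of_bool (c = q) * 1 + of_bool (d = q) * 1 :: nat)"
  have eq: "(\<Prod>q\<in>Q. V q \<omega> ^ ?n q) = V a \<omega> * V b \<omega> * (V c \<omega> * V d \<omega>)" for \<omega>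
    unfolding power_add prod.distrib prod_delta_power[OF assms(1)] prod_delta_power[OF assms(2)]
      prod_delta_power[OF assms(3)] prod_delta_power[OF assms(4)] by simp
  show ?int using moment_prod(1)[of ?n] unfolding eq .
  have "expectation (\<lambda>\<omega>. V a \<omega> * V b \<omega> * (V c \<omega> * V d \<omega>)) = (\<Prod>q\<in>Q. expectation (\<lambda>\<omega>. V q \<omega> ^ ?n q))"
    using moment_prod(2)[of ?n] unfolding eq .
  also have "\<dots> = (\<Prod>q\<in>{a, b, c, d}. expectation (\<lambda>\<omega>. V q \<omega> ^ ?n q))"
    using assms by (intro prod.mono_neutral_right fin) (auto simp: prob_space)
  also have "\<dots> = of_bool (a = b \<and> c = d) * ((\<sigma> a)\<^sup>2 * (\<sigma> c)\<^sup>2) +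
          (of_bool (a = c \<and> b = d) + of_bool (a = d \<and> b = c)) * ((\<sigma> a)\<^sup>2 * (\<sigma> b)\<^sup>2)"
  proof -
    note mv = moment_values[OF assms(1)] moment_values[OF assms(2)] moment_values[OF assms(3)] moment_values[OF assms(4)]
    have n: "Suc (Suc 0) = 2" "Suc 2 = 3" "Suc (Suc (Suc (Suc 0))) = 4" "Suc 3 = 4" by simp_all
    \<comment> \<open>Four indices of which none occurs exactly once either all coincide or form two
      different pairs.\<close>
    consider "a = b" "c = d" "a = c" | "a = b" "c = d" "a \<noteq> c" | "a = c" "b = d" "a \<noteq> b" | "a = d" "b = c" "a \<noteq> b"
      | q where "q \<in> {a, b, c, d}" "?n q = Suc 0" "\<not> (a = b \<and> c = d)" "\<not> (a = c \<and> b = d)" "\<not> (a = d \<and> b = c)"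
    proof -
      have "?n q = Suc 0" if "q = a \<and> a \<notin> {b, c, d} \<or> q = b \<and> b \<notin> {a, c, d} \<or> q = c \<and> c \<notin> {a, b, d} \<or> q = d \<and> d \<notin> {a, b, c}" for q
        using that by auto
      then show ?thesis using that by blast
    qed
    then show ?thesis
    proof cases
      case 1 then show ?thesis using mv by (simp add: n power2_eq_square del: power_Suc)
    next
      case 2 then show ?thesis using mv by (simp add: n power2_eq_square del: power_Suc)
    next
      case 3 then show ?thesis using mv by (auto simp add: n insert_commute power2_eq_square simp del: power_Suc)
    next
      case 4 then show ?thesis using mv by (auto simp add: n insert_commute power2_eq_square simp del: power_Suc)
    next
      case 5
      then have "q \<in> Q" using assms by auto
      then have "expectation (\<lambda>\<omega>. V q \<omega> ^ ?n q) = 0" unfolding 5(2) by (rule moment_values(2))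
      then have "(\<Prod>q\<in>{a, b, c, d}. expectation (\<lambda>\<omega>. V q \<omega> ^ ?n q)) = 0" using 5(1) by (intro prod_zero) auto
      then show ?thesis using 5(3-5) by (simp only: of_bool_eq(1) simp_thms) simp
    qed
  qed
  finally show ?eq .
qed

lemma moment2:
  assumes "a \<in> Q" "b \<in> Q"
  shows "integrable M (\<lambda>\<omega>. V a \<omega> * V b \<omega>)"
    and "expectation (\<lambda>\<omega>. V a \<omega> * V b \<omega>) = of_bool (a = b) * (\<sigma> a)\<^sup>2"
proof -
  let ?n = "\<lambda>q. of_bool (a = q) * 1 + of_bool (b = q) * 1 :: nat"
  have eq: "(\<Prod>q\<in>Q. V q \<omega> ^ ?n q) = V a \<omega> * V b \<omega>" for \<omega>
    unfolding power_add prod.distrib prod_delta_power[OF assms(1)] prod_delta_power[OF assms(2)] by simp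
  show "integrable M (\<lambda>\<omega>. V a \<omega> * V b \<omega>)" using moment_prod(1)[of ?n] unfolding eq .
  show "expectation (\<lambda>\<omega>. V a \<omega> * V b \<omega>) = of_bool (a = b) * (\<sigma> a)\<^sup>2"
  proof (cases "a = b")
    case True
    then show ?thesis using moment_values(3)[OF assms(1)] by (simp add: power2_eq_square)
  next
    case False
    have "expectation (\<lambda>\<omega>. V a \<omega> * V b \<omega>) = (\<Prod>q\<in>Q. expectation (\<lambda>\<omega>. V q \<omega> ^ ?n q))"
      using moment_prod(2)[of ?n] unfolding eq .
    moreover have "expectation (\<lambda>\<omega>. V a \<omega> ^ ?n a) = 0" using False moment_values(2)[OF assms(1)] by simp
    ultimately show ?thesis using False assms(1) fin by (auto simp: prod_zero_iff)
  qed
qed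

definition U :: "'q \<Rightarrow> 'q \<Rightarrow> 'a \<Rightarrow> real" where
  "U a b \<omega> = V a \<omega> * V b \<omega> - of_bool (a = b) * (\<sigma> a)\<^sup>2"

text \<open>Centring removes the pairing of \<open>a\<close> with \<open>b\<close> and
  \<open>c\<close> with \<open>d\<close> from Isserlis' formula, leaving the two cross
  pairings.\<close>

lemma U_cov:
  assumes "a \<in> Q" "b \<in> Q" "c \<in> Q" "d \<in> Q"
  shows "integrable M (\<lambda>\<omega>. U a b \<omega> * U c d \<omega>)"
    and "expectation (\<lambda>\<omega>. U a b \<omega> * U c d \<omega>) =
           (of_bool (a = c \<and> b = d) + of_bool (a = d \<and> b = c)) * ((\<sigma> a)\<^sup>2 * (\<sigma> b)\<^sup>2)"
proof -
  note I = isserlis[OF assms] moment2[OF assms(1,2)] moment2[OF assms(3,4)]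
  let ?p = "of_bool (a = b) * (\<sigma> a)\<^sup>2" and ?q = "of_bool (c = d) * (\<sigma> c)\<^sup>2"
  have eq: "U a b \<omega> * U c d \<omega> = V a \<omega> * V b \<omega> * (V c \<omega> * V d \<omega>) - ?q * (V a \<omega> * V b \<omega>) - ?p * (V c \<omega> * V d \<omega>) + ?p * ?q" for \<omega>
    by (simp add: U_def algebra_simps)
  show "integrable M (\<lambda>\<omega>. U a b \<omega> * U c d \<omega>)"
    unfolding eq using I by simp
  have "expectation (\<lambda>\<omega>. U a b \<omega> * U c d \<omega>) = expectation (\<lambda>\<omega>. V a \<omega> * V b \<omega> * (V c \<omega> * V d \<omega>)) - ?q * ?p - ?p * ?q + ?p * ?q"
    unfolding eq using I by (simp add: prob_space)
  then show "expectation (\<lambda>\<omega>. U a b \<omega> * U c d \<omega>) =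
           (of_bool (a = c \<and> b = d) + of_bool (a = d \<and> b = c)) * ((\<sigma> a)\<^sup>2 * (\<sigma> b)\<^sup>2)"
    unfolding I(2) by (simp add: of_bool_conj)
qed

text \<open>The constant is 848 = 8 * (105 + 1): the fourth power of a sum of two terms costs 2^3 =
  8, and 105 is the eighth moment of the standard normal law. For different indices the value is 3 *
  3 = 9.\<close>

lemma U_fourth:
  assumes "a \<in> Q" "b \<in> Q"
  shows "integrable M (\<lambda>\<omega>. U a b \<omega> ^ 4)"
    and "expectation (\<lambda>\<omega>. U a b \<omega> ^ 4) \<le> 848 * ((\<sigma> a)\<^sup>2 * (\<sigma> b)\<^sup>2)\<^sup>2"
proof -
  have "integrable M (\<lambda>\<omega>. U a b \<omega> ^ 4) \<and> expectation (\<lambda>\<omega>. U a b \<omega> ^ 4) \<le> 848 * ((\<sigma> a)\<^sup>2 * (\<sigma> b)\<^sup>2)\<^sup>2"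
  proof (cases "a = b")
    case True
    let ?s = "(\<sigma> a)\<^sup>2"
    have i8: "integrable M (\<lambda>\<omega>. V a \<omega> ^ 8)"
      by (rule centred_normal_moments(1)[OF normal[OF assms(1)] pos[OF assms(1)]])
    have le: "U a b \<omega> ^ 4 \<le> 8 * (V a \<omega> ^ 8 + ?s ^ 4)" for \<omega>
    proof -
      have "(\<Sum>i<2::nat. (if i = 0 then (V a \<omega>)\<^sup>2 else - ?s)) ^ 4 \<le>
        real (card {..<2::nat}) ^ 3 * (\<Sum>i<2::nat. (if i = 0 then (V a \<omega>)\<^sup>2 else - ?s) ^ 4)"
        by (rule sum_power4_le)
      moreover have "{..<2::nat} = {0, 1}" by auto
      ultimately show ?thesis using True by (simp add: U_def power2_eq_square[symmetric] flip: power_mult)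
    qed
    have int: "integrable M (\<lambda>\<omega>. U a b \<omega> ^ 4)"
    proof (rule Bochner_Integration.integrable_bound)
      show "integrable M (\<lambda>\<omega>. 8 * (V a \<omega> ^ 8 + ?s ^ 4))" using i8 by simp
      show "AE \<omega> in M. norm (U a b \<omega> ^ 4) \<le> norm (8 * (V a \<omega> ^ 8 + ?s ^ 4))"
      proof (rule AE_I2)
        fix \<omega>
        show "norm (U a b \<omega> ^ 4) \<le> norm (8 * (V a \<omega> ^ 8 + ?s ^ 4))"
          using le[of \<omega>] by simp
      qed
    qed (use assms in \<open>simp add: U_def\<close>)
    have "expectation (\<lambda>\<omega>. U a b \<omega> ^ 4) \<le> expectation (\<lambda>\<omega>. 8 * (V a \<omega> ^ 8 + ?s ^ 4))"
      by (rule integral_mono) (use int i8 le in auto)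
    also have "\<dots> = 848 * ?s ^ 4"
      using i8 moment_values(6)[OF assms(1)] by (simp add: prob_space)
    finally show ?thesis using int True by (simp add: power2_eq_square eval_nat_numeral)
  next
    case False
    let ?n = "\<lambda>q. of_bool (a = q) * 4 + of_bool (b = q) * 4 :: nat"
    have eq: "(\<Prod>q\<in>Q. V q \<omega> ^ ?n q) = U a b \<omega> ^ 4" for \<omega>
      unfolding power_add prod.distrib prod_delta_power[OF assms(1)] prod_delta_power[OF assms(2)]
      using False by (simp add: U_def power_mult_distrib)
    have "expectation (\<lambda>\<omega>. U a b \<omega> ^ 4) = (\<Prod>q\<in>Q. expectation (\<lambda>\<omega>. V q \<omega> ^ ?n q))"
      using moment_prod(2)[of ?n] unfolding eq .
    also have "\<dots> = (\<Prod>q\<in>{a, b}. expectation (\<lambda>\<omega>. V q \<omega> ^ ?n q))"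
      using assms by (intro prod.mono_neutral_right fin) (auto simp: prob_space)
    also have "\<dots> = 9 * ((\<sigma> a)\<^sup>2 * (\<sigma> b)\<^sup>2)\<^sup>2"
      using False moment_values(5)[OF assms(1)] moment_values(5)[OF assms(2)] by (simp add: power_mult_distrib)
    finally show ?thesis using moment_prod(1)[of ?n] unfolding eq by simp
  qed
  then show "integrable M (\<lambda>\<omega>. U a b \<omega> ^ 4)"
    and "expectation (\<lambda>\<omega>. U a b \<omega> ^ 4) \<le> 848 * ((\<sigma> a)\<^sup>2 * (\<sigma> b)\<^sup>2)\<^sup>2" by auto
qed

definition centred_form :: "('q \<Rightarrow> 'q \<Rightarrow> real) \<Rightarrow> 'a \<Rightarrow> real" where
  "centred_form h \<omega> = (\<Sum>a\<in>Q. \<Sum>b\<in>Q. h a b * (V a \<omega> * V b \<omega>)) - (\<Sum>a\<in>Q. h a a * (\<sigma> a)\<^sup>2)"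

lemma centred_form_eq: "centred_form h \<omega> = (\<Sum>(a, b)\<in>Q \<times> Q. h a b * U a b \<omega>)"
proof -
  have "(\<Sum>a\<in>Q. \<Sum>b\<in>Q. h a b * (of_bool (a = b) * (\<sigma> a)\<^sup>2)) = (\<Sum>a\<in>Q. h a a * (\<sigma> a)\<^sup>2)"
  proof (rule sum.cong[OF refl])
    fix a assume a: "a \<in> Q"
    have "(\<Sum>b\<in>Q. h a b * (of_bool (a = b) * (\<sigma> a)\<^sup>2)) = (\<Sum>b\<in>Q. if a = b then h a b * (\<sigma> a)\<^sup>2 else 0)"
      by (rule sum.cong) auto
    then show "(\<Sum>b\<in>Q. h a b * (of_bool (a = b) * (\<sigma> a)\<^sup>2)) = h a a * (\<sigma> a)\<^sup>2" using a fin by simp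
  qed
  then show ?thesis
    unfolding centred_form_def U_def sum.cartesian_product[symmetric] right_diff_distrib sum_subtractf by simp
qed

lemma centred_form_mean: "integrable M (centred_form h)" "expectation (centred_form h) = 0"
proof -
  have U: "integrable M (U a b)" "expectation (U a b) = 0" if "a \<in> Q" "b \<in> Q" for a b
    using moment2[OF that] by (simp_all add: U_def[abs_def] prob_space)
  have eq: "centred_form h = (\<lambda>\<omega>. \<Sum>p\<in>Q \<times> Q. h (fst p) (snd p) * U (fst p) (snd p) \<omega>)"
    by (simp add: fun_eq_iff centred_form_eq case_prod_beta)
  show "integrable M (centred_form h)" unfolding eq using U by (intro Bochner_Integration.integrable_sum) auto
  show "expectation (centred_form h) = 0"
    unfolding eq by (subst Bochner_Integration.integral_sum) (use U in \<open>auto intro!: sum.neutral\<close>)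
qed

text \<open>By symmetry of \<open>h\<close> both cross pairings in \<open>U_cov\<close> contribute
  the same amount, whence the factor 2. For a diagonal pair the two pairings coincide and are still
  both counted.\<close>

lemma centred_form_variance:
  assumes sym: "\<And>a b. h a b = h b a"
  shows "expectation (\<lambda>\<omega>. (centred_form h \<omega>)\<^sup>2) = 2 * (\<Sum>a\<in>Q. \<Sum>b\<in>Q. (h a b)\<^sup>2 * ((\<sigma> a)\<^sup>2 * (\<sigma> b)\<^sup>2))"
proof -
  let ?W = "\<lambda>p \<omega>. h (fst p) (snd p) * U (fst p) (snd p) \<omega>"
  let ?s = "\<lambda>a b. (\<sigma> a)\<^sup>2 * (\<sigma> b)\<^sup>2"
  have "expectation (\<lambda>\<omega>. (centred_form h \<omega>)\<^sup>2) = expectation (\<lambda>\<omega>. \<Sum>p\<in>Q \<times> Q. \<Sum>r\<in>Q \<times> Q. ?W p \<omega> * ?W r \<omega>)"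
    by (simp add: centred_form_eq case_prod_beta power2_eq_square sum_product)
  also have "\<dots> = (\<Sum>p\<in>Q \<times> Q. \<Sum>r\<in>Q \<times> Q. h (fst p) (snd p) * h (fst r) (snd r) * expectation (\<lambda>\<omega>. U (fst p) (snd p) \<omega> * U (fst r) (snd r) \<omega>))"
  proof -
    have i: "integrable M (\<lambda>\<omega>. ?W p \<omega> * ?W r \<omega>)" if "p \<in> Q \<times> Q" "r \<in> Q \<times> Q" for p r
    proof -
      have "integrable M (\<lambda>\<omega>. h (fst p) (snd p) * h (fst r) (snd r) * (U (fst p) (snd p) \<omega> * U (fst r) (snd r) \<omega>))"
        using that U_cov(1) by (intro integrable_mult_right) auto
      then show ?thesis by (simp add: mult_ac)
    qed
    have e: "expectation (\<lambda>\<omega>. ?W p \<omega> * ?W r \<omega>) = h (fst p) (snd p) * h (fst r) (snd r) * expectation (\<lambda>\<omega>. U (fst p) (snd p) \<omega> * U (fst r) (snd r) \<omega>)" for p r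
      by (subst integral_mult_right_zero[symmetric], rule Bochner_Integration.integral_cong) (auto simp: mult_ac)
    show ?thesis
      apply (subst Bochner_Integration.integral_sum)
       apply (intro Bochner_Integration.integrable_sum i; assumption)
      apply (rule sum.cong[OF refl])
      apply (subst Bochner_Integration.integral_sum)
       apply (intro i; assumption)
      apply (simp only: e)
      done
  qed
  also have "\<dots> = (\<Sum>p\<in>Q \<times> Q. 2 * ((h (fst p) (snd p))\<^sup>2 * ?s (fst p) (snd p)))"
  proof (rule sum.cong[OF refl])
    fix p assume p: "p \<in> Q \<times> Q"
    let ?a = "fst p" and ?b = "snd p"
    have "(\<Sum>r\<in>Q \<times> Q. h ?a ?b * h (fst r) (snd r) * expectation (\<lambda>\<omega>. U ?a ?b \<omega> * U (fst r) (snd r) \<omega>)) =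
      (\<Sum>r\<in>Q \<times> Q. (if r = p then (h ?a ?b)\<^sup>2 * ?s ?a ?b else 0) + (if r = (?b, ?a) then (h ?a ?b)\<^sup>2 * ?s ?a ?b else 0))"
    proof (rule sum.cong[OF refl])
      fix r assume r: "r \<in> Q \<times> Q"
      have "expectation (\<lambda>\<omega>. U ?a ?b \<omega> * U (fst r) (snd r) \<omega>) =
          (of_bool (?a = fst r \<and> ?b = snd r) + of_bool (?a = snd r \<and> ?b = fst r)) * ?s ?a ?b"
        by (rule U_cov) (use p r in auto)
      moreover have "(?a = fst r \<and> ?b = snd r) \<longleftrightarrow> r = p" "(?a = snd r \<and> ?b = fst r) \<longleftrightarrow> r = (?b, ?a)"
        by (auto simp: prod_eq_iff)
      ultimately show "h ?a ?b * h (fst r) (snd r) * expectation (\<lambda>\<omega>. U ?a ?b \<omega> * U (fst r) (snd r) \<omega>) =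
         (if r = p then (h ?a ?b)\<^sup>2 * ?s ?a ?b else 0) + (if r = (?b, ?a) then (h ?a ?b)\<^sup>2 * ?s ?a ?b else 0)"
        using sym[of ?a ?b] by (auto simp: power2_eq_square algebra_simps)
    qed
    also have "\<dots> = 2 * ((h ?a ?b)\<^sup>2 * ?s ?a ?b)"
      using p fin by (simp add: sum.distrib mem_Times_iff)
    finally show "(\<Sum>r\<in>Q \<times> Q. h ?a ?b * h (fst r) (snd r) * expectation (\<lambda>\<omega>. U ?a ?b \<omega> * U (fst r) (snd r) \<omega>)) =
       2 * ((h ?a ?b)\<^sup>2 * ?s ?a ?b)" .
  qed
  finally show ?thesis
    by (simp add: sum.cartesian_product case_prod_beta sum_distrib_left)
qed

text \<open>The sum over pairs of \<open>h\<close> squared times variances is half the variance of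
  the form, so squaring it turns 848 into 848 / 4 = 212. The cube of the number of pairs stems from
  \<open>sum_power4_le\<close>; it is harmless because each form in the application has only
  \<open>D + 1\<close> variables.\<close>

lemma centred_form_fourth:
  assumes sym: "\<And>a b. h a b = h b a"
  shows "integrable M (\<lambda>\<omega>. centred_form h \<omega> ^ 4)"
    and "expectation (\<lambda>\<omega>. centred_form h \<omega> ^ 4) \<le>
          212 * real (card (Q \<times> Q)) ^ 3 * (expectation (\<lambda>\<omega>. (centred_form h \<omega>)\<^sup>2))\<^sup>2"
proof -
  let ?W = "\<lambda>p \<omega>. h (fst p) (snd p) * U (fst p) (snd p) \<omega>"
  let ?s = "\<lambda>p. (h (fst p) (snd p))\<^sup>2 * ((\<sigma> (fst p))\<^sup>2 * (\<sigma> (snd p))\<^sup>2)"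
  let ?n = "real (card (Q \<times> Q)) ^ 3"
  have eq: "centred_form h \<omega> = (\<Sum>p\<in>Q \<times> Q. ?W p \<omega>)" for \<omega>
    by (simp add: centred_form_eq case_prod_beta)
  have le: "centred_form h \<omega> ^ 4 \<le> ?n * (\<Sum>p\<in>Q \<times> Q. ?W p \<omega> ^ 4)" for \<omega>
    unfolding eq by (rule sum_power4_le)
  have iW: "integrable M (\<lambda>\<omega>. ?W p \<omega> ^ 4)" if "p \<in> Q \<times> Q" for p
    using U_fourth(1)[of "fst p" "snd p"] that by (auto simp: power_mult_distrib)
  have iS: "integrable M (\<lambda>\<omega>. ?n * (\<Sum>p\<in>Q \<times> Q. ?W p \<omega> ^ 4))"
    using iW by (intro integrable_mult_right Bochner_Integration.integrable_sum)
  show int: "integrable M (\<lambda>\<omega>. centred_form h \<omega> ^ 4)"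
  proof (rule Bochner_Integration.integrable_bound[OF iS])
    show "(\<lambda>\<omega>. centred_form h \<omega> ^ 4) \<in> borel_measurable M"
      using centred_form_mean(1)[of h] by measurable
    show "AE \<omega> in M. norm (centred_form h \<omega> ^ 4) \<le> norm (?n * (\<Sum>p\<in>Q \<times> Q. ?W p \<omega> ^ 4))"
    proof (rule AE_I2)
      fix \<omega>
      show "norm (centred_form h \<omega> ^ 4) \<le> norm (?n * (\<Sum>p\<in>Q \<times> Q. ?W p \<omega> ^ 4))"
        using le[of \<omega>] by (simp add: sum_nonneg)
    qed
  qed
  have "expectation (\<lambda>\<omega>. centred_form h \<omega> ^ 4) \<le> expectation (\<lambda>\<omega>. ?n * (\<Sum>p\<in>Q \<times> Q. ?W p \<omega> ^ 4))"
    by (rule integral_mono) (use int iS le in auto)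
  also have "\<dots> = ?n * (\<Sum>p\<in>Q \<times> Q. expectation (\<lambda>\<omega>. ?W p \<omega> ^ 4))"
    using iW by (simp add: Bochner_Integration.integral_sum)
  also have "\<dots> \<le> ?n * (\<Sum>p\<in>Q \<times> Q. 848 * (?s p)\<^sup>2)"
  proof (intro mult_left_mono sum_mono)
    fix p assume p: "p \<in> Q \<times> Q"
    have "expectation (\<lambda>\<omega>. ?W p \<omega> ^ 4) = h (fst p) (snd p) ^ 4 * expectation (\<lambda>\<omega>. U (fst p) (snd p) \<omega> ^ 4)"
      by (simp add: power_mult_distrib)
    also have "\<dots> \<le> h (fst p) (snd p) ^ 4 * (848 * ((\<sigma> (fst p))\<^sup>2 * (\<sigma> (snd p))\<^sup>2)\<^sup>2)"
      by (rule mult_left_mono[OF U_fourth(2)]) (use p in auto)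
    finally show "expectation (\<lambda>\<omega>. ?W p \<omega> ^ 4) \<le> 848 * (?s p)\<^sup>2"
      by (simp add: power_mult_distrib flip: power_mult)
  qed simp
  also have "\<dots> = 848 * ?n * (\<Sum>p\<in>Q \<times> Q. (?s p)\<^sup>2)"
    by (simp add: sum_distrib_left mult_ac)
  also have "\<dots> \<le> 848 * ?n * (\<Sum>p\<in>Q \<times> Q. ?s p)\<^sup>2"
    by (intro mult_left_mono sum_power2_le_power2_sum) (auto simp: fin)
  also have "(\<Sum>p\<in>Q \<times> Q. ?s p) = expectation (\<lambda>\<omega>. (centred_form h \<omega>)\<^sup>2) / 2"
    unfolding centred_form_variance[of h, OF sym] by (simp add: sum.cartesian_product case_prod_beta)
  finally show "expectation (\<lambda>\<omega>. centred_form h \<omega> ^ 4) \<le>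
          212 * ?n * (expectation (\<lambda>\<omega>. (centred_form h \<omega>)\<^sup>2))\<^sup>2"
    by (simp add: power_divide)
qed

end

section \<open>Integration by parts for polynomials on the unit interval\<close>

definition antideriv :: "real poly \<Rightarrow> real poly" where
  "antideriv p = (\<Sum>i\<le>Polynomial.degree p. Polynomial.monom (coeff p i / real (Suc i)) (Suc i))"

lemma pderiv_antideriv: "pderiv (antideriv p) = p"
proof -
  have "pderiv (antideriv p) = (\<Sum>i\<le>Polynomial.degree p. Polynomial.monom (coeff p i) i)"
    unfolding antideriv_def higher_pderiv_sum[where n = 1, simplified] by (rule sum.cong) (auto simp: pderiv_monom)
  then show ?thesis by (simp add: poly_as_sum_of_monoms)
qed

text \<open>Integration over [0, 1] in purely algebraic form. Analysis enters only once, when the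
  substitution t = sin^2 (\<theta>/2) is made in \<open>wigner_d_orthogonal_le\<close>.\<close>

definition unit_integral :: "real poly \<Rightarrow> real" where
  "unit_integral p = poly (antideriv p) 1 - poly (antideriv p) 0"

lemma unit_integral_pderiv: "unit_integral (pderiv Q) = poly Q 1 - poly Q 0"
proof -
  have "pderiv (antideriv (pderiv Q) - Q) = 0" by (simp add: pderiv_diff pderiv_antideriv)
  then obtain c where "antideriv (pderiv Q) - Q = [:c:]"
    using pderiv_eq_0_iff degree_eq_zeroE by metis
  then have "antideriv (pderiv Q) = Q + [:c:]" by (simp add: algebra_simps)
  then show ?thesis by (simp add: unit_integral_def)
qed

lemma unit_integral_add: "unit_integral (p + q) = unit_integral p + unit_integral q"
proof -
  have "p + q = pderiv (antideriv p + antideriv q)" by (simp add: pderiv_add pderiv_antideriv)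
  then have "unit_integral (p + q) = unit_integral (pderiv (antideriv p + antideriv q))" by simp
  then show ?thesis unfolding unit_integral_pderiv by (simp add: unit_integral_def)
qed

lemma unit_integral_smult: "unit_integral (smult c p) = c * unit_integral p"
proof -
  have "smult c p = pderiv (smult c (antideriv p))" by (simp add: pderiv_smult pderiv_antideriv)
  then have "unit_integral (smult c p) = unit_integral (pderiv (smult c (antideriv p)))" by simp
  then show ?thesis unfolding unit_integral_pderiv by (simp add: unit_integral_def algebra_simps)
qed

lemma unit_integral_by_parts:
  "unit_integral (pderiv p * q) = poly p 1 * poly q 1 - poly p 0 * poly q 0 - unit_integral (p * pderiv q)"
proof -
  have "unit_integral (pderiv p * q) + unit_integral (p * pderiv q) = unit_integral (pderiv (p * q))"
    by (simp add: pderiv_mult unit_integral_add[symmetric] add.commute mult.commute)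
  then show ?thesis unfolding unit_integral_pderiv by simp
qed

lemma power_dvd_pderiv:
  fixes d :: "real poly"
  assumes "d ^ Suc k dvd p"
  shows "d ^ k dvd pderiv p"
proof -
  obtain r where "p = d ^ Suc k * r" using assms by (elim dvdE)
  then have "pderiv p = d ^ Suc k * pderiv r + r * pderiv (d ^ Suc k)"
    by (simp only: pderiv_mult)
  also have "\<dots> = d ^ k * (d * pderiv r + smult (of_nat (Suc k)) (pderiv d) * r)"
    unfolding pderiv_power_Suc by (simp add: algebra_simps del: of_nat_Suc)
  finally have "pderiv p = d ^ k * (d * pderiv r + smult (of_nat (Suc k)) (pderiv d) * r)" .
  then show ?thesis by simp
qed

text \<open>Divisibility by \<open>d ^ k\<close> is a zero of order \<open>k\<close> at the roots of
  \<open>d\<close>, and each derivative lowers the order by at most one.\<close>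

lemma poly_higher_pderiv_eq_0:
  fixes d :: "real poly"
  assumes "d ^ k dvd p" "i < k" "poly d x = 0"
  shows "poly ((pderiv ^^ i) p) x = 0"
proof -
  have "d ^ (k - i) dvd (pderiv ^^ i) p" using assms(2)
  proof (induction i)
    case (Suc i)
    then have "d ^ Suc (k - Suc i) dvd (pderiv ^^ i) p" by (simp add: Suc_diff_Suc)
    then show ?case using power_dvd_pderiv by simp
  qed (use assms in simp)
  then obtain r where "(pderiv ^^ i) p = d ^ (k - i) * r" by (elim dvdE)
  then show ?thesis using assms by (simp add: poly_power zero_power)
qed

text \<open>Each step moves one derivative from \<open>p\<close> to \<open>q\<close>, so the total
  \<open>N + M'\<close> is invariant. At both endpoints the orders of vanishing of \<open>p\<close>
  and \<open>q\<close> add up to at least this total; hence in every boundary term one of the two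
  factors has not yet lost its zero.\<close>

lemma unit_integral_repeated_by_parts:
  fixes p q :: "real poly"
  assumes "[:0, 1:] ^ k0 dvd p" "[:0, 1:] ^ k0' dvd q" "N + M' \<le> k0 + k0'"
    and "[:1, -1:] ^ k1 dvd p" "[:1, -1:] ^ k1' dvd q" "N + M' \<le> k1 + k1'"
  shows "unit_integral ((pderiv ^^ N) p * (pderiv ^^ M') q) = (-1) ^ N * unit_integral (p * (pderiv ^^ (N + M')) q)"
  using assms(3,6)
proof (induction N arbitrary: M')
  case (Suc N)
  have b0: "poly ((pderiv ^^ N) p) 0 * poly ((pderiv ^^ M') q) 0 = 0"
  proof (cases "N < k0")
    case True
    then show ?thesis using poly_higher_pderiv_eq_0[OF assms(1), of N 0] by simp
  next
    case False
    then show ?thesis using Suc.prems poly_higher_pderiv_eq_0[OF assms(2), of M' 0] by simp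
  qed
  have b1: "poly ((pderiv ^^ N) p) 1 * poly ((pderiv ^^ M') q) 1 = 0"
  proof (cases "N < k1")
    case True
    then show ?thesis using poly_higher_pderiv_eq_0[OF assms(4), of N 1] by simp
  next
    case False
    then show ?thesis using Suc.prems poly_higher_pderiv_eq_0[OF assms(5), of M' 1] by simp
  qed
  have "unit_integral ((pderiv ^^ Suc N) p * (pderiv ^^ M') q) = - unit_integral ((pderiv ^^ N) p * (pderiv ^^ Suc M') q)"
    using unit_integral_by_parts[of "(pderiv ^^ N) p" "(pderiv ^^ M') q"] b0 b1 by simp
  also have "\<dots> = - ((-1) ^ N * unit_integral (p * (pderiv ^^ (N + Suc M')) q))"
    using Suc.IH[of "Suc M'"] Suc.prems by simp
  finally show ?case by simp
qed simp

text \<open>Euler's beta integral. Each integration by parts moves one power from 1 - t to t, which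
  leads to a pure power of t.\<close>

lemma unit_integral_beta: "unit_integral ([:0, 1:] ^ a * [:1, -1:] ^ b) = fact a * fact b / fact (a + b + 1)"
proof (induction b arbitrary: a)
  case 0
  have "[:0, 1:] ^ a = pderiv (smult (1 / real (Suc a)) ([:0, 1:] ^ Suc a))"
    by (simp add: pderiv_smult pderiv_power_Suc pderiv_pCons del: of_nat_Suc power_Suc)
  then have "unit_integral ([:0, 1:] ^ a) = 1 / real (Suc a)"
    using unit_integral_pderiv[of "smult (1 / real (Suc a)) ([:0, 1:] ^ Suc a)"] by (simp add: poly_power)
  then show ?case by (simp add: fact_Suc del: of_nat_Suc)
next
  case (Suc b)
  have "[:0, 1:] ^ a = pderiv (smult (1 / real (Suc a)) ([:0, 1:] ^ Suc a))"
    by (simp add: pderiv_smult pderiv_power_Suc pderiv_pCons del: of_nat_Suc power_Suc)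
  then have "unit_integral ([:0, 1:] ^ a * [:1, -1:] ^ Suc b) =
      - unit_integral (smult (1 / real (Suc a)) ([:0, 1:] ^ Suc a) * pderiv ([:1, -1:] ^ Suc b))"
    using unit_integral_by_parts[of "smult (1 / real (Suc a)) ([:0, 1:] ^ Suc a)" "[:1, -1:] ^ Suc b"]
    by (simp add: poly_power)
  also have "smult (1 / real (Suc a)) ([:0, 1:] ^ Suc a) * pderiv ([:1, -1:] ^ Suc b) =
      smult (- (real (Suc b) / real (Suc a))) ([:0, 1:] ^ Suc a * [:1, -1:] ^ b)"
    by (simp add: pderiv_power_Suc pderiv_pCons del: of_nat_Suc power_Suc)
  also have "- unit_integral \<dots> = real (Suc b) / real (Suc a) * (fact (Suc a) * fact b / fact (Suc a + b + 1))"
    unfolding unit_integral_smult Suc.IH by simp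
  also have "\<dots> = fact a * fact (Suc b) / fact (a + Suc b + 1)"
    by (simp add: fact_Suc[of a] fact_Suc[of b] mult_ac del: of_nat_Suc fact_Suc)
  finally show ?case .
qed


section \<open>Wigner functions by a Rodrigues formula\<close>

lemma higher_pderiv_mult:
  fixes p q :: "real poly"
  shows "(pderiv ^^ N) (p * q) = (\<Sum>k\<le>N. smult (real (N choose k)) ((pderiv ^^ (N - k)) p * (pderiv ^^ k) q))"
proof (induction N)
  case (Suc N)
  let ?f = "\<lambda>i j. (pderiv ^^ i) p * (pderiv ^^ j) q"
  have "(pderiv ^^ Suc N) (p * q) = (\<Sum>k\<le>N. smult (real (N choose k)) (?f (Suc N - k) k + ?f (N - k) (Suc k)))"
    by (simp add: Suc higher_pderiv_sum[where n = 1, simplified] pderiv_smult pderiv_mult Suc_diff_le add.commute mult.commute)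
  also have "\<dots> = (\<Sum>k\<le>N. smult (real (N choose k)) (?f (Suc N - k) k)) + (\<Sum>k\<le>N. smult (real (N choose k)) (?f (N - k) (Suc k)))"
    by (simp add: smult_add_right sum.distrib)
  also have "(\<Sum>k\<le>N. smult (real (N choose k)) (?f (Suc N - k) k)) = (\<Sum>k\<le>Suc N. smult (real (N choose k)) (?f (Suc N - k) k))"
    by simp
  also have "\<dots> = ?f (Suc N) 0 + (\<Sum>k\<le>N. smult (real (N choose Suc k)) (?f (N - k) (Suc k)))"
    by (subst sum.atMost_Suc_shift) simp
  also have "\<dots> + (\<Sum>k\<le>N. smult (real (N choose k)) (?f (N - k) (Suc k))) =
      ?f (Suc N) 0 + (\<Sum>k\<le>N. smult (real (Suc N choose Suc k)) (?f (N - k) (Suc k)))"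
    by (simp add: sum.distrib smult_add_left add.assoc add.commute)
  also have "\<dots> = (\<Sum>k\<le>Suc N. smult (real (Suc N choose k)) (?f (Suc N - k) k))"
    by (subst sum.atMost_Suc_shift) simp
  finally show ?case .
qed simp

lemma higher_pderiv_linear_power:
  fixes c e :: real
  shows "(pderiv ^^ i) ([:c, e:] ^ a) = (if i \<le> a then smult (e ^ i * fact a / fact (a - i)) ([:c, e:] ^ (a - i)) else 0)"
proof (induction i)
  case (Suc i)
  show ?case
  proof (cases "Suc i \<le> a")
    case True
    then obtain j where j: "a - i = Suc j" "a - Suc i = j" by (metis Suc_diff_Suc Suc_le_lessD)
    have "(pderiv ^^ Suc i) ([:c, e:] ^ a) = pderiv (smult (e ^ i * fact a / fact (Suc j)) ([:c, e:] ^ Suc j))"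
      using Suc True j by simp
    also have "\<dots> = smult (e ^ i * fact a / fact (Suc j) * (real (Suc j) * e)) ([:c, e:] ^ j)"
      unfolding pderiv_smult pderiv_power_Suc by (simp add: pderiv_pCons mult.commute del: of_nat_Suc fact_Suc)
    also have "e ^ i * fact a / fact (Suc j) * (real (Suc j) * e) = e ^ Suc i * fact a / fact j"
      by (simp add: field_simps del: of_nat_Suc)
    finally show ?thesis using True j by simp
  next
    case False
    then show ?thesis
    proof (cases "i = a")
      case True
      then show ?thesis using Suc by (simp add: pderiv_smult)
    next
      case neq: False
      then show ?thesis using Suc False by simp
    qed
  qed
qed simp

text \<open>For \<open>N\<close> at most \<open>a\<close> and \<open>b\<close> this is, up to a
  constant, t^(a-N) (1-t)^(b-N) times a Jacobi polynomial of degree \<open>N\<close>. As a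
  derivative it is a polynomial for all values of the parameters.\<close>

definition rodrigues :: "nat \<Rightarrow> nat \<Rightarrow> nat \<Rightarrow> real poly" where
  "rodrigues a b N = (pderiv ^^ N) ([:0, 1:] ^ a * [:1, -1:] ^ b)"

text \<open>Leibniz' rule. The limits of the sum discard the terms in which one of the two powers is
  differentiated more often than its exponent; they coincide with those of Wigner's formula.\<close>

lemma poly_rodrigues:
  "poly (rodrigues a b N) t = fact N * fact a * fact b *
     (\<Sum>k = N - a..min b N. (-1) ^ k / (fact (b - k) * fact k * fact (a + k - N) * fact (N - k)) *
        (t ^ (a + k - N) * (1 - t) ^ (b - k)))"
proof -
  have "poly (rodrigues a b N) t = (\<Sum>k\<le>N. real (N choose k) *
     (poly ((pderiv ^^ (N - k)) ([:0, 1:] ^ a)) t * poly ((pderiv ^^ k) ([:1, -1:] ^ b)) t))"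
    unfolding rodrigues_def higher_pderiv_mult by (simp add: poly_sum)
  also have "\<dots> = (\<Sum>k = N - a..min b N. real (N choose k) *
     (poly ((pderiv ^^ (N - k)) ([:0, 1:] ^ a)) t * poly ((pderiv ^^ k) ([:1, -1:] ^ b)) t))"
    by (rule sum.mono_neutral_right) (auto simp: higher_pderiv_linear_power)
  also have "\<dots> = (\<Sum>k = N - a..min b N. fact N * fact a * fact b * ((-1) ^ k / (fact (b - k) * fact k * fact (a + k - N) * fact (N - k)) *
        (t ^ (a + k - N) * (1 - t) ^ (b - k))))"
  proof (rule sum.cong[OF refl])
    fix k assume "k \<in> {N - a..min b N}"
    then have k: "k \<le> N" "k \<le> b" "N - k \<le> a" "a - (N - k) = a + k - N" by auto
    show "real (N choose k) * (poly ((pderiv ^^ (N - k)) ([:0, 1:] ^ a)) t * poly ((pderiv ^^ k) ([:1, -1:] ^ b)) t) =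
      fact N * fact a * fact b * ((-1) ^ k / (fact (b - k) * fact k * fact (a + k - N) * fact (N - k)) *
        (t ^ (a + k - N) * (1 - t) ^ (b - k)))"
      using k by (simp add: higher_pderiv_linear_power poly_power binomial_fact mult_ac)
  qed
  finally show ?thesis by (simp add: sum_distrib_left)
qed


text \<open>With \<open>a = l - n\<close>, \<open>b = l + n\<close> and \<open>N = l - m\<close> all exponents and factorials in Wigner's formula are
  natural numbers.\<close>

definition wigner_nat :: "nat \<Rightarrow> nat \<Rightarrow> nat \<Rightarrow> real \<Rightarrow> real" where
  "wigner_nat a b N \<beta> = sqrt (fact N * fact (a + b - N) * fact b * fact a) *
     (\<Sum>k = N - a..min b N. (-1) ^ (a + k - N) / (fact (b - k) * fact k * fact (a + k - N) * fact (N - k)) *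
        cos (\<beta> / 2) ^ ((b - k) + (N - k)) * sin (\<beta> / 2) ^ ((a + k - N) + k))"

lemma wigner_d_eq_nat:
  assumes "\<bar>m\<bar> \<le> int l" "\<bar>n\<bar> \<le> int l"
  shows "wigner_d l m n \<beta> = wigner_nat (nat (int l - n)) (nat (int l + n)) (nat (int l - m)) \<beta>"
proof -
  define a b N where "a = nat (int l - n)" and "b = nat (int l + n)" and "N = nat (int l - m)"
  have a: "int l - n = int a" and b: "int l + n = int b" and N: "int l - m = int N"
    using assms by (auto simp: a_def b_def N_def)
  have lm: "int l + m = int a + int b - int N" and nm: "n - m = int N - int a" "m - n = int a - int N"
    and le: "int N \<le> int a + int b" and nm2: "2 * int l + n - m = int b + int N"
    using a b N assms by auto
  have N': "nat (int l + m) = a + b - N" unfolding lm using le by (simp add: nat_diff_distrib')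
  have lo: "nat (max 0 (n - m)) = N - a" unfolding nm by simp
  have hi: "nat (min (int l + n) (int l - m)) = min b N" unfolding b N by (simp add: min_def)
  show ?thesis
    unfolding wigner_d_def wigner_nat_def N' lo hi a_def[symmetric] b_def[symmetric] N_def[symmetric]
  proof (intro arg_cong2[of _ _ _ _ "(*)"] sum.cong refl)
    fix k assume "k \<in> {N - a..min b N}"
    then have k: "N \<le> a + k" "k \<le> b" "k \<le> N" by auto
    have e: "nat (m - n + int k) = a + k - N" "nat (int l + n - int k) = b - k"
      "nat (int l - m - int k) = N - k"
      "nat (2 * int l + n - m - 2 * int k) = (b - k) + (N - k)"
      "nat (m - n + 2 * int k) = (a + k - N) + k"
      unfolding nm b N nm2 using k by (simp_all add: nat_eq_iff of_nat_diff)
    show "(- 1) ^ nat (m - n + int k) /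
           (fact (nat (int l + n - int k)) * fact k * fact (nat (m - n + int k)) * fact (nat (int l - m - int k))) =
         (- 1) ^ (a + k - N) / (fact (b - k) * fact k * fact (a + k - N) * (fact (N - k) :: real))"
      unfolding e ..
    show "cos (\<beta> / 2) ^ nat (2 * int l + n - m - 2 * int k) = cos (\<beta> / 2) ^ ((b - k) + (N - k))"
      unfolding e ..
    show "sin (\<beta> / 2) ^ nat (m - n + 2 * int k) = sin (\<beta> / 2) ^ ((a + k - N) + k)"
      unfolding e ..
  qed simp
qed

lemma minus_one_power_diff:
  assumes "N \<le> a + k"
  shows "(-1 :: real) ^ (a + k - N) = (-1) ^ (a + N) * (-1) ^ k"
proof -
  have "a + N + k = (a + k - N) + 2 * N" using assms by simp
  then have "(-1 :: real) ^ (a + N) * (-1) ^ k = (-1) ^ ((a + k - N) + 2 * N)"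
    by (simp only: power_add[symmetric])
  then show ?thesis by (simp add: power_add)
qed

text \<open>At t = sin^2 (\<beta>/2) the terms of Wigner's sum and of \<open>poly_rodrigues\<close>
  differ by powers of sine and cosine whose exponents N - a and N - b do not depend on
  \<open>k\<close>. These exponents may be negative, hence \<open>powi\<close> and the strict
  positivity of both functions.\<close>

lemma wigner_nat_rodrigues:
  assumes s: "sin (\<beta> / 2) > 0" and c: "cos (\<beta> / 2) > 0"
  shows "wigner_nat a b N \<beta> = sqrt (fact N * fact (a + b - N) * fact b * fact a) / (fact N * fact a * fact b) * (-1) ^ (a + N) *
     (sin (\<beta> / 2) powi (int N - int a) * cos (\<beta> / 2) powi (int N - int b)) * poly (rodrigues a b N) ((sin (\<beta> / 2))\<^sup>2)"
proof -
  let ?s = "sin (\<beta> / 2)" and ?c = "cos (\<beta> / 2)"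
  have c2: "1 - ?s\<^sup>2 = ?c\<^sup>2" by (simp add: sin_squared_eq)
  have "(\<Sum>k = N - a..min b N. (-1) ^ (a + k - N) / (fact (b - k) * fact k * fact (a + k - N) * fact (N - k)) *
        ?c ^ ((b - k) + (N - k)) * ?s ^ ((a + k - N) + k)) =
    (\<Sum>k = N - a..min b N. (-1) ^ (a + N) * (?s powi (int N - int a) * ?c powi (int N - int b)) *
        ((-1) ^ k / (fact (b - k) * fact k * fact (a + k - N) * fact (N - k)) * ((?s\<^sup>2) ^ (a + k - N) * (1 - ?s\<^sup>2) ^ (b - k))))"
  proof (rule sum.cong[OF refl])
    fix k assume "k \<in> {N - a..min b N}"
    then have k: "k \<le> N" "k \<le> b" "N \<le> a + k" by auto
    have S: "?s powi (int N - int a) * (?s\<^sup>2) ^ (a + k - N) = ?s ^ ((a + k - N) + k)"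
    proof -
      have "?s powi (int N - int a) * (?s\<^sup>2) ^ (a + k - N) = ?s powi (int N - int a + int (2 * (a + k - N)))"
        using s by (simp add: power_int_add power_mult power_int_of_nat del: of_nat_mult)
      also have "int N - int a + int (2 * (a + k - N)) = int ((a + k - N) + k)" using k by simp
      finally show ?thesis by (simp only: power_int_of_nat)
    qed
    have C: "?c powi (int N - int b) * (1 - ?s\<^sup>2) ^ (b - k) = ?c ^ ((b - k) + (N - k))"
    proof -
      have "?c powi (int N - int b) * (1 - ?s\<^sup>2) ^ (b - k) = ?c powi (int N - int b + int (2 * (b - k)))"
        unfolding c2 using c by (simp add: power_int_add power_mult power_int_of_nat del: of_nat_mult)
      also have "int N - int b + int (2 * (b - k)) = int ((b - k) + (N - k))" using k by simp
      finally show ?thesis by (simp only: power_int_of_nat)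
    qed
    show "(-1) ^ (a + k - N) / (fact (b - k) * fact k * fact (a + k - N) * fact (N - k)) *
        ?c ^ ((b - k) + (N - k)) * ?s ^ ((a + k - N) + k) =
        (-1) ^ (a + N) * (?s powi (int N - int a) * ?c powi (int N - int b)) *
        ((-1) ^ k / (fact (b - k) * fact k * fact (a + k - N) * fact (N - k)) * ((?s\<^sup>2) ^ (a + k - N) * (1 - ?s\<^sup>2) ^ (b - k)))"
      unfolding minus_one_power_diff[OF k(3)] S[symmetric] C[symmetric]
      by (simp only: mult_ac times_divide_eq_left times_divide_eq_right)
  qed
  then have L: "(\<Sum>k = N - a..min b N. (-1) ^ (a + k - N) / (fact (b - k) * fact k * fact (a + k - N) * fact (N - k)) *
        ?c ^ ((b - k) + (N - k)) * ?s ^ ((a + k - N) + k)) = (-1) ^ (a + N) * (?s powi (int N - int a) * ?c powi (int N - int b)) *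
     (\<Sum>k = N - a..min b N. (-1) ^ k / (fact (b - k) * fact k * fact (a + k - N) * fact (N - k)) * ((?s\<^sup>2) ^ (a + k - N) * (1 - ?s\<^sup>2) ^ (b - k)))"
    (is "_ = _ * ?S") by (simp only: sum_distrib_left)
  have F: "x / y * e * p * (y * z) = x * (e * p * z)" if "y \<noteq> 0" for x y e p z :: real
    using that by simp
  show ?thesis
    unfolding wigner_nat_def poly_rodrigues L by (rule F[symmetric]) simp
qed

text \<open>The symmetry between d_mn and d_(-m)(-n) with sign (-1)^(m-n): exchanging
  \<open>a\<close> and \<open>b\<close> changes the sign of n, and replacing \<open>N\<close> by
  \<open>a + b - N\<close> that of m. The sum is reindexed by k -> a + k - N, which permutes the
  four factorials.\<close>

lemma wigner_nat_flip:
  assumes "N \<le> a + b"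
  shows "wigner_nat a b N \<beta> = (-1) ^ (a + N) * wigner_nat b a (a + b - N) \<beta>"
proof -
  let ?s = "sin (\<beta> / 2)" and ?c = "cos (\<beta> / 2)"
  let ?L = "\<lambda>k. (-1) ^ (a + k - N) / (fact (b - k) * fact k * fact (a + k - N) * fact (N - k)) *
        ?c ^ ((b - k) + (N - k)) * ?s ^ ((a + k - N) + k)"
  let ?M = "a + b - N"
  let ?R = "\<lambda>k. (-1) ^ (b + k - ?M) / (fact (a - k) * fact k * fact (b + k - ?M) * fact (?M - k)) *
        ?c ^ ((a - k) + (?M - k)) * ?s ^ ((b + k - ?M) + k)"
  have "(\<Sum>k = N - a..min b N. ?L k) = (\<Sum>k = ?M - b..min a ?M. (-1) ^ (a + N) * ?R k)"
  proof (rule sum.reindex_bij_witness[of _ "\<lambda>k. k + N - a" "\<lambda>k. a + k - N"])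
    fix k assume "k \<in> {N - a..min b N}"
    then have k: "k \<le> N" "k \<le> b" "N \<le> a + k" by auto
    show "a + k - N + N - a = k" using k by simp
    show "a + k - N \<in> {?M - b..min a ?M}" using k assms by auto
    have e: "b + (a + k - N) - ?M = k" "a - (a + k - N) = N - k" "?M - (a + k - N) = b - k"
      using k assms by auto
    have sg: "(-1 :: real) ^ (a + N) * (-1) ^ k = (-1) ^ (a + k - N)"
      using minus_one_power_diff[OF k(3)] by simp
    show "(-1) ^ (a + N) * ?R (a + k - N) = ?L k"
      unfolding e sg[symmetric] power_add[of "cos (\<beta> / 2)"] power_add[of "sin (\<beta> / 2)"]
      by (simp only: mult_ac times_divide_eq_left times_divide_eq_right)
  next
    fix k assume "k \<in> {?M - b..min a ?M}"
    then have k: "k \<le> ?M" "k \<le> a" "?M \<le> b + k" by auto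
    show "a + (k + N - a) - N = k" using k assms by auto
    show "k + N - a \<in> {N - a..min b N}" using k assms by auto
  qed
  then have L: "(\<Sum>k = N - a..min b N. ?L k) = (-1) ^ (a + N) * (\<Sum>k = ?M - b..min a ?M. ?R k)"
    by (simp only: sum_distrib_left)
  have M: "b + a - ?M = N" using assms by simp
  show ?thesis
    unfolding wigner_nat_def L M by (simp only: mult_ac)
qed

text \<open>Each factor is written by one of the two Rodrigues formulas, for \<open>d\<^sub>m\<^sub>n\<close> and for \<open>d\<^sub>-\<^sub>m\<^sub>,\<^sub>-\<^sub>n\<close>, so that the
  weights cancel and the product is a polynomial in \<open>sin\<^sup>2 (\<beta>/2)\<close>.\<close>

lemma wigner_nat_product:
  assumes s: "sin (\<beta> / 2) > 0" and c: "cos (\<beta> / 2) > 0" and N: "N \<le> a + b" "N' \<le> a' + b'"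
    and eq: "int a - int N = int a' - int N'" "int b - int N = int b' - int N'"
  shows "wigner_nat a b N \<beta> * wigner_nat a' b' N' \<beta> =
    sqrt (fact N * fact (a + b - N) * fact b * fact a) / (fact N * fact a * fact b) *
    (sqrt (fact N' * fact (a' + b' - N') * fact b' * fact a') / (fact (a' + b' - N') * fact a' * fact b')) * (-1) ^ (a + N) *
    poly (rodrigues a b N * rodrigues b' a' (a' + b' - N')) ((sin (\<beta> / 2))\<^sup>2)"
proof -
  let ?s = "sin (\<beta> / 2)" and ?c = "cos (\<beta> / 2)" and ?M = "a' + b' - N'"
  have M: "b' + a' - ?M = N'" using N by simp
  have e: "int ?M - int b' = - (int N - int a)" "int ?M - int a' = - (int N - int b)" using N eq by auto
  have sg: "(-1 :: real) ^ (a' + N') * (-1) ^ (b' + ?M) = 1"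
  proof -
    have "a' + N' + (b' + ?M) = 2 * (a' + b')" using N by simp
    then have "(-1 :: real) ^ (a' + N') * (-1) ^ (b' + ?M) = (-1) ^ (2 * (a' + b'))" by (metis power_add)
    then show ?thesis by simp
  qed
  have inv: "x powi i * x powi - i = 1" if "x > 0" for x :: real and i
    using that by (simp add: power_int_minus)
  have c1: "?s powi (int N - int a) * ?s powi - (int N - int a) = 1" "?c powi (int N - int b) * ?c powi - (int N - int b) = 1"
    by (rule inv[OF s], rule inv[OF c])
  have "wigner_nat a' b' N' \<beta> = (-1) ^ (a' + N') * wigner_nat b' a' ?M \<beta>"
    by (rule wigner_nat_flip[OF N(2)])
  also have "wigner_nat b' a' ?M \<beta> = sqrt (fact ?M * fact N' * fact a' * fact b') / (fact ?M * fact b' * fact a') * (-1) ^ (b' + ?M) *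
     (?s powi - (int N - int a) * ?c powi - (int N - int b)) * poly (rodrigues b' a' ?M) (?s\<^sup>2)"
    unfolding wigner_nat_rodrigues[OF s c] M e ..
  finally have 2: "wigner_nat a' b' N' \<beta> = ((-1) ^ (a' + N') * (-1) ^ (b' + ?M)) * (sqrt (fact ?M * fact N' * fact a' * fact b') / (fact ?M * fact b' * fact a') *
     (?s powi - (int N - int a) * ?c powi - (int N - int b)) * poly (rodrigues b' a' ?M) (?s\<^sup>2))"
    by (simp only: mult_ac)
  let ?x = "sqrt (fact N * fact (a + b - N) * fact b * fact a) / (fact N * fact a * fact b)"
  let ?y = "sqrt (fact N' * fact ?M * fact b' * fact a') / (fact ?M * fact a' * fact b')"
  let ?p = "poly (rodrigues a b N) (?s\<^sup>2)" and ?q = "poly (rodrigues b' a' ?M) (?s\<^sup>2)"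
  have 3: "wigner_nat a' b' N' \<beta> = ?y * (?s powi - (int N - int a) * ?c powi - (int N - int b)) * ?q"
    unfolding 2 sg by (simp add: mult_ac)
  have "wigner_nat a b N \<beta> * wigner_nat a' b' N' \<beta> =
    ?x * ?y * (-1) ^ (a + N) * (?s powi (int N - int a) * ?s powi - (int N - int a)) *
      (?c powi (int N - int b) * ?c powi - (int N - int b)) * (?p * ?q)"
    unfolding 3 wigner_nat_rodrigues[OF s c, of a b N] by (simp only: mult_ac)
  then show ?thesis unfolding c1 by simp
qed

text \<open>All N + M derivatives are moved to the second polynomial, of degree a' + b'. By the two
  equations N + M is the average of a + b and a' + b', so it exceeds that degree when a' + b' < a +
  b and the integrand vanishes. In the case of equality the derivative is a constant, given by the
  leading coefficient, and a beta integral remains.\<close>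

lemma rodrigues_orthogonality:
  assumes "N + M = a + b'" "N + M = b + a'" "a' + b' \<le> a + b" "N \<le> a + b"
  shows "unit_integral (rodrigues a b N * rodrigues b' a' M) =
    (if a' + b' = a + b then (-1) ^ (a + N) * fact a * fact b / real (a + b + 1) else 0)"
proof -
  let ?q = "[:0, 1:] ^ b' * [:1, -1:] ^ a' :: real poly"
  have parts: "unit_integral (rodrigues a b N * rodrigues b' a' M) =
     (-1) ^ N * unit_integral ([:0, 1:] ^ a * [:1, -1:] ^ b * (pderiv ^^ (N + M)) ?q)"
    unfolding rodrigues_def
    by (rule unit_integral_repeated_by_parts[where ?k0.0 = a and k0' = b' and ?k1.0 = b and k1' = a']) (use assms in auto)
  have deg: "Polynomial.degree ?q = a' + b'"
    by (subst degree_mult_eq) (auto simp: degree_power_eq)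
  show ?thesis
  proof (cases "a' + b' = a + b")
    case False
    then have "Polynomial.degree ?q < N + M" using assms deg by auto
    then have "(pderiv ^^ (N + M)) ?q = 0"
    proof -
      have "coeff ((pderiv ^^ (N + M)) ?q) i = 0" for i
        using \<open>Polynomial.degree ?q < N + M\<close> by (simp add: coeff_higher_pderiv coeff_eq_0)
      then show ?thesis by (simp add: poly_eq_iff)
    qed
    then show ?thesis using parts False by (simp add: unit_integral_def antideriv_def)
  next
    case True
    then have eq: "a' = a" "b' = b" "N + M = a + b" using assms by auto
    have "coeff ((pderiv ^^ (N + M)) ?q) i = coeff [:fact (a + b) * (-1) ^ a:] i" for i
    proof (cases "i = 0")
      case True
      have "coeff ?q (a + b) = lead_coeff ?q" using deg eq by simp
      also have "\<dots> = (-1) ^ a" by (simp add: lead_coeff_mult lead_coeff_power eq)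
      finally show ?thesis using True eq by (simp add: coeff_higher_pderiv pochhammer_fact[symmetric])
    next
      case False
      then show ?thesis using deg eq by (simp add: coeff_higher_pderiv coeff_eq_0 coeff_pCons split: nat.split)
    qed
    then have "(pderiv ^^ (N + M)) ?q = [:fact (a + b) * (-1) ^ a:]" by (rule poly_eqI)
    then have "unit_integral (rodrigues a b N * rodrigues b' a' M) =
      (-1) ^ N * (fact (a + b) * (-1) ^ a * unit_integral ([:0, 1:] ^ a * [:1, -1:] ^ b))"
      unfolding parts by (simp add: unit_integral_smult)
    also have "\<dots> = (-1) ^ (a + N) * fact a * fact b / real (a + b + 1)"
    proof -
      have F: "fact (a + b + 1) = real (a + b + 1) * fact (a + b)" by simp
      show ?thesis
        unfolding unit_integral_beta F power_add by (simp del: of_nat_add of_nat_Suc)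
    qed
    finally show ?thesis using True by simp
  qed
qed

section \<open>Orthonormality of the spin spherical harmonics\<close>

text \<open>With t = sin^2 (\<theta>/2) one has dt = sin \<theta> d\<theta> / 2, so an explicit
  antiderivative \<open>F\<close> is available and the fundamental theorem reduces the claim to
  \<open>rodrigues_orthogonality\<close>. The order of \<open>l\<close> and \<open>l'\<close>
  decides which polynomial receives the derivatives.\<close>

lemma wigner_d_orthogonal_le:
  assumes "\<bar>m\<bar> \<le> int l'" "\<bar>n\<bar> \<le> int l'" "l' \<le> l"
  shows "has_bochner_integral lborel (\<lambda>\<theta>. indicator {0..pi} \<theta> * sin \<theta> * (wigner_d l m n \<theta> * wigner_d l' m n \<theta>))
           (if l = l' then 2 / (2 * real l + 1) else 0)"
proof -
  define a b N where "a = nat (int l - n)" and "b = nat (int l + n)" and "N = nat (int l - m)"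
  define a' b' N' where "a' = nat (int l' - n)" and "b' = nat (int l' + n)" and "N' = nat (int l' - m)"
  define M where "M = a' + b' - N'"
  have nat: "N \<le> a + b" "N' \<le> a' + b'" "int a - int N = int a' - int N'" "int b - int N = int b' - int N'"
    "N + M = a + b'" "N + M = b + a'" "a' + b' \<le> a + b" "a + b = 2 * l" "a' + b' = 2 * l'"
    using assms by (auto simp: a_def b_def N_def a'_def b'_def N'_def M_def)
  define \<kappa> where "\<kappa> = sqrt (fact N * fact (a + b - N) * fact b * fact a) / (fact N * fact a * fact b) *
    (sqrt (fact N' * fact M * fact b' * fact a') / (fact M * fact a' * fact b')) * (-1) ^ (a + N)"
  define p where "p = rodrigues a b N * rodrigues b' a' M"
  have I: "unit_integral p = (if a' + b' = a + b then (-1) ^ (a + N) * fact a * fact b / real (a + b + 1) else 0)"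
    unfolding p_def by (rule rodrigues_orthogonality) (use nat in auto)
  \<comment> \<open>For equal degrees the two square roots coincide; their square and the beta
    integral cancel all factorials, leaving a + b + 1 = 2 l + 1 in the denominator.\<close>
  have val: "2 * \<kappa> * unit_integral p = (if l = l' then 2 / (2 * real l + 1) else 0)"
  proof (cases "l = l'")
    case True
    then have eq: "a' = a" "b' = b" "N' = N" "M = a + b - N"
      by (auto simp: a_def b_def N_def a'_def b'_def N'_def M_def)
    have "sqrt (fact N * fact M * fact b * fact a) * sqrt (fact N * fact M * fact b * fact a) = fact N * fact M * fact b * (fact a :: real)"
      by (simp add: less_imp_le)
    moreover have "(-1 :: real) ^ (a + N) * (-1) ^ (a + N) = 1" by (simp flip: power_mult_distrib)
    moreover have "2 * \<kappa> * unit_integral p =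
      2 * (sqrt (fact N * fact M * fact b * fact a) * sqrt (fact N * fact M * fact b * fact a)) * ((-1) ^ (a + N) * (-1) ^ (a + N)) *
        (fact a * fact b) / ((fact N * fact a * fact b) * (fact M * fact a * fact b) * real (a + b + 1))"
      unfolding \<kappa>_def I eq by (simp add: eq(4)[symmetric])
    ultimately have "2 * \<kappa> * unit_integral p = 2 / real (a + b + 1)"
      by (simp del: of_nat_add of_nat_Suc)
    then show ?thesis using True nat by simp
  next
    case False
    then show ?thesis using I nat by simp
  qed
  define F where "F \<theta> = 2 * \<kappa> * poly (antideriv p) ((sin (\<theta> / 2))\<^sup>2)" for \<theta>
  define f where "f \<theta> = \<kappa> * poly p ((sin (\<theta> / 2))\<^sup>2) * sin \<theta>" for \<theta>
  \<comment> \<open>The product formula requires sine and cosine of the half angle to be positive.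
    At the endpoints both sides vanish through the factor sin \<theta>.\<close>
  have eq: "indicator {0..pi} \<theta> * sin \<theta> * (wigner_d l m n \<theta> * wigner_d l' m n \<theta>) = f \<theta> * indicator {0..pi} \<theta>" for \<theta>
  proof (cases "0 < \<theta> \<and> \<theta> < pi")
    case True
    then have "sin (\<theta> / 2) > 0" "cos (\<theta> / 2) > 0" by (auto intro!: sin_gt_zero cos_gt_zero)
    from wigner_nat_product[OF this nat(1-4)]
    have "wigner_d l m n \<theta> * wigner_d l' m n \<theta> = \<kappa> * poly p ((sin (\<theta> / 2))\<^sup>2)"
      using assms by (simp add: wigner_d_eq_nat a_def b_def N_def a'_def b'_def N'_def M_def \<kappa>_def p_def)
    then show ?thesis by (simp add: f_def)
  next
    case False
    then have "\<theta> \<notin> {0..pi} \<or> \<theta> = 0 \<or> \<theta> = pi" by auto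
    then show ?thesis by (auto simp: f_def)
  qed
  have "has_bochner_integral lborel (\<lambda>\<theta>. f \<theta> * indicator {0..pi} \<theta>) (F pi - F 0)"
  proof (rule has_bochner_integral_FTC_Icc_real)
    fix \<theta> :: real
    have "((\<lambda>\<theta>. (sin (\<theta> / 2))\<^sup>2) has_real_derivative sin \<theta> / 2) (at \<theta>)"
      using sin_double[of "\<theta> / 2"] by (auto intro!: derivative_eq_intros simp: field_simps)
    then have "((\<lambda>\<theta>. poly (antideriv p) ((sin (\<theta> / 2))\<^sup>2)) has_real_derivative
        poly (pderiv (antideriv p)) ((sin (\<theta> / 2))\<^sup>2) * (sin \<theta> / 2)) (at \<theta>)"
      by (rule DERIV_chain2[OF poly_DERIV])
    from DERIV_cmult[OF this, of "2 * \<kappa>"] show "(F has_real_derivative f \<theta>) (at \<theta>)"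
      unfolding F_def f_def pderiv_antideriv by (simp add: mult_ac)
    show "isCont f \<theta>" unfolding f_def by (intro continuous_intros) auto
  qed simp
  moreover have "F pi - F 0 = 2 * \<kappa> * unit_integral p"
    by (simp add: F_def unit_integral_def algebra_simps)
  ultimately show ?thesis unfolding eq val by simp
qed

lemma wigner_d_orthogonal:
  assumes "\<bar>m\<bar> \<le> int l" "\<bar>n\<bar> \<le> int l" "\<bar>m\<bar> \<le> int l'" "\<bar>n\<bar> \<le> int l'"
  shows "has_bochner_integral lborel (\<lambda>\<theta>. indicator {0..pi} \<theta> * sin \<theta> * (wigner_d l m n \<theta> * wigner_d l' m n \<theta>))
           (if l = l' then 2 / (2 * real l + 1) else 0)"
proof (cases "l' \<le> l")
  case True
  then show ?thesis using wigner_d_orthogonal_le assms by blast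
next
  case False
  then show ?thesis using wigner_d_orthogonal_le[of m l n l'] assms by (simp add: mult.commute)
qed

lemma has_bochner_integral_cis:
  "has_bochner_integral lborel (\<lambda>\<phi>. indicator {0..<2*pi} \<phi> *\<^sub>R cis (of_int k * \<phi>)) (if k = 0 then 2 * pi else 0)"
proof -
  define F where "F \<phi> = (if k = 0 then of_real \<phi> else cis (of_int k * \<phi>) / (\<i> * of_int k))" for \<phi> :: real
  have "has_bochner_integral lborel (\<lambda>\<phi>. indicator {0..2*pi} \<phi> *\<^sub>R cis (of_int k * \<phi>)) (F (2*pi) - F 0)"
  proof (rule has_bochner_integral_FTC_Icc)
    fix \<phi> :: real
    show "(F has_vector_derivative cis (of_int k * \<phi>)) (at \<phi> within {0..2*pi})"
    proof (cases "k = 0")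
      case True
      then show ?thesis unfolding F_def by (auto intro!: derivative_eq_intros simp: has_vector_derivative_of_real)
    next
      case False
      have ii: "- (\<i> * (z * \<i>)) = z" for z by (simp add: complex_eq_iff)
      have "((\<lambda>\<phi>. exp (\<i> * (of_int k * of_real \<phi>)) / (\<i> * of_int k)) has_vector_derivative exp (\<i> * (of_int k * of_real \<phi>)))
          (at \<phi> within {0..2*pi})"
        by (rule has_vector_derivative_real_field) (use False in \<open>auto intro!: derivative_eq_intros simp: ii\<close>)
      then show ?thesis using False by (simp add: F_def[abs_def] cis_conv_exp)
    qed
  qed (auto intro!: continuous_intros)
  moreover have "F (2*pi) - F 0 = (if k = 0 then 2 * pi else 0)"
  proof -
    have "cis (of_int k * (2 * pi)) = 1"
      using cis_multiple_2pi[of "of_int k"] by (simp add: mult_ac)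
    then show ?thesis by (simp add: F_def)
  qed
  ultimately have 1: "has_bochner_integral lborel (\<lambda>\<phi>. indicator {0..2*pi} \<phi> *\<^sub>R cis (of_int k * \<phi>)) (if k = 0 then 2 * pi else 0)"
    by simp
  \<comment> \<open>The fundamental theorem was used on the closed interval; the half-open one
    differs from it by a null set.\<close>
  show ?thesis
  proof (rule has_bochner_integralI_AE[OF 1])
    have "AE \<phi> in lborel. \<phi> \<noteq> 2 * pi" by (rule AE_lborel_singleton)
    then show "AE \<phi> in lborel. indicator {0..2*pi} \<phi> *\<^sub>R cis (of_int k * \<phi>) = indicator {0..<2*pi} \<phi> *\<^sub>R cis (of_int k * \<phi>)"
      by eventually_elim (auto simp: indicator_def)
    have [measurable]: "(\<lambda>\<phi>. cis (of_int k * \<phi>)) \<in> borel_measurable borel"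
      by (intro borel_measurable_continuous_onI continuous_intros)
    show "(\<lambda>\<phi>. indicator {0..<2*pi} \<phi> *\<^sub>R cis (of_int k * \<phi>)) \<in> borel_measurable lborel" by simp
  qed
qed

section \<open>Surface measure, measurability and boundedness of the harmonics,
  orthonormality\<close>

lemma norm_sphere_point: "norm (sphere_point z) = 1"
proof -
  obtain \<theta> \<phi> where z: "z = (\<theta>, \<phi>)" by (cases z)
  have "(sin \<theta> * cos \<phi>)\<^sup>2 + (sin \<theta> * sin \<phi>)\<^sup>2 + (cos \<theta>)\<^sup>2 = (sin \<theta>)\<^sup>2 * ((cos \<phi>)\<^sup>2 + (sin \<phi>)\<^sup>2) + (cos \<theta>)\<^sup>2"
    by (simp only: power_mult_distrib distrib_left)
  also have "\<dots> = 1" by (simp only: sin_cos_squared_add sin_cos_squared_add2 mult_1_right)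
  finally have "(norm (sphere_point z))\<^sup>2 = 1"
    unfolding z sphere_point_def power2_norm_eq_inner inner_vec_def by (simp add: sum_3 vector_3 power2_eq_square)
  then show ?thesis by (simp add: power2_eq_1_iff) (metis norm_ge_zero not_one_le_zero neg_0_le_iff_le zero_le_one order_trans)
qed

lemma measurable_sphere_point[measurable]: "sphere_point \<in> borel \<rightarrow>\<^sub>M restrict_space borel (sphere 0 1)"
proof (rule measurable_restrict_space2)
  have "continuous_on UNIV sphere_point"
  proof -
    have "continuous_on UNIV (\<lambda>z. sphere_point z $ i)" for i
    proof -
      have "sphere_point z $ 1 = sin (fst z) * cos (snd z)" "sphere_point z $ 2 = sin (fst z) * sin (snd z)"
        "sphere_point z $ 3 = cos (fst z)" for z
        by (simp_all add: sphere_point_def case_prod_beta vector_3)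
      then show ?thesis using exhaust_3[of i] by (elim disjE) (simp_all add: continuous_intros)
    qed
    then have "continuous_on UNIV (\<lambda>z. \<chi> i. sphere_point z $ i)" by (intro continuous_on_vec_lambda)
    then show ?thesis by simp
  qed
  then show "sphere_point \<in> borel_measurable borel" by (rule borel_measurable_continuous_onI)
  show "sphere_point \<in> space borel \<rightarrow> sphere 0 1" by (auto simp: norm_sphere_point)
qed

lemma space_sphere_measure[simp]: "space sphere_measure = sphere 0 1"
  by (simp add: sphere_measure_def space_restrict_space)

lemma sets_sphere_measure[measurable_cong]: "sets sphere_measure = sets (restrict_space borel (sphere 0 1))"
  by (simp add: sphere_measure_def)

lemma finite_measure_sphere: "finite_measure sphere_measure"
proof (rule finite_measureI)
  let ?f = "\<lambda>(\<theta>, \<phi>). ennreal (indicator ({0..pi} \<times> {0..<2*pi}) (\<theta>, \<phi>) * sin \<theta>)"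
  let ?D = "density lborel ?f"
  have [measurable]: "?f \<in> borel_measurable borel" by (simp add: borel_prod[symmetric])
  have m: "sphere_point \<in> ?D \<rightarrow>\<^sub>M restrict_space borel (sphere 0 1)" by simp
  have "emeasure sphere_measure (space sphere_measure) = emeasure ?D (sphere_point -` sphere 0 1 \<inter> space ?D)"
    unfolding sphere_measure_def
    by (subst emeasure_distr[OF m]) (auto simp: space_restrict_space sets_restrict_space)
  also have "\<dots> \<le> emeasure ?D UNIV" by (rule emeasure_mono) auto
  also have "\<dots> = (\<integral>\<^sup>+ z. ?f z \<partial>lborel)" by (subst emeasure_density) auto
  also have "\<dots> \<le> (\<integral>\<^sup>+ z. indicator (cbox (0, 0) (pi, 2*pi)) z \<partial>lborel)"
    by (intro nn_integral_mono) (auto simp: indicator_def cbox_Pair_eq split: prod.splits)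
  also have "\<dots> < \<infinity>" using emeasure_bounded_finite[OF bounded_cbox] by simp
  finally show "emeasure sphere_measure (space sphere_measure) \<noteq> \<infinity>" by simp
qed

lemma continuous_wigner_d: "continuous_on S (wigner_d l m n)"
  unfolding wigner_d_def by (intro continuous_intros) auto

lemma sphere_component: "x \<in> sphere 0 1 \<Longrightarrow> \<bar>x $ i\<bar> \<le> (1 :: real)" for x :: "real ^ 3"
  using component_le_norm_cart[of x i] by simp

text \<open>Integer powers of \<open>sgn z\<close> do not see the branch cut of \<open>Arg\<close>,
  which makes measurability straightforward; the value 1 at the origin reflects
  \<open>Arg 0 = 0\<close>.\<close>

lemma cis_mult_Arg: "cis (real_of_int m * Arg z) = (if z = 0 then 1 else sgn z powi m)"
proof (cases "z = 0")
  case False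
  then show ?thesis using cis_power_int[of "Arg z" m] by (simp add: cis_Arg)
qed (simp add: Arg_zero)

lemma measurable_cis_mult_Arg[measurable]: "(\<lambda>z. cis (real_of_int m * Arg z)) \<in> borel_measurable borel"
proof -
  have [measurable]: "(\<lambda>z::complex. sgn z) \<in> borel_measurable borel"
    unfolding sgn_div_norm by measurable
  show ?thesis
  proof (cases "m \<ge> 0")
    case True
    then have "(\<lambda>z::complex. sgn z powi m) = (\<lambda>z. sgn z ^ nat m)"
      by (simp add: fun_eq_iff power_int_nonneg_exp)
    then have [measurable]: "(\<lambda>z::complex. sgn z powi m) \<in> borel_measurable borel" by simp
    show ?thesis unfolding cis_mult_Arg by measurable
  next
    case False
    then have "(\<lambda>z::complex. sgn z powi m) = (\<lambda>z. inverse (sgn z ^ nat (- m)))"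
      by (simp add: fun_eq_iff power_int_def power_inverse)
    then have [measurable]: "(\<lambda>z::complex. sgn z powi m) \<in> borel_measurable borel" by simp
    show ?thesis unfolding cis_mult_Arg by measurable
  qed
qed

lemma measurable_spin_Y[measurable]: "spin_Y s l m \<in> borel_measurable (restrict_space borel (sphere 0 1))"
proof -
  have "continuous_on (sphere 0 1) (\<lambda>x::real^3. complex_of_real (wigner_d l (- m) s (arccos (x $ 3))))"
    by (intro continuous_intros continuous_on_compose2[OF continuous_wigner_d[of UNIV]])
       (use sphere_component[of _ 3] in \<open>auto simp: abs_le_iff minus_le_iff\<close>)
  then have [measurable]: "(\<lambda>x::real^3. complex_of_real (wigner_d l (- m) s (arccos (x $ 3)))) \<in> borel_measurable (restrict_space borel (sphere 0 1))"
    by (rule borel_measurable_continuous_on_restrict)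
  have "(\<lambda>x::real^3. Complex (x $ 1) (x $ 2)) \<in> borel_measurable borel"
    unfolding Complex_eq by measurable
  then have [measurable]: "(\<lambda>x::real^3. Complex (x $ 1) (x $ 2)) \<in> borel_measurable (restrict_space borel (sphere 0 1))"
    by (rule measurable_restrict_space1)
  show ?thesis unfolding spin_Y_def[abs_def] by measurable
qed

lemma bounded_spin_Y: "\<exists>c>0. \<forall>x\<in>sphere 0 1. cmod (spin_Y s l m x) \<le> c"
proof -
  have "bounded (wigner_d l (- m) s ` {0..pi})"
    by (intro compact_imp_bounded compact_continuous_image continuous_wigner_d) simp
  then obtain c where c: "c > 0" "\<And>\<theta>. \<theta> \<in> {0..pi} \<Longrightarrow> \<bar>wigner_d l (- m) s \<theta>\<bar> \<le> c"
    by (auto simp: bounded_pos)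
  have "cmod (spin_Y s l m x) \<le> sqrt ((2 * real l + 1) / (4 * pi)) * c" if "x \<in> sphere 0 1" for x
  proof -
    have "cmod (spin_Y s l m x) = sqrt ((2 * real l + 1) / (4 * pi)) * \<bar>wigner_d l (- m) s (arccos (x $ 3))\<bar>"
      unfolding spin_Y_def norm_mult by (simp add: norm_power_int)
    moreover have "\<bar>wigner_d l (- m) s (arccos (x $ 3))\<bar> \<le> c"
      using sphere_component[OF that, of 3] by (intro c) (auto simp: abs_le_iff minus_le_iff intro!: arccos_lbound arccos_ubound)
    ultimately show ?thesis by (simp add: mult_left_mono)
  qed
  moreover have "sqrt ((2 * real l + 1) / (4 * pi)) * c > 0" using c by simp
  ultimately show ?thesis by blast
qed

text \<open>\<open>Arg\<close> recovers \<phi> only up to a multiple of 2 \<pi>, which is invisible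
  because \<open>m\<close> is an integer. At the poles \<phi> is lost altogether, hence the strict
  inequalities.\<close>

lemma spin_Y_sphere_point:
  assumes "0 < \<theta>" "\<theta> < pi"
  shows "spin_Y s l m (sphere_point (\<theta>, \<phi>)) = (-1) powi m * complex_of_real (sqrt ((2 * real l + 1) / (4 * pi))) *
     cis (real_of_int m * \<phi>) * complex_of_real (wigner_d l (- m) s \<theta>)"
proof -
  have s: "sin \<theta> > 0" using assms by (rule sin_gt_zero)
  have z: "Complex (sin \<theta> * cos \<phi>) (sin \<theta> * sin \<phi>) = of_real (sin \<theta>) * cis \<phi>"
    by (simp add: complex_eq_iff)
  have "sgn (of_real (sin \<theta>) * cis \<phi>) = cis \<phi>"
    using s by (simp add: sgn_mult sgn_of_real sgn_eq norm_mult)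
  then have "cis (real_of_int m * Arg (Complex (sin \<theta> * cos \<phi>) (sin \<theta> * sin \<phi>))) = cis (real_of_int m * \<phi>)"
    unfolding cis_mult_Arg z using s by (simp add: cis_power_int)
  then show ?thesis
    using assms by (simp add: spin_Y_def sphere_point_def arccos_cos)
qed

text \<open>In spherical coordinates the integrand is a product: the \<phi>-integral forces m = m',
  after which the \<theta>-integral is the orthogonality of Wigner functions with common indices.
  The total 2 \<pi> * 2 / (2 l + 1) is cancelled by the normalization. At the poles the density sin
  \<theta> vanishes.\<close>

theorem spin_Y_orthonormal:
  assumes "\<bar>s\<bar> \<le> int l" "\<bar>m\<bar> \<le> int l" "\<bar>s\<bar> \<le> int l'" "\<bar>m'\<bar> \<le> int l'"
  shows "(CLINT x|sphere_measure. spin_Y s l m x * cnj (spin_Y s l' m' x)) = (if l = l' \<and> m = m' then 1 else 0)"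
proof -
  let ?i = "\<lambda>z :: real \<times> real. indicator ({0..pi} \<times> {0..<2*pi}) z * sin (fst z)"
  let ?G = "\<lambda>x. spin_Y s l m x * cnj (spin_Y s l' m' x)"
  have [measurable]: "(\<lambda>x. cnj (spin_Y s l m x)) \<in> borel_measurable (restrict_space borel (sphere 0 1))" for l m
    by (rule measurable_compose[OF measurable_spin_Y borel_measurable_continuous_onI]) (intro continuous_intros)
  have [measurable]: "?i \<in> borel_measurable borel" by (simp add: borel_prod[symmetric])
  have f: "(\<lambda>(\<theta>, \<phi>). ennreal (indicator ({0..pi} \<times> {0..<2*pi}) (\<theta>, \<phi>) * sin \<theta>)) = (\<lambda>z. ennreal (?i z))"
    by (auto simp: fun_eq_iff)
  have sin0: "0 \<le> ?i z" for z by (auto simp: indicator_def sin_ge_zero)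
  define W where "W \<theta> = indicator {0..pi} \<theta> * sin \<theta> * (wigner_d l (- m) s \<theta> * wigner_d l' (- m') s \<theta>)" for \<theta>
  define E where "E \<phi> = indicator {0..<2*pi} \<phi> *\<^sub>R cis (of_int (m - m') * \<phi>)" for \<phi>
  define c where "c = (-1) powi m * complex_of_real (sqrt ((2 * real l + 1) / (4 * pi))) *
      ((-1) powi m' * complex_of_real (sqrt ((2 * real l' + 1) / (4 * pi))))"
  have E: "has_bochner_integral lborel E (if m - m' = 0 then 2 * pi else 0)"
    unfolding E_def by (rule has_bochner_integral_cis)
  have "continuous_on UNIV (\<lambda>\<theta>. wigner_d l (- m) s \<theta> * wigner_d l' (- m') s \<theta>)"
    by (intro continuous_intros continuous_wigner_d)
  then have [measurable]: "(\<lambda>\<theta>. wigner_d l (- m) s \<theta> * wigner_d l' (- m') s \<theta>) \<in> borel_measurable borel"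
    by (rule borel_measurable_continuous_onI)
  have iW: "integrable lborel W"
  proof -
    have "integrable lborel (\<lambda>x. indicator {0..pi} x *\<^sub>R (sin x * (wigner_d l (- m) s x * wigner_d l' (- m') s x)))"
      by (rule borel_integrable_compact) (intro compact_Icc continuous_intros continuous_wigner_d)+
    then show ?thesis by (simp add: W_def[abs_def] mult.assoc)
  qed
  have pt: "?i (\<theta>, \<phi>) *\<^sub>R ?G (sphere_point (\<theta>, \<phi>)) = c * (W \<theta> *\<^sub>R E \<phi>)" for \<theta> \<phi>
  proof (cases "0 < \<theta> \<and> \<theta> < pi")
    case True
    have "cis (real_of_int m * \<phi>) * cnj (cis (real_of_int m' * \<phi>)) = cis (of_int (m - m') * \<phi>)"
      by (simp add: cis_mult cis_cnj left_diff_distrib)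
    moreover have "cnj ((-1) powi m') = (-1) powi m'" by simp
    ultimately have "?G (sphere_point (\<theta>, \<phi>)) = c * (complex_of_real (wigner_d l (- m) s \<theta> * wigner_d l' (- m') s \<theta>) * cis (of_int (m - m') * \<phi>))"
      using True unfolding c_def by (simp add: spin_Y_sphere_point mult_ac)
    then show ?thesis using True by (auto simp: W_def E_def scaleR_conv_of_real indicator_def)
  next
    case False
    then have "?i (\<theta>, \<phi>) = 0" "W \<theta> = 0" by (auto simp: W_def indicator_def)
    then show ?thesis by simp
  qed
  have iE: "integrable lborel E" using E by (rule integrable.intros)
  have iWE: "integrable (lborel \<Otimes>\<^sub>M lborel) (\<lambda>(\<theta>, \<phi>). c * (W \<theta> *\<^sub>R E \<phi>))"
  proof (rule lborel_pair.Fubini_integrable)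
    have [measurable]: "W \<in> borel_measurable lborel" "E \<in> borel_measurable lborel" using iW iE by auto
    show "(\<lambda>(\<theta>, \<phi>). c * (W \<theta> *\<^sub>R E \<phi>)) \<in> borel_measurable (lborel \<Otimes>\<^sub>M lborel)" by measurable
    show "integrable lborel (\<lambda>\<theta>. \<integral>\<phi>. norm (case (\<theta>, \<phi>) of (\<theta>, \<phi>) \<Rightarrow> c * (W \<theta> *\<^sub>R E \<phi>)) \<partial>lborel)"
      using iW by (simp add: norm_mult)
    show "AE \<theta> in lborel. integrable lborel (\<lambda>\<phi>. case (\<theta>, \<phi>) of (\<theta>, \<phi>) \<Rightarrow> c * (W \<theta> *\<^sub>R E \<phi>))"
      using iE by simp
  qed
  have "(CLINT x|sphere_measure. ?G x) = (CLINT z|density lborel (\<lambda>z. ennreal (?i z)). ?G (sphere_point z))"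
    unfolding sphere_measure_def f by (rule integral_distr) measurable
  also have "\<dots> = (CLINT z|lborel. ?i z *\<^sub>R ?G (sphere_point z))"
    by (rule integral_density) (use sin0 in auto)
  also have "\<dots> = (CLINT z|lborel \<Otimes>\<^sub>M lborel. (case z of (\<theta>, \<phi>) \<Rightarrow> c * (W \<theta> *\<^sub>R E \<phi>)))"
    unfolding lborel_prod by (rule Bochner_Integration.integral_cong[OF refl]) (use pt in \<open>auto split: prod.splits\<close>)
  also have "\<dots> = (CLINT \<theta>|lborel. CLINT \<phi>|lborel. c * (W \<theta> *\<^sub>R E \<phi>))"
    using lborel_pair.integral_fst[OF iWE] by simp
  also have "\<dots> = c * ((LINT \<theta>|lborel. W \<theta>) * (CLINT \<phi>|lborel. E \<phi>))"
    by (simp add: scaleR_conv_of_real)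
  also have "\<dots> = (if l = l' \<and> m = m' then 1 else 0)"
  proof (cases "m = m'")
    case True
    have "has_bochner_integral lborel W (if l = l' then 2 / (2 * real l + 1) else 0)"
      unfolding W_def True by (rule wigner_d_orthogonal) (use assms True in auto)
    then have IW: "(LINT \<theta>|lborel. W \<theta>) = (if l = l' then 2 / (2 * real l + 1) else 0)"
      by (rule has_bochner_integral_integral_eq)
    have IE: "(CLINT \<phi>|lborel. E \<phi>) = complex_of_real (2 * pi)"
      using has_bochner_integral_integral_eq[OF E] True by simp
    show ?thesis
    proof (cases "l = l'")
      case eq: True
      have "(-1 :: complex) powi m' * (-1) powi m' = 1"
        by (simp flip: power_int_mult_distrib)
      moreover have "complex_of_real (sqrt ((2 * real l' + 1) / (4 * pi))) * complex_of_real (sqrt ((2 * real l' + 1) / (4 * pi))) = complex_of_real ((2 * real l' + 1) / (4 * pi))"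
        by (simp flip: of_real_mult)
      ultimately have "c = complex_of_real ((2 * real l' + 1) / (4 * pi))"
        unfolding c_def True eq by (metis (no_types, lifting) mult.assoc mult.left_commute mult_1)
      then show ?thesis unfolding IW IE using True eq
        by (simp add: of_real_mult[symmetric] del: of_real_mult of_real_divide of_real_add)
    qed (simp add: IW)
  next
    case False
    then have "(CLINT \<phi>|lborel. E \<phi>) = 0" using has_bochner_integral_integral_eq[OF E] by simp
    then show ?thesis using False by simp
  qed
  finally show ?thesis .
qed

section \<open>Integrals of a random field over the sphere\<close>

text \<open>The paths need not be continuous, so \<open>\<integral> H \<omega> x dx\<close> need not be a function of the field measurable
  for the product algebra of the values \<open>H \<omega> x\<close>. By Fubini it agrees almost surely with its conditional
  expectation given these values.\<close>

lemma (in prob_space) AE_cond_exp_integral: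
  fixes H :: "'a \<Rightarrow> 'x \<Rightarrow> real"
  assumes S: "sigma_finite_measure S" and sub: "subalgebra M \<G>"
    and int: "integrable (M \<Otimes>\<^sub>M S) (\<lambda>(\<omega>, x). H \<omega> x)"
    and meas: "\<And>x. x \<in> space S \<Longrightarrow> (\<lambda>\<omega>. H \<omega> x) \<in> borel_measurable \<G>"
  shows "AE \<omega> in M. real_cond_exp M \<G> (\<lambda>\<omega>. LINT x|S. H \<omega> x) \<omega> = (LINT x|S. H \<omega> x)"
proof -
  interpret S: sigma_finite_measure S by fact
  interpret G: finite_measure_subalgebra M \<G>
    by standard (rule sub)
  interpret MS: pair_sigma_finite M S ..
  define L where "L \<omega> = (LINT x|S. H \<omega> x)" for \<omega>
  have iL: "integrable M L" unfolding L_def by (rule MS.integrable_fst[OF int])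
  have iR: "integrable M (real_cond_exp M \<G> L)" by (rule G.real_cond_exp_int(1)[OF iL])
  have [measurable]: "(\<lambda>(\<omega>, x). H \<omega> x) \<in> borel_measurable (M \<Otimes>\<^sub>M S)" using int by simp
  have "AE \<omega> in M. L \<omega> = real_cond_exp M \<G> L \<omega>"
  proof (rule density_unique_real[OF iL iR])
    fix A assume [measurable]: "A \<in> sets M"
    let ?I = "indicator A :: 'a \<Rightarrow> real"
    \<comment> \<open>Testing against an event \<open>A\<close>: the indicator may be replaced by
      its conditional expectation \<open>c\<close> under the integral over \<open>S\<close>, because
      each \<open>H\<close> at fixed \<open>x\<close> is measurable for the subalgebra. Afterwards
      the conditional expectation is moved from the indicator to \<open>L\<close> by
      self-adjointness.\<close>
    define c where "c = real_cond_exp M \<G> ?I"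
    have iI: "integrable M ?I" by (rule integrable_const_bound[where B=1]) (auto simp: indicator_def)
    have [measurable]: "c \<in> borel_measurable M" "c \<in> borel_measurable \<G>" unfolding c_def by auto
    have c: "AE \<omega> in M. \<bar>c \<omega>\<bar> \<le> 1"
    proof -
      have "AE \<omega> in M. c \<omega> \<ge> 0" "AE \<omega> in M. c \<omega> \<le> 1" unfolding c_def
        by (rule G.real_cond_exp_ge_c[OF iI]; simp) (rule G.real_cond_exp_le_c[OF iI]; simp add: indicator_def)
      then show ?thesis by eventually_elim auto
    qed
    have swap: "(LINT \<omega>|M. f \<omega> * L \<omega>) = (LINT x|S. LINT \<omega>|M. f \<omega> * H \<omega> x)"
      if [measurable]: "f \<in> borel_measurable M" and f: "AE \<omega> in M. \<bar>f \<omega>\<bar> \<le> 1" for f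
    proof -
      have "AE z in M \<Otimes>\<^sub>M S. \<bar>f (fst z)\<bar> \<le> 1"
      proof (rule MS.AE_pair_measure)
        show "AE \<omega> in M. AE x in S. \<bar>f (fst (\<omega>, x))\<bar> \<le> 1" using f by eventually_elim simp
      qed measurable
      then have "integrable (M \<Otimes>\<^sub>M S) (\<lambda>z. f (fst z) * (case z of (\<omega>, x) \<Rightarrow> H \<omega> x))"
        by (intro Bochner_Integration.integrable_bound[OF int])
          (auto elim!: eventually_mono simp: abs_mult intro!: mult_left_le_one_le)
      then have i: "integrable (M \<Otimes>\<^sub>M S) (\<lambda>(\<omega>, x). f \<omega> * H \<omega> x)" by (simp add: case_prod_unfold)
      have "(LINT \<omega>|M. f \<omega> * L \<omega>) = (LINT \<omega>|M. LINT x|S. f \<omega> * H \<omega> x)" by (simp add: L_def)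
      also have "\<dots> = (LINT x|S. LINT \<omega>|M. f \<omega> * H \<omega> x)"
        using MS.integral_fst[OF i] MS.integral_snd[OF i] by simp
      finally show ?thesis .
    qed
    have "(LINT \<omega>|M. c \<omega> * L \<omega>) = (LINT x|S. LINT \<omega>|M. c \<omega> * H \<omega> x)"
      by (rule swap[OF _ c]) simp
    also have "\<dots> = (LINT x|S. LINT \<omega>|M. ?I \<omega> * H \<omega> x)"
    proof (rule integral_cong_AE)
      show "(\<lambda>x. LINT \<omega>|M. c \<omega> * H \<omega> x) \<in> borel_measurable S" "(\<lambda>x. LINT \<omega>|M. ?I \<omega> * H \<omega> x) \<in> borel_measurable S"
        by measurable
      have "AE x in S. integrable M (\<lambda>\<omega>. H \<omega> x)" by (rule MS.AE_integrable_snd[OF int])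
      then show "AE x in S. (LINT \<omega>|M. c \<omega> * H \<omega> x) = (LINT \<omega>|M. ?I \<omega> * H \<omega> x)"
      proof (rule AE_mp, intro AE_I2 impI)
        fix x assume x: "x \<in> space S" and i: "integrable M (\<lambda>\<omega>. H \<omega> x)"
        have "integrable M (\<lambda>\<omega>. H \<omega> x * ?I \<omega>)"
          using integrable_mult_indicator[OF \<open>A \<in> sets M\<close> i] by (simp add: mult.commute)
        from G.real_cond_exp_intg(2)[OF this meas[OF x]] show "(LINT \<omega>|M. c \<omega> * H \<omega> x) = (LINT \<omega>|M. ?I \<omega> * H \<omega> x)"
          by (simp add: c_def mult.commute)
      qed
    qed
    also have "\<dots> = (LINT \<omega>|M. ?I \<omega> * L \<omega>)"
      by (rule swap[symmetric]) auto
    finally have 1: "(LINT \<omega>|M. c \<omega> * L \<omega>) = (LINT \<omega>|M. ?I \<omega> * L \<omega>)" .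
    have "(LINT \<omega>|M. c \<omega> * L \<omega>) = (LINT \<omega>|M. c \<omega> * real_cond_exp M \<G> L \<omega>)"
    proof -
      have "integrable M (\<lambda>\<omega>. c \<omega> * L \<omega>)"
        by (rule Bochner_Integration.integrable_bound[OF iL])
          (use iL c in \<open>auto elim!: eventually_mono simp: abs_mult intro!: mult_left_le_one_le\<close>)
      from G.real_cond_exp_intg(2)[OF this] iL show ?thesis by simp
    qed
    also have "\<dots> = (LINT \<omega>|M. real_cond_exp M \<G> L \<omega> * ?I \<omega>)"
    proof -
      have "integrable M (\<lambda>\<omega>. real_cond_exp M \<G> L \<omega> * ?I \<omega>)"
        using integrable_mult_indicator[OF \<open>A \<in> sets M\<close> iR] by (simp add: mult.commute)
      from G.real_cond_exp_intg(2)[OF this] show ?thesis by (simp add: c_def mult.commute)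
    qed
    finally show "(LINT \<omega>:A|M. L \<omega>) = (LINT \<omega>:A|M. real_cond_exp M \<G> L \<omega>)"
      unfolding set_lebesgue_integral_def using 1 by (simp add: mult.commute)
  qed
  then have "AE \<omega> in M. real_cond_exp M \<G> L \<omega> = L \<omega>" by (rule AE_symmetric)
  then show ?thesis unfolding L_def .
qed

text \<open>The conditional expectations given the single paths serve as the versions \<open>R r\<close>.\<close>

lemma (in prob_space) indep_version_of_path_integrals:
  fixes F :: "'i \<Rightarrow> 'a \<Rightarrow> 'x \<Rightarrow> 'b :: topological_space" and H :: "'i \<Rightarrow> 'a \<Rightarrow> 'x \<Rightarrow> real"
  assumes S: "sigma_finite_measure S"
    and indep: "indep_vars (\<lambda>_. \<Pi>\<^sub>M x\<in>space S. borel) (\<lambda>r \<omega>. restrict (F r \<omega>) (space S)) I"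
    and int: "\<And>r. r \<in> I \<Longrightarrow> integrable (M \<Otimes>\<^sub>M S) (\<lambda>(\<omega>, x). H r \<omega> x)"
    and H: "\<And>r x. r \<in> I \<Longrightarrow> x \<in> space S \<Longrightarrow> \<exists>h\<in>borel_measurable borel. \<forall>\<omega>. H r \<omega> x = h (F r \<omega> x)"
  obtains R where "indep_vars (\<lambda>_. borel) R I" "\<And>r. r \<in> I \<Longrightarrow> AE \<omega> in M. R r \<omega> = (LINT x|S. H r \<omega> x)"
proof
  let ?X = "\<lambda>r \<omega>. restrict (F r \<omega>) (space S)"
  let ?G = "\<lambda>r. vimage_algebra (space M) (?X r) (\<Pi>\<^sub>M x\<in>space S. borel)"
  let ?R = "\<lambda>r. real_cond_exp M (?G r) (\<lambda>\<omega>. LINT x|S. H r \<omega> x)"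
  have rv: "?X r \<in> M \<rightarrow>\<^sub>M (\<Pi>\<^sub>M x\<in>space S. borel)" if "r \<in> I" for r
    using indep that by (auto simp: indep_vars_def)
  have sp: "?X r \<in> space M \<rightarrow> space (\<Pi>\<^sub>M x\<in>space S. (borel :: 'b measure))" for r
    by (auto simp: space_PiM)
  have setsG: "sets (?G r) = {?X r -` A \<inter> space M | A. A \<in> sets (\<Pi>\<^sub>M x\<in>space S. borel)}" for r
    by (rule sets_vimage_algebra2[OF sp])
  have sub: "subalgebra M (?G r)" if "r \<in> I" for r
    unfolding subalgebra_def setsG using rv[OF that] by auto
  have "indep_sets (\<lambda>r. {?X r -` A \<inter> space M | A. A \<in> sets (\<Pi>\<^sub>M x\<in>space S. borel)}) I"
    using indep by (simp add: indep_vars_def2)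
  then have "indep_sets (\<lambda>r. {?R r -` A \<inter> space M | A. A \<in> sets borel}) I"
  proof (rule indep_sets_mono_sets)
    fix r assume r: "r \<in> I"
    have "?R r \<in> borel_measurable (?G r)" by simp
    then show "{?R r -` A \<inter> space M | A. A \<in> sets borel} \<subseteq> {?X r -` A \<inter> space M | A. A \<in> sets (\<Pi>\<^sub>M x\<in>space S. borel)}"
      unfolding setsG[symmetric] by (auto simp: measurable_def)
  qed
  then show "indep_vars (\<lambda>_. borel) ?R I" by (simp add: indep_vars_def2)
  show "AE \<omega> in M. ?R r \<omega> = (LINT x|S. H r \<omega> x)" if r: "r \<in> I" for r
  proof (rule AE_cond_exp_integral[OF S sub[OF r] int[OF r]])
    \<comment> \<open>Each value \<open>H r \<omega> x\<close> is a function of one coordinate of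
      the path, hence measurable for the algebra that the path generates.\<close>
    fix x assume x: "x \<in> space S"
    obtain h where h: "h \<in> borel_measurable borel" "\<And>\<omega>. H r \<omega> x = h (F r \<omega> x)"
      using H[OF r x] by blast
    have "?X r \<in> ?G r \<rightarrow>\<^sub>M (\<Pi>\<^sub>M x\<in>space S. borel)" by (rule measurable_vimage_algebra1[OF sp])
    then have "(\<lambda>\<omega>. ?X r \<omega> x) \<in> borel_measurable (?G r)"
      by (rule measurable_compose[OF _ measurable_component_singleton[OF x]])
    then have "(\<lambda>\<omega>. h (?X r \<omega> x)) \<in> borel_measurable (?G r)" by (rule measurable_compose[OF _ h(1)])
    then show "(\<lambda>\<omega>. H r \<omega> x) \<in> borel_measurable (?G r)" using x by (simp add: h(2))
  qed
qed

section \<open>Harmonic coefficients of a Gaussian spin field\<close>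

definition harmonic_coeff :: "int \<Rightarrow> nat \<times> int \<Rightarrow> (real^3 \<Rightarrow> complex) \<Rightarrow> complex" where
  "harmonic_coeff s i f = (CLINT x|sphere_measure. f x * cnj (spin_Y s (fst i) (snd i) x))"

interpretation sphere: finite_measure sphere_measure by (rule finite_measure_sphere)

lemma spin_Y_measurable_sphere[measurable]: "spin_Y s l m \<in> borel_measurable sphere_measure"
  using measurable_spin_Y by (simp add: measurable_cong_sets[OF sets_sphere_measure refl])

lemma cnj_measurable[measurable (raw)]: "f \<in> borel_measurable N \<Longrightarrow> (\<lambda>x. cnj (f x)) \<in> borel_measurable N"
  by (rule measurable_compose[OF _ borel_measurable_continuous_onI]) (auto intro: continuous_intros)

lemma integrable_mult_spin_Y:
  assumes "integrable sphere_measure f"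
  shows "integrable sphere_measure (\<lambda>x. f x * cnj (spin_Y s l m x))"
    and "integrable sphere_measure (\<lambda>x. f x * spin_Y s l m x)"
proof -
  have [measurable]: "f \<in> borel_measurable sphere_measure" using assms by simp
  obtain c where c: "c > 0" "\<And>x. x \<in> sphere 0 1 \<Longrightarrow> cmod (spin_Y s l m x) \<le> c"
    using bounded_spin_Y by blast
  have b: "AE x in sphere_measure. norm (f x * spin_Y s l m x) \<le> norm (c * norm (f x))"
    by (rule AE_I2) (use c in \<open>simp add: norm_mult mult.commute[of c] mult_left_mono\<close>)
  show "integrable sphere_measure (\<lambda>x. f x * spin_Y s l m x)"
    by (rule Bochner_Integration.integrable_bound[where f="\<lambda>x. c * norm (f x)"]) (use assms b in auto)
  show "integrable sphere_measure (\<lambda>x. f x * cnj (spin_Y s l m x))"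
    by (rule Bochner_Integration.integrable_bound[where f="\<lambda>x. c * norm (f x)"]) (use assms b in \<open>auto simp: norm_mult\<close>)
qed

lemma integrable_spin_Y: "integrable sphere_measure (spin_Y s l m)"
  using integrable_mult_spin_Y(2)[of "\<lambda>_. 1" s l m] by simp

lemma harmonic_coeff_add:
  assumes "integrable sphere_measure f" "integrable sphere_measure g"
  shows "harmonic_coeff s i (\<lambda>x. f x + g x) = harmonic_coeff s i f + harmonic_coeff s i g"
  unfolding harmonic_coeff_def
  using assms by (simp add: distrib_right integrable_mult_spin_Y)

lemma le_one_plus_square: "r \<le> 1 + r\<^sup>2" for r :: real
  using zero_le_power2[of "r - 1/2"] by (simp add: power2_diff power_divide)

lemma square_integrable_sphere:
  assumes [measurable]: "f \<in> borel_measurable sphere_measure"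
    and fin: "(\<integral>\<^sup>+ x. ennreal ((cmod (f x))\<^sup>2) \<partial>sphere_measure) < \<infinity>"
  shows "integrable sphere_measure (\<lambda>x. (cmod (f x))\<^sup>2)" "integrable sphere_measure f"
proof -
  show sq: "integrable sphere_measure (\<lambda>x. (cmod (f x))\<^sup>2)"
    by (rule integrableI_nonneg) (use fin in auto)
  show "integrable sphere_measure f"
  proof (rule Bochner_Integration.integrable_bound)
    show "integrable sphere_measure (\<lambda>x. 1 + (cmod (f x))\<^sup>2)" using sq by simp
    show "AE x in sphere_measure. norm (f x) \<le> norm (1 + (cmod (f x))\<^sup>2)" by (simp add: le_one_plus_square)
  qed simp
qed

text \<open>Bessel's inequality for one harmonic: expand the squared norm of f - c Y, with c the
  coefficient of f. Applied to the remainder of the expansion, it bounds the error of a coefficient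
  by the tail.\<close>

lemma harmonic_coeff_bessel:
  assumes f[measurable]: "f \<in> borel_measurable sphere_measure" and l: "\<bar>s\<bar> \<le> int l" "\<bar>m\<bar> \<le> int l"
  shows "(\<integral>\<^sup>+ x. ennreal ((cmod (f x))\<^sup>2) \<partial>sphere_measure) < \<infinity> \<Longrightarrow>
    ennreal ((cmod (harmonic_coeff s (l, m) f))\<^sup>2) \<le> (\<integral>\<^sup>+ x. ennreal ((cmod (f x))\<^sup>2) \<partial>sphere_measure)"
proof -
  assume fin: "(\<integral>\<^sup>+ x. ennreal ((cmod (f x))\<^sup>2) \<partial>sphere_measure) < \<infinity>"
  note int = square_integrable_sphere[OF f fin]
  let ?Y = "spin_Y s l m"
  define c where "c = harmonic_coeff s (l, m) f"
  have i1: "integrable sphere_measure (\<lambda>x. f x * cnj (?Y x))" by (rule integrable_mult_spin_Y(1)[OF int(2)])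
  have i2: "integrable sphere_measure (\<lambda>x. ?Y x * cnj (?Y x))" by (rule integrable_mult_spin_Y(1)[OF integrable_spin_Y])
  have i2': "integrable sphere_measure (\<lambda>x. (cmod (?Y x))\<^sup>2)" and Y1: "(LINT x|sphere_measure. (cmod (?Y x))\<^sup>2) = 1"
  proof -
    have "(\<lambda>x. ?Y x * cnj (?Y x)) = (\<lambda>x. complex_of_real ((cmod (?Y x))\<^sup>2))"
      by (simp only: complex_norm_square)
    then show "(LINT x|sphere_measure. (cmod (?Y x))\<^sup>2) = 1"
      using spin_Y_orthonormal[OF l l] by (simp del: of_real_power add: complex_eq_iff)
    show "integrable sphere_measure (\<lambda>x. (cmod (?Y x))\<^sup>2)"
      using integrable_norm[OF i2] by (simp add: norm_mult power2_eq_square)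
  qed
  define R where "R x = Re (cnj c * (f x * cnj (?Y x)))" for x
  have eq: "(cmod (f x - c * ?Y x))\<^sup>2 = (cmod (f x))\<^sup>2 - 2 * R x + (cmod c)\<^sup>2 * (cmod (?Y x))\<^sup>2" for x
    unfolding cmod_power2 R_def by (simp add: power2_eq_square algebra_simps)
  have ir: "integrable sphere_measure R"
    unfolding R_def using i1 by (intro integrable_Re integrable_mult_right)
  have "0 \<le> (LINT x|sphere_measure. (cmod (f x - c * ?Y x))\<^sup>2)" by (rule integral_nonneg_AE) simp
  also have "\<dots> = (LINT x|sphere_measure. (cmod (f x))\<^sup>2) - 2 * (LINT x|sphere_measure. R x) + (cmod c)\<^sup>2"
    unfolding eq using int ir i2' Y1 by simp
  also have "(LINT x|sphere_measure. R x) = (cmod c)\<^sup>2"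
  proof -
    have "(LINT x|sphere_measure. R x) = Re (CLINT x|sphere_measure. cnj c * (f x * cnj (?Y x)))"
      unfolding R_def by (rule integral_Re) (use i1 in simp)
    also have "(CLINT x|sphere_measure. cnj c * (f x * cnj (?Y x))) = cnj c * c"
      by (simp add: c_def harmonic_coeff_def)
    finally show ?thesis unfolding cmod_power2 by (simp add: power2_eq_square)
  qed
  finally have "(cmod c)\<^sup>2 \<le> (LINT x|sphere_measure. (cmod (f x))\<^sup>2)" by simp
  also have "ennreal (LINT x|sphere_measure. (cmod (f x))\<^sup>2) = (\<integral>\<^sup>+ x. ennreal ((cmod (f x))\<^sup>2) \<partial>sphere_measure)"
    by (rule nn_integral_eq_integral[symmetric]) (use int in auto)
  finally show ?thesis by (simp add: c_def ennreal_leI)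
qed

text \<open>Fixes the coefficients whose existence \<open>gaussian_spin_field\<close> asserts.
  Positivity of the spectrum is what makes the covariance equations imply square
  integrability.\<close>

locale spin_expansion = prob_space +
  fixes s :: int and C :: "nat \<Rightarrow> real" and F :: "'a \<Rightarrow> real^3 \<Rightarrow> complex" and a :: "nat \<times> int \<Rightarrow> 'a \<Rightarrow> complex"
  assumes F_meas: "(\<lambda>(\<omega>, x). F \<omega> x) \<in> borel_measurable (M \<Otimes>\<^sub>M sphere_measure)"
    and gauss: "jointly_gaussian M (harmonic_indices s) a"
    and zero: "\<And>i. i \<in> harmonic_indices s \<Longrightarrow> (LINT \<omega>|M. a i \<omega>) = 0"
    and cov: "\<And>i i'. i \<in> harmonic_indices s \<Longrightarrow> i' \<in> harmonic_indices s \<Longrightarrow>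
           (LINT \<omega>|M. a i \<omega> * cnj (a i' \<omega>)) = (if i = i' then complex_of_real (C (fst i)) else 0)"
    and relation: "\<And>i i'. i \<in> harmonic_indices s \<Longrightarrow> i' \<in> harmonic_indices s \<Longrightarrow> (LINT \<omega>|M. a i \<omega> * a i' \<omega>) = 0"
    and expansion: "(\<lambda>L. \<integral>\<^sup>+ (\<omega>, x). ennreal ((cmod (F \<omega> x -
             (\<Sum>l = lmin s..L. \<Sum>m = - int l..int l. a (l, m) \<omega> * spin_Y s l m x)))\<^sup>2)
             \<partial>(M \<Otimes>\<^sub>M sphere_measure)) \<longlonglongrightarrow> 0"
    and C_pos: "\<And>l. lmin s \<le> l \<Longrightarrow> C l > 0"

lemma (in prob_space) spin_expansionI:
  assumes "gaussian_spin_field M s C F" "\<And>l. lmin s \<le> l \<Longrightarrow> C l > 0"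
  obtains a where "spin_expansion M s C F a"
proof -
  have "prob_space M" by (rule prob_space_axioms)
  then show ?thesis
    using assms that unfolding gaussian_spin_field_def spin_expansion_def spin_expansion_axioms_def by blast
qed

context spin_expansion
begin

abbreviation HI :: "(nat \<times> int) set" where "HI \<equiv> harmonic_indices s"

lemma a_meas[measurable]: "i \<in> HI \<Longrightarrow> a i \<in> borel_measurable M"
  using gauss by (simp add: jointly_gaussian_def)

lemma a_square_integrable: "i \<in> HI \<Longrightarrow> integrable M (\<lambda>\<omega>. (cmod (a i \<omega>))\<^sup>2)"
proof -
  assume i: "i \<in> HI"
  then have "C (fst i) > 0" using C_pos by (auto simp: harmonic_indices_def)
  \<comment> \<open>A non-integrable function has integral 0 by convention, so a nonzero value
    certifies integrability.\<close>
  then have "(LINT \<omega>|M. a i \<omega> * cnj (a i \<omega>)) \<noteq> 0" using cov[OF i i] by simp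
  then have "integrable M (\<lambda>\<omega>. a i \<omega> * cnj (a i \<omega>))" using not_integrable_integral_eq by blast
  from integrable_norm[OF this] show ?thesis by (simp add: norm_mult power2_eq_square)
qed

lemma a_integrable: "i \<in> HI \<Longrightarrow> integrable M (a i)"
proof -
  assume i: "i \<in> HI"
  show ?thesis
  proof (rule Bochner_Integration.integrable_bound)
    show "integrable M (\<lambda>\<omega>. 1 + (cmod (a i \<omega>))\<^sup>2)" using a_square_integrable[OF i] by simp
    show "AE \<omega> in M. norm (a i \<omega>) \<le> norm (1 + (cmod (a i \<omega>))\<^sup>2)" by (simp add: le_one_plus_square)
  qed (use i in measurable)
qed

lemma a_prod_integrable:
  assumes "i \<in> HI" "i' \<in> HI"
  shows "integrable M (\<lambda>\<omega>. a i \<omega> * a i' \<omega>)" "integrable M (\<lambda>\<omega>. a i \<omega> * cnj (a i' \<omega>))"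
proof -
  have int: "integrable M (\<lambda>\<omega>. (cmod (a i \<omega>))\<^sup>2 + (cmod (a i' \<omega>))\<^sup>2)"
    using assms a_square_integrable by simp
  have "x * y \<le> x\<^sup>2 + y\<^sup>2" if "x \<ge> 0" "y \<ge> 0" for x y :: real
  proof -
    have "2 * (x * y) \<le> x\<^sup>2 + y\<^sup>2" using zero_le_power2[of "x - y"] by (simp add: power2_diff)
    moreover have "0 \<le> x * y" using that by simp
    ultimately show ?thesis by linarith
  qed
  then show "integrable M (\<lambda>\<omega>. a i \<omega> * a i' \<omega>)" "integrable M (\<lambda>\<omega>. a i \<omega> * cnj (a i' \<omega>))"
    by (rule_tac [!] Bochner_Integration.integrable_bound[OF int]) (use assms in \<open>auto simp: norm_mult\<close>)
qed

definition partial_sum :: "nat \<Rightarrow> 'a \<Rightarrow> real^3 \<Rightarrow> complex" where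
  "partial_sum L \<omega> x = (\<Sum>l = lmin s..L. \<Sum>m = - int l..int l. a (l, m) \<omega> * spin_Y s l m x)"

lemma in_HI: "l \<in> {lmin s..L} \<Longrightarrow> m \<in> {- int l..int l} \<Longrightarrow> (l, m) \<in> HI"
  by (auto simp: harmonic_indices_def)

lemma partial_sum_meas[measurable]: "(\<lambda>z. partial_sum L (fst z) (snd z)) \<in> borel_measurable (M \<Otimes>\<^sub>M sphere_measure)"
  unfolding partial_sum_def
  by (intro borel_measurable_sum borel_measurable_times)
    (auto simp: harmonic_indices_def intro!: a_meas measurable_compose[OF measurable_fst] measurable_compose[OF measurable_snd])

lemma partial_sum_integrable: "integrable sphere_measure (partial_sum L \<omega>)"
  unfolding partial_sum_def by (intro Bochner_Integration.integrable_sum integrable_mult_right integrable_spin_Y)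

text \<open>An extended real, because the remainder of an individual path need not be square
  integrable; it is so for almost every path as soon as the expected tail is finite.\<close>

definition tail :: "nat \<Rightarrow> 'a \<Rightarrow> ennreal" where
  "tail L \<omega> = (\<integral>\<^sup>+ x. ennreal ((cmod (F \<omega> x - partial_sum L \<omega> x))\<^sup>2) \<partial>sphere_measure)"

lemma F_meas'[measurable]: "(\<lambda>z. F (fst z) (snd z)) \<in> borel_measurable (M \<Otimes>\<^sub>M sphere_measure)"
  using F_meas by (simp add: case_prod_unfold)

lemma F_path_meas: "\<omega> \<in> space M \<Longrightarrow> F \<omega> \<in> borel_measurable sphere_measure"
  using measurable_compose[OF measurable_Pair1' F_meas'] by simp

lemma nn_integral_tail:
  "(\<integral>\<^sup>+ \<omega>. tail L \<omega> \<partial>M) = (\<integral>\<^sup>+ (\<omega>, x). ennreal ((cmod (F \<omega> x - partial_sum L \<omega> x))\<^sup>2) \<partial>(M \<Otimes>\<^sub>M sphere_measure))"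
  unfolding tail_def case_prod_unfold
  by (subst sphere.nn_integral_fst[symmetric]) simp_all

lemma tail_meas[measurable]: "tail L \<in> borel_measurable M"
  unfolding tail_def by (rule sphere.borel_measurable_nn_integral) (simp add: case_prod_unfold)

lemma tail_lim: "(\<lambda>L. \<integral>\<^sup>+ \<omega>. tail L \<omega> \<partial>M) \<longlonglongrightarrow> 0"
  unfolding nn_integral_tail using expansion by (simp add: partial_sum_def)

lemma path_integrable_if_tail:
  assumes "\<omega> \<in> space M" "tail L \<omega> < \<infinity>"
  shows "integrable sphere_measure (F \<omega>)"
proof -
  have [measurable]: "F \<omega> \<in> borel_measurable sphere_measure" by (rule F_path_meas[OF assms(1)])
  have [measurable]: "partial_sum L \<omega> \<in> borel_measurable sphere_measure" using partial_sum_integrable by auto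
  have "integrable sphere_measure (\<lambda>x. F \<omega> x - partial_sum L \<omega> x)"
    by (rule square_integrable_sphere(2)) (use assms in \<open>auto simp: tail_def\<close>)
  from Bochner_Integration.integrable_add[OF this partial_sum_integrable[of L \<omega>]] show ?thesis by simp
qed

lemma tail_finite: "\<exists>L. (\<integral>\<^sup>+ \<omega>. tail L \<omega> \<partial>M) < 1"
  using order_tendstoD(2)[OF tail_lim, of 1] by (auto simp: eventually_sequentially)

lemma AE_path_integrable: "AE \<omega> in M. integrable sphere_measure (F \<omega>)"
proof -
  obtain L where "(\<integral>\<^sup>+ \<omega>. tail L \<omega> \<partial>M) < 1" using tail_finite by blast
  then have "AE \<omega> in M. tail L \<omega> \<noteq> \<infinity>" by (intro nn_integral_PInf_AE) auto
  then show ?thesis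
    by (rule AE_mp) (auto intro!: AE_I2 path_integrable_if_tail simp: less_top)
qed

lemma harmonic_coeff_partial_sum:
  assumes i: "(l, m) \<in> HI" "l \<le> L"
  shows "harmonic_coeff s (l, m) (partial_sum L \<omega>) = a (l, m) \<omega>"
proof -
  have lm: "lmin s \<le> l" "\<bar>m\<bar> \<le> int l" "\<bar>s\<bar> \<le> int l" using i by (auto simp: harmonic_indices_def lmin_def)
  let ?S = "SIGMA l':{lmin s..L}. {- int l'..int l'}"
  have "harmonic_coeff s (l, m) (partial_sum L \<omega>) =
      (CLINT x|sphere_measure. (\<Sum>p\<in>?S. a p \<omega> * (spin_Y s (fst p) (snd p) x * cnj (spin_Y s l m x))))"
    unfolding harmonic_coeff_def partial_sum_def
    by (simp add: sum.Sigma sum_distrib_right mult.assoc case_prod_unfold)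
  also have "\<dots> = (\<Sum>p\<in>?S. a p \<omega> * (CLINT x|sphere_measure. spin_Y s (fst p) (snd p) x * cnj (spin_Y s l m x)))"
    by (subst Bochner_Integration.integral_sum)
      (auto intro!: integrable_mult_right integrable_mult_spin_Y(1) integrable_spin_Y)
  also have "\<dots> = (\<Sum>p\<in>?S. if p = (l, m) then a p \<omega> else 0)"
  proof (rule sum.cong[OF refl])
    fix p assume "p \<in> ?S"
    then have p: "\<bar>snd p\<bar> \<le> int (fst p)" "\<bar>s\<bar> \<le> int (fst p)" by (auto simp: lmin_def)
    show "a p \<omega> * (CLINT x|sphere_measure. spin_Y s (fst p) (snd p) x * cnj (spin_Y s l m x)) = (if p = (l, m) then a p \<omega> else 0)"
      using spin_Y_orthonormal[OF p(2,1) lm(3,2)] by (auto simp: prod_eq_iff)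
  qed
  also have "\<dots> = a (l, m) \<omega>" using i lm by (subst sum.delta) auto
  finally show ?thesis .
qed

lemma harmonic_coeff_meas[measurable]: "(\<lambda>\<omega>. harmonic_coeff s i (F \<omega>)) \<in> borel_measurable M"
  unfolding harmonic_coeff_def
  by (rule sphere.borel_measurable_lebesgue_integral)
    (auto simp: case_prod_unfold intro!: borel_measurable_times cnj_measurable measurable_compose[OF measurable_snd])

text \<open>Once a partial sum contains the index, its own coefficient is \<open>a i\<close>, and
  Bessel's inequality bounds the squared error by the tail (trivially where the tail is infinite).
  The left side does not depend on \<open>L\<close> while the expected tails tend to 0, so its
  expectation vanishes.\<close>

theorem AE_harmonic_coeff:
  assumes i: "i \<in> HI"
  shows "AE \<omega> in M. harmonic_coeff s i (F \<omega>) = a i \<omega>"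
proof -
  obtain l m where lm: "i = (l, m)" by (cases i)
  have l: "\<bar>s\<bar> \<le> int l" "\<bar>m\<bar> \<le> int l" using i by (auto simp: lm harmonic_indices_def lmin_def)
  let ?d = "\<lambda>\<omega>. ennreal ((cmod (harmonic_coeff s i (F \<omega>) - a i \<omega>))\<^sup>2)"
  have le: "?d \<omega> \<le> tail L \<omega>" if \<omega>: "\<omega> \<in> space M" and L: "l \<le> L" for \<omega> L
  proof (cases "tail L \<omega> < \<infinity>")
    case True
    let ?h = "\<lambda>x. F \<omega> x - partial_sum L \<omega> x"
    have [measurable]: "F \<omega> \<in> borel_measurable sphere_measure" by (rule F_path_meas[OF \<omega>])
    have [measurable]: "partial_sum L \<omega> \<in> borel_measurable sphere_measure" using partial_sum_integrable by auto
    have ih: "integrable sphere_measure ?h"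
      by (rule Bochner_Integration.integrable_diff[OF path_integrable_if_tail[OF \<omega> True] partial_sum_integrable])
    have "harmonic_coeff s i (F \<omega>) = harmonic_coeff s i (\<lambda>x. ?h x + partial_sum L \<omega> x)" by simp
    also have "\<dots> = harmonic_coeff s i ?h + a i \<omega>"
      unfolding harmonic_coeff_add[OF ih partial_sum_integrable] lm
      by (subst harmonic_coeff_partial_sum) (use i lm L in auto)
    finally have "?d \<omega> = ennreal ((cmod (harmonic_coeff s (l, m) ?h))\<^sup>2)" by (simp add: lm)
    also have "\<dots> \<le> tail L \<omega>" unfolding tail_def
      by (rule harmonic_coeff_bessel[OF _ l]) (use True in \<open>auto simp: tail_def\<close>)
    finally show ?thesis .
  next
    case False
    then have "tail L \<omega> = \<top>" by (metis top.not_eq_extremum infinity_ennreal_def)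
    then show ?thesis by simp
  qed
  have "(\<integral>\<^sup>+ \<omega>. ?d \<omega> \<partial>M) \<le> 0"
  proof (rule LIMSEQ_le_const[OF tail_lim])
    show "\<exists>N. \<forall>L\<ge>N. (\<integral>\<^sup>+ \<omega>. ?d \<omega> \<partial>M) \<le> (\<integral>\<^sup>+ \<omega>. tail L \<omega> \<partial>M)"
      using le by (intro exI[of _ l]) (auto intro!: nn_integral_mono)
  qed
  then have "AE \<omega> in M. ?d \<omega> = 0"
    by (subst nn_integral_0_iff_AE[symmetric]) (use i in auto)
  then show ?thesis by eventually_elim simp
qed

text \<open>The field is split into a remainder, square integrable on a finite measure space, and a
  finite sum of products of a coefficient and a harmonic. Joint integrability is what Fubini's
  theorem asks for in \<open>AE_cond_exp_integral\<close>.\<close>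

lemma integrable_mult_bounded:
  assumes [measurable]: "G \<in> borel_measurable sphere_measure" and G: "\<And>x. x \<in> sphere 0 1 \<Longrightarrow> cmod (G x) \<le> c"
  shows "integrable (M \<Otimes>\<^sub>M sphere_measure) (\<lambda>(\<omega>, x). F \<omega> x * G x)"
proof -
  interpret MS: pair_sigma_finite M sphere_measure ..
  obtain L where L: "(\<integral>\<^sup>+ \<omega>. tail L \<omega> \<partial>M) < 1" using tail_finite by blast
  let ?h = "\<lambda>z. F (fst z) (snd z) - partial_sum L (fst z) (snd z)"
  have sq: "integrable (M \<Otimes>\<^sub>M sphere_measure) (\<lambda>z. (cmod (?h z))\<^sup>2)"
  proof (rule integrableI_nonneg)
    have "(\<integral>\<^sup>+ z. ennreal ((cmod (?h z))\<^sup>2) \<partial>(M \<Otimes>\<^sub>M sphere_measure)) < 1"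
      using L unfolding nn_integral_tail by (simp add: case_prod_unfold)
    then show "(\<integral>\<^sup>+ z. ennreal ((cmod (?h z))\<^sup>2) \<partial>(M \<Otimes>\<^sub>M sphere_measure)) < \<infinity>"
      by (rule less_trans) simp
  qed auto
  have one: "integrable (M \<Otimes>\<^sub>M sphere_measure) (\<lambda>z. 1 :: real)"
  proof -
    have "emeasure (M \<Otimes>\<^sub>M sphere_measure) (space M \<times> space sphere_measure) < \<infinity>"
      by (subst sphere.emeasure_pair_measure_Times) (use sets.top[of sphere_measure] in \<open>auto simp: emeasure_space_1 sphere.emeasure_finite less_top[symmetric]\<close>)
    then have "finite_measure (M \<Otimes>\<^sub>M sphere_measure)"
      by (intro finite_measureI) (simp add: space_pair_measure)
    then interpret P: finite_measure "M \<Otimes>\<^sub>M sphere_measure" .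
    show ?thesis by simp
  qed
  have ih: "integrable (M \<Otimes>\<^sub>M sphere_measure) ?h"
  proof (rule Bochner_Integration.integrable_bound[OF Bochner_Integration.integrable_add[OF one sq]])
    show "AE z in M \<Otimes>\<^sub>M sphere_measure. norm (?h z) \<le> norm (1 + (cmod (?h z))\<^sup>2)" by (simp add: le_one_plus_square)
  qed measurable
  have ip: "integrable (M \<Otimes>\<^sub>M sphere_measure) (\<lambda>z. partial_sum L (fst z) (snd z))"
    unfolding partial_sum_def
  proof (intro Bochner_Integration.integrable_sum)
    fix l m assume "l \<in> {lmin s..L}" "m \<in> {- int l..int l}"
    then have i: "(l, m) \<in> HI" by (rule in_HI)
    have [measurable]: "a (l, m) \<in> borel_measurable M" using i by (rule a_meas)
    show "integrable (M \<Otimes>\<^sub>M sphere_measure) (\<lambda>z. a (l, m) (fst z) * spin_Y s l m (snd z))"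
    proof (rule MS.Fubini_integrable)
      show "integrable M (\<lambda>\<omega>. LINT x|sphere_measure. norm (a (l, m) (fst (\<omega>, x)) * spin_Y s l m (snd (\<omega>, x))))"
        using integrable_norm[OF a_integrable[OF i]] by (simp add: norm_mult)
      show "AE \<omega> in M. complex_integrable sphere_measure (\<lambda>x. a (l, m) (fst (\<omega>, x)) * spin_Y s l m (snd (\<omega>, x)))"
        by (simp add: integrable_spin_Y)
    qed measurable
  qed
  have iF: "integrable (M \<Otimes>\<^sub>M sphere_measure) (\<lambda>z. F (fst z) (snd z))"
    using Bochner_Integration.integrable_add[OF ih ip] by simp
  show ?thesis
  proof (rule Bochner_Integration.integrable_bound[where f="\<lambda>z. c * norm (F (fst z) (snd z))"])
    show "integrable (M \<Otimes>\<^sub>M sphere_measure) (\<lambda>z. c * norm (F (fst z) (snd z)))" using iF by simp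
    show "AE z in M \<Otimes>\<^sub>M sphere_measure. norm (case z of (\<omega>, x) \<Rightarrow> F \<omega> x * G x) \<le> norm (c * norm (F (fst z) (snd z)))"
    proof (rule AE_I2)
      fix z assume "z \<in> space (M \<Otimes>\<^sub>M sphere_measure)"
      then have "snd z \<in> sphere 0 1" by (auto simp: space_pair_measure)
      then have *: "cmod (G (snd z)) \<le> c" by (rule G)
      then have c0: "0 \<le> c" by (rule order_trans[OF norm_ge_zero])
      have "cmod (F (fst z) (snd z)) * cmod (G (snd z)) \<le> cmod (F (fst z) (snd z)) * c"
        using * by (intro mult_left_mono) auto
      then show "norm (case z of (\<omega>, x) \<Rightarrow> F \<omega> x * G x) \<le> norm (c * norm (F (fst z) (snd z)))"
        using c0 by (simp add: case_prod_unfold norm_mult mult.commute)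
    qed
  qed (simp add: case_prod_unfold)
qed

end

text \<open>For Z the complex combination, (Re Z)^2 = Re (Z Z + Z cnj Z) / 2. The expectation of Z Z
  vanishes by \<open>relation\<close>, so the real part carries half of the mean square of
  Z.\<close>

lemma (in spin_expansion) linear_combination:
  fixes c :: "nat \<times> int \<Rightarrow> complex"
  assumes J: "finite J" "J \<subseteq> HI"
  defines "L \<equiv> \<lambda>\<omega>. Re (\<Sum>i\<in>J. c i * a i \<omega>)"
  shows "gaussian_rv M L" "integrable M (\<lambda>\<omega>. (L \<omega>)\<^sup>2)" "expectation L = 0"
    "expectation (\<lambda>\<omega>. (L \<omega>)\<^sup>2) = (\<Sum>i\<in>J. (cmod (c i))\<^sup>2 * C (fst i)) / 2"
    "expectation (\<lambda>\<omega>. (cmod (\<Sum>i\<in>J. c i * a i \<omega>))\<^sup>2) = (\<Sum>i\<in>J. (cmod (c i))\<^sup>2 * C (fst i))"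
proof -
  show "gaussian_rv M L" using gauss J unfolding L_def jointly_gaussian_def by blast
  define Z where "Z \<omega> = (\<Sum>i\<in>J. c i * a i \<omega>)" for \<omega>
  have J': "i \<in> HI" if "i \<in> J" for i using that J by auto
  have iZ: "integrable M Z" unfolding Z_def using J' a_integrable by (intro Bochner_Integration.integrable_sum integrable_mult_right) auto
  have "(LINT \<omega>|M. Z \<omega>) = 0"
    unfolding Z_def using J' a_integrable zero by (subst Bochner_Integration.integral_sum) auto
  then show "expectation L = 0" unfolding L_def Z_def[symmetric] using iZ by simp
  have p1: "Z \<omega> * Z \<omega> = (\<Sum>p\<in>J \<times> J. (c (fst p) * c (snd p)) * (a (fst p) \<omega> * a (snd p) \<omega>))" for \<omega>
    unfolding Z_def sum_product sum.cartesian_product by (rule sum.cong) (auto simp: mult_ac)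
  have p2: "Z \<omega> * cnj (Z \<omega>) = (\<Sum>p\<in>J \<times> J. (c (fst p) * cnj (c (snd p))) * (a (fst p) \<omega> * cnj (a (snd p) \<omega>)))" for \<omega>
    unfolding Z_def cnj_sum sum_product sum.cartesian_product by (rule sum.cong) (auto simp: mult_ac)
  have i1: "integrable M (\<lambda>\<omega>. Z \<omega> * Z \<omega>)"
    unfolding p1 using J' a_prod_integrable by (intro Bochner_Integration.integrable_sum integrable_mult_right) auto
  have i2: "integrable M (\<lambda>\<omega>. Z \<omega> * cnj (Z \<omega>))"
    unfolding p2 using J' a_prod_integrable by (intro Bochner_Integration.integrable_sum integrable_mult_right) auto
  have e1: "(LINT \<omega>|M. Z \<omega> * Z \<omega>) = 0"
  proof -
    have "(LINT \<omega>|M. Z \<omega> * Z \<omega>) = (\<Sum>p\<in>J \<times> J. (c (fst p) * c (snd p)) * (LINT \<omega>|M. a (fst p) \<omega> * a (snd p) \<omega>))"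
      unfolding p1 by (subst Bochner_Integration.integral_sum)
        (use J' a_prod_integrable in \<open>auto intro!: integrable_mult_right\<close>)
    also have "\<dots> = 0" by (intro sum.neutral) (use J' relation in auto)
    finally show ?thesis .
  qed
  have e2: "(LINT \<omega>|M. Z \<omega> * cnj (Z \<omega>)) = complex_of_real (\<Sum>i\<in>J. (cmod (c i))\<^sup>2 * C (fst i))"
  proof -
    have "(LINT \<omega>|M. Z \<omega> * cnj (Z \<omega>)) = (\<Sum>p\<in>J \<times> J. (c (fst p) * cnj (c (snd p))) * (LINT \<omega>|M. a (fst p) \<omega> * cnj (a (snd p) \<omega>)))"
      unfolding p2 by (subst Bochner_Integration.integral_sum)
        (use J' a_prod_integrable in \<open>auto intro!: integrable_mult_right\<close>)
    also have "\<dots> = (\<Sum>i\<in>J. \<Sum>i'\<in>J. if i = i' then complex_of_real ((cmod (c i))\<^sup>2 * C (fst i)) else 0)"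
      unfolding sum.cartesian_product
      by (rule sum.cong) (use J' cov in \<open>auto simp: complex_norm_square[symmetric] simp del: of_real_power\<close>)
    also have "\<dots> = complex_of_real (\<Sum>i\<in>J. (cmod (c i))\<^sup>2 * C (fst i))"
      using J by simp
    finally show ?thesis .
  qed
  have "complex_of_real (expectation (\<lambda>\<omega>. (cmod (Z \<omega>))\<^sup>2)) = (LINT \<omega>|M. Z \<omega> * cnj (Z \<omega>))"
    by (simp only: complex_norm_square[symmetric] integral_complex_of_real)
  from trans[OF this e2] show "expectation (\<lambda>\<omega>. (cmod (\<Sum>i\<in>J. c i * a i \<omega>))\<^sup>2) = (\<Sum>i\<in>J. (cmod (c i))\<^sup>2 * C (fst i))"
    unfolding Z_def by (simp only: of_real_eq_iff)
  have sq: "(L \<omega>)\<^sup>2 = Re (Z \<omega> * Z \<omega> + Z \<omega> * cnj (Z \<omega>)) / 2" for \<omega>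
  proof -
    have "(Re z)\<^sup>2 = Re (z * z + z * cnj z) / 2" for z by (simp add: power2_eq_square)
    then show ?thesis unfolding L_def Z_def[symmetric] .
  qed
  show "integrable M (\<lambda>\<omega>. (L \<omega>)\<^sup>2)"
    unfolding sq by (intro integrable_divide_zero integrable_Re Bochner_Integration.integrable_add i1 i2)
  have "expectation (\<lambda>\<omega>. (L \<omega>)\<^sup>2) = expectation (\<lambda>\<omega>. Re (Z \<omega> * Z \<omega> + Z \<omega> * cnj (Z \<omega>))) / 2"
    unfolding sq by (rule integral_divide_zero)
  also have "expectation (\<lambda>\<omega>. Re (Z \<omega> * Z \<omega> + Z \<omega> * cnj (Z \<omega>))) = Re (LINT \<omega>|M. Z \<omega> * Z \<omega> + Z \<omega> * cnj (Z \<omega>))"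
    by (rule integral_Re) (intro Bochner_Integration.integrable_add i1 i2)
  also have "(LINT \<omega>|M. Z \<omega> * Z \<omega> + Z \<omega> * cnj (Z \<omega>)) = complex_of_real (\<Sum>i\<in>J. (cmod (c i))\<^sup>2 * C (fst i))"
    unfolding Bochner_Integration.integral_add[OF i1 i2] e1 e2 by simp
  finally show "expectation (\<lambda>\<omega>. (L \<omega>)\<^sup>2) = (\<Sum>i\<in>J. (cmod (c i))\<^sup>2 * C (fst i)) / 2" by simp
qed

section \<open>Joint independence of the parts of all harmonic coefficients\<close>

lemma sum_triple: "(\<Sum>q\<in>A \<times> B \<times> D. f q) = (\<Sum>x\<in>A. \<Sum>y\<in>B. \<Sum>z\<in>D. f (x, y, z))"
  by (simp add: sum.cartesian_product case_prod_unfold)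

lemma prod_triple: "(\<Prod>q\<in>A \<times> B \<times> D. f q) = (\<Prod>x\<in>A. \<Prod>y\<in>B. \<Prod>z\<in>D. f (x, y, z))"
  by (simp add: prod.cartesian_product case_prod_unfold)

definition re_im :: "bool \<Rightarrow> complex \<Rightarrow> real" where
  "re_im c z = (if c then Re z else Im z)"

locale independent_spin_fields = prob_space +
  fixes s :: int and I :: "'i set" and C :: "'i \<Rightarrow> nat \<Rightarrow> real"
    and F :: "'i \<Rightarrow> 'a \<Rightarrow> real^3 \<Rightarrow> complex" and a :: "'i \<Rightarrow> nat \<times> int \<Rightarrow> 'a \<Rightarrow> complex"
  assumes fin: "finite I" and expansion: "\<And>r. r \<in> I \<Longrightarrow> spin_expansion M s (C r) (F r) (a r)"
    and indep: "indep_vars (\<lambda>_. \<Pi>\<^sub>M x\<in>sphere 0 1. borel) (\<lambda>r \<omega>. restrict (F r \<omega>) (sphere 0 1)) I"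
begin

definition V :: "'i \<times> (nat \<times> int) \<times> bool \<Rightarrow> 'a \<Rightarrow> real" where
  "V q \<omega> = re_im (snd (snd q)) (a (fst q) (fst (snd q)) \<omega>)"

lemma V_linear:
  fixes t :: "'i \<times> (nat \<times> int) \<times> bool \<Rightarrow> real"
  assumes "finite J"
  shows "(\<Sum>q\<in>I \<times> J \<times> UNIV. t q * V q \<omega>) =
    (\<Sum>r\<in>I. Re (\<Sum>i\<in>J. Complex (t (r, i, True)) (- t (r, i, False)) * a r i \<omega>))"
  unfolding sum_triple by (simp add: UNIV_bool V_def re_im_def add.commute)

lemma V_normal:
  assumes "r \<in> I" "i \<in> harmonic_indices s"
  shows "distributed M lborel (V (r, i, c)) (normal_density 0 (sqrt (C r (fst i) / 2)))"
    and "gaussian_rv M (\<lambda>\<omega>. u * V (r, i, c) \<omega>)" "expectation (\<lambda>\<omega>. u * V (r, i, c) \<omega>) = 0"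
    "expectation (\<lambda>\<omega>. (u * V (r, i, c) \<omega>)\<^sup>2) = u\<^sup>2 * C r (fst i) / 2" "integrable M (\<lambda>\<omega>. (u * V (r, i, c) \<omega>)\<^sup>2)"
proof -
  interpret E: spin_expansion M s "C r" "F r" "a r" by (rule expansion) fact
  \<comment> \<open>The imaginary part is the real part after multiplication by - \<i>, so
    \<open>linear_combination\<close> covers both parts.\<close>
  let ?k = "\<lambda>u::real. if c then complex_of_real u else - \<i> * complex_of_real u"
  have eq: "Re (\<Sum>i\<in>{i}. ?k u * a r i \<omega>) = u * V (r, i, c) \<omega>" for u \<omega>
    by (auto simp: V_def re_im_def)
  have k: "(\<Sum>i\<in>{i}. (cmod (?k u))\<^sup>2 * C r (fst i)) = u\<^sup>2 * C r (fst i)" for u by (simp add: norm_mult)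
  have i: "finite {i}" "{i} \<subseteq> harmonic_indices s" using assms by auto
  note l = E.linear_combination[OF i, of "\<lambda>_. ?k u" for u, unfolded eq k]
  show "gaussian_rv M (\<lambda>\<omega>. u * V (r, i, c) \<omega>)" "expectation (\<lambda>\<omega>. u * V (r, i, c) \<omega>) = 0"
    "expectation (\<lambda>\<omega>. (u * V (r, i, c) \<omega>)\<^sup>2) = u\<^sup>2 * C r (fst i) / 2" "integrable M (\<lambda>\<omega>. (u * V (r, i, c) \<omega>)\<^sup>2)"
    by (rule l)+
  have "C r (fst i) > 0" using E.C_pos assms by (auto simp: harmonic_indices_def)
  then show "distributed M lborel (V (r, i, c)) (normal_density 0 (sqrt (C r (fst i) / 2)))"
    using l[of 1] assms by (intro gaussian_rv_distributed) simp_all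
qed

text \<open>The joint characteristic function factorizes twice. A linear combination of the
  variables is a sum of one Gaussian functional per field, and independence of the fields separates
  these; within a field the Gaussian exponent is a sum of variances, which separates indices and
  parts.\<close>

theorem V_indep:
  assumes J: "finite J" "J \<subseteq> harmonic_indices s"
  shows "indep_vars (\<lambda>_. borel) V (I \<times> J \<times> UNIV)"
proof (rule indep_vars_if_char_factorizes)
  show "finite (I \<times> J \<times> (UNIV :: bool set))" using fin J by simp
  show "V q \<in> borel_measurable M" if "q \<in> I \<times> J \<times> UNIV" for q
    using V_normal(1)[of "fst q" "fst (snd q)" "snd (snd q)"] that J by (auto simp: distributed_def)
  fix t :: "'i \<times> (nat \<times> int) \<times> bool \<Rightarrow> real"
  define c where "c r i = Complex (t (r, i, True)) (- t (r, i, False))" for r i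
  define L where "L r \<omega> = Re (\<Sum>i\<in>J. c r i * a r i \<omega>)" for r \<omega>
  \<comment> \<open>The integral of the path \<open>F r \<omega>\<close> against \<open>G r\<close>
    is almost surely \<open>L r \<omega>\<close>. This presents \<open>L r\<close> as a functional
    of the path, to which the independence of the fields can be applied through a version
    \<open>R r\<close>.\<close>
  define G where "G r x = (\<Sum>i\<in>J. c r i * cnj (spin_Y s (fst i) (snd i) x))" for r x
  define H where "H r \<omega> x = Re (F r \<omega> x * G r x)" for r \<omega> x
  have G_meas[measurable]: "G r \<in> borel_measurable sphere_measure" for r
    unfolding G_def by measurable
  have G_bound: "\<exists>k. \<forall>x\<in>sphere 0 1. cmod (G r x) \<le> k" for r
  proof -
    have "\<forall>i. \<exists>k>0. \<forall>x\<in>sphere 0 1. cmod (spin_Y s (fst i) (snd i) x) \<le> k" using bounded_spin_Y by blast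
    then obtain k where k: "\<And>i x. x \<in> sphere 0 1 \<Longrightarrow> cmod (spin_Y s (fst i) (snd i) x) \<le> k i" by metis
    have "cmod (G r x) \<le> (\<Sum>i\<in>J. cmod (c r i) * k i)" if "x \<in> sphere 0 1" for x
      unfolding G_def by (rule sum_norm_le) (use k that in \<open>simp add: norm_mult mult_left_mono\<close>)
    then show ?thesis by blast
  qed
  have sig: "sigma_finite_measure sphere_measure" by (rule sphere.sigma_finite_measure_axioms)
  obtain R where R: "indep_vars (\<lambda>_. borel) R I" "\<And>r. r \<in> I \<Longrightarrow> AE \<omega> in M. R r \<omega> = (LINT x|sphere_measure. H r \<omega> x)"
  proof (rule indep_version_of_path_integrals[OF sig, of F I H])
    show "indep_vars (\<lambda>_. \<Pi>\<^sub>M x\<in>space sphere_measure. borel) (\<lambda>r \<omega>. restrict (F r \<omega>) (space sphere_measure)) I"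
      using indep by simp
    fix r assume r: "r \<in> I"
    interpret E: spin_expansion M s "C r" "F r" "a r" by (rule expansion) fact
    obtain k where "\<And>x. x \<in> sphere 0 1 \<Longrightarrow> cmod (G r x) \<le> k" using G_bound[of r] by blast
    from integrable_Re[OF E.integrable_mult_bounded[OF G_meas this]]
    show "integrable (M \<Otimes>\<^sub>M sphere_measure) (\<lambda>(\<omega>, x). H r \<omega> x)"
      by (simp add: H_def case_prod_unfold)
    fix x :: "real^3"
    show "\<exists>h\<in>borel_measurable borel. \<forall>\<omega>. H r \<omega> x = h (F r \<omega> x)"
      by (rule bexI[of _ "\<lambda>z. Re (z * G r x)"]) (auto simp: H_def)
  qed blast
  have RL: "AE \<omega> in M. R r \<omega> = L r \<omega>" if r: "r \<in> I" for r
  proof -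
    interpret E: spin_expansion M s "C r" "F r" "a r" by (rule expansion) fact
    have "AE \<omega> in M. \<forall>i\<in>J. harmonic_coeff s i (F r \<omega>) = a r i \<omega>"
      using J E.AE_harmonic_coeff by (intro AE_finite_allI) auto
    moreover have "AE \<omega> in M. integrable sphere_measure (F r \<omega>)" by (rule E.AE_path_integrable)
    ultimately show ?thesis using R(2)[OF r]
    proof eventually_elim
      case (elim \<omega>)
      have i: "integrable sphere_measure (\<lambda>x. c r i * (F r \<omega> x * cnj (spin_Y s (fst i) (snd i) x)))" for i
        by (intro integrable_mult_right integrable_mult_spin_Y(1) elim)
      have eq: "F r \<omega> x * G r x = (\<Sum>i\<in>J. c r i * (F r \<omega> x * cnj (spin_Y s (fst i) (snd i) x)))" for x
        by (simp add: G_def sum_distrib_left mult_ac)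
      have "(LINT x|sphere_measure. H r \<omega> x) = Re (CLINT x|sphere_measure. F r \<omega> x * G r x)"
        unfolding H_def by (rule integral_Re) (use i in \<open>simp add: eq\<close>)
      also have "(CLINT x|sphere_measure. F r \<omega> x * G r x) = (\<Sum>i\<in>J. c r i * harmonic_coeff s i (F r \<omega>))"
        unfolding eq using i by (subst Bochner_Integration.integral_sum) (auto simp: harmonic_coeff_def)
      also have "\<dots> = (\<Sum>i\<in>J. c r i * a r i \<omega>)" using elim by simp
      finally show ?case using elim by (simp add: L_def)
    qed
  qed
  have L_meas[measurable]: "L r \<in> borel_measurable M" if "r \<in> I" for r
  proof -
    interpret E: spin_expansion M s "C r" "F r" "a r" by (rule expansion) fact
    show ?thesis using E.linear_combination(1)[OF J, of "c r"] by (simp add: gaussian_rv_def L_def[abs_def])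
  qed
  have R_meas[measurable]: "R r \<in> borel_measurable M" if "r \<in> I" for r
    using R(1) that by (auto simp: indep_vars_def)
  have "(CLINT \<omega>|M. iexp (\<Sum>q\<in>I \<times> J \<times> UNIV. t q * V q \<omega>)) = (CLINT \<omega>|M. iexp (\<Sum>r\<in>I. L r \<omega>))"
    by (simp only: V_linear[OF J(1)] L_def c_def)
  also have "\<dots> = (CLINT \<omega>|M. iexp (\<Sum>r\<in>I. R r \<omega>))"
  proof (rule integral_cong_AE)
    have "AE \<omega> in M. \<forall>r\<in>I. R r \<omega> = L r \<omega>" using fin RL by (intro AE_finite_allI) auto
    then show "AE \<omega> in M. iexp (\<Sum>r\<in>I. L r \<omega>) = iexp (\<Sum>r\<in>I. R r \<omega>)" by eventually_elim simp
  qed measurable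
  also have "\<dots> = char (distr M borel (\<lambda>\<omega>. \<Sum>r\<in>I. R r \<omega>)) 1"
    by (simp add: char_def integral_distr del: of_real_sum)
  also have "\<dots> = (\<Prod>r\<in>I. char (distr M borel (R r)) 1)" by (rule char_distr_sum[OF R(1)])
  \<comment> \<open>Of the 4 in the denominator, one factor 2 is the halved variance of a real part
    and the other belongs to the Gaussian characteristic function. As \<open>cmod (c r i)\<close>
    squared is the sum of the squares of the two frequencies, the exponent then splits over the
    parts.\<close>
  also have "\<dots> = (\<Prod>r\<in>I. complex_of_real (exp (- (\<Sum>i\<in>J. (cmod (c r i))\<^sup>2 * C r (fst i)) / 4)))"
  proof (rule prod.cong[OF refl])
    fix r assume r: "r \<in> I"
    interpret E: spin_expansion M s "C r" "F r" "a r" by (rule expansion) fact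
    have "char (distr M borel (R r)) 1 = (CLINT \<omega>|M. iexp (R r \<omega>))"
      using r by (simp add: char_def integral_distr)
    also have "\<dots> = (CLINT \<omega>|M. iexp (L r \<omega>))"
    proof (rule integral_cong_AE)
      show "AE \<omega> in M. iexp (R r \<omega>) = iexp (L r \<omega>)" using RL[OF r] by eventually_elim simp
    qed (use r in measurable)
    also have "\<dots> = complex_of_real (exp (- ((\<Sum>i\<in>J. (cmod (c r i))\<^sup>2 * C r (fst i)) / 2) / 2))"
      unfolding L_def by (rule char_gaussian_rv) (rule E.linear_combination(1-4)[OF J])+
    finally show "char (distr M borel (R r)) 1 = complex_of_real (exp (- (\<Sum>i\<in>J. (cmod (c r i))\<^sup>2 * C r (fst i)) / 4))"
      by simp
  qed
  also have "\<dots> = (\<Prod>q\<in>I \<times> J \<times> UNIV. complex_of_real (exp (- ((t q)\<^sup>2 * C (fst q) (fst (fst (snd q))) / 2) / 2)))"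
  proof -
    have "- (\<Sum>i\<in>J. (cmod (c r i))\<^sup>2 * C r (fst i)) / 4 = (\<Sum>i\<in>J. \<Sum>b\<in>UNIV. - ((t (r, i, b))\<^sup>2 * C r (fst i) / 2) / 2)" for r
      unfolding minus_divide_left[symmetric] sum_divide_distrib sum_negf[symmetric]
      by (rule sum.cong) (auto simp: UNIV_bool c_def cmod_power2 algebra_simps add_divide_distrib)
    then have "complex_of_real (exp (- (\<Sum>i\<in>J. (cmod (c r i))\<^sup>2 * C r (fst i)) / 4)) =
      (\<Prod>i\<in>J. \<Prod>b\<in>UNIV. complex_of_real (exp (- ((t (r, i, b))\<^sup>2 * C r (fst i) / 2) / 2)))" for r
      by (simp only: exp_sum[OF J(1)] exp_sum[OF finite_class.finite_UNIV] of_real_prod)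
    then show ?thesis unfolding prod_triple by simp
  qed
  also have "\<dots> = (\<Prod>q\<in>I \<times> J \<times> UNIV. CLINT \<omega>|M. iexp (t q * V q \<omega>))"
  proof (rule prod.cong[OF refl])
    fix q assume q: "q \<in> I \<times> J \<times> (UNIV :: bool set)"
    then have qq: "fst q \<in> I" "fst (snd q) \<in> harmonic_indices s" "q = (fst q, fst (snd q), snd (snd q))" using J by auto
    note n = V_normal(2-5)[OF qq(1,2), of "t q" "snd (snd q)", folded qq(3)]
    have "(CLINT \<omega>|M. iexp (t q * V q \<omega>)) = complex_of_real (exp (- ((t q)\<^sup>2 * C (fst q) (fst (fst (snd q))) / 2) / 2))"
      by (rule char_gaussian_rv) (rule n)+
    then show "complex_of_real (exp (- ((t q)\<^sup>2 * C (fst q) (fst (fst (snd q))) / 2) / 2)) = (CLINT \<omega>|M. iexp (t q * V q \<omega>))" by simp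
  qed
  finally show "(CLINT \<omega>|M. iexp (\<Sum>q\<in>I \<times> J \<times> UNIV. t q * V q \<omega>)) = (\<Prod>q\<in>I \<times> J \<times> UNIV. CLINT \<omega>|M. iexp (t q * V q \<omega>))" .
qed

end

section \<open>The frequency band of level \<open>j\<close>\<close>

definition level_weight :: "int \<Rightarrow> real \<Rightarrow> (real \<Rightarrow> real) \<Rightarrow> nat \<Rightarrow> nat \<Rightarrow> real" where
  "level_weight s B b j l = b (sqrt (spin_e s l) / B ^ j)"

definition band :: "int \<Rightarrow> real \<Rightarrow> (real \<Rightarrow> real) \<Rightarrow> nat \<Rightarrow> nat set" where
  "band s B b j = {l. lmin s \<le> l \<and> level_weight s B b j l \<noteq> 0}"

definition band_indices :: "int \<Rightarrow> real \<Rightarrow> (real \<Rightarrow> real) \<Rightarrow> nat \<Rightarrow> (nat \<times> int) set" where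
  "band_indices s B b j = (SIGMA l:band s B b j. {- int l..int l})"

lemma window_support:
  assumes "needlet_window B b" "b u \<noteq> 0"
  shows "1 / B \<le> u" "u \<le> B"
proof -
  have "u \<in> closure {u. b u \<noteq> 0}" by (rule subsetD[OF closure_subset]) (simp add: assms(2))
  moreover have "closure {u. b u \<noteq> 0} \<subseteq> {1 / B..B}" using assms(1) unfolding needlet_window_def by (elim conjE)
  ultimately have "u \<in> {1 / B..B}" by (rule subsetD[rotated])
  then show "1 / B \<le> u" "u \<le> B" by auto
qed

lemma window_nonneg: "needlet_window B b \<Longrightarrow> 0 \<le> b u"
  by (simp add: needlet_window_def)

text \<open>The square of \<open>b u\<close> is the term of index 0 in the partition of unity at
  \<open>u\<close>.\<close>

lemma window_le_1:
  assumes "needlet_window B b" "B > 1"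
  shows "b u \<le> 1"
proof (cases "b u = 0")
  case False
  then have "1 / B \<le> u" by (rule window_support(1)[OF assms(1)])
  moreover have "0 < 1 / B" using assms(2) by simp
  ultimately have "u > 0" by linarith
  then have h: "((\<lambda>j::int. (b (u / B powi j))\<^sup>2) has_sum 1) UNIV" using assms(1) unfolding needlet_window_def by (elim conjE allE impE)
  have "(\<Sum>j\<in>{0::int}. (b (u / B powi j))\<^sup>2) \<le> 1"
    by (rule has_sum_mono2[OF has_sum_finite h]) auto
  then have "(b u)\<^sup>2 \<le> 1\<^sup>2" by simp
  then show ?thesis by (rule power2_le_imp_le) simp
qed simp

lemma abs_spin_le: "lmin s \<le> l \<Longrightarrow> \<bar>s\<bar> \<le> int l"
  by (simp add: lmin_def nat_le_iff)

lemma spin_e_nonneg: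
  assumes "lmin s \<le> l"
  shows "0 \<le> spin_e s l"
proof -
  have "real_of_int \<bar>s\<bar> \<le> real_of_int (int l)"
    using abs_spin_le[OF assms] by (simp only: of_int_le_iff)
  then have "real_of_int s \<le> real l" "- real_of_int s \<le> real l" by (simp_all add: abs_le_iff)
  then show ?thesis unfolding spin_e_def by (intro mult_nonneg_nonneg) linarith+
qed

text \<open>The support of the window puts sqrt (spin_e s l) between B^j / B and B B^j, and spin_e s
  l = l^2 + l - s (s + 1) is comparable with l^2. The third bound is exactly the range in which the
  cubature is exact.\<close>

lemma band_bounds:
  assumes w: "needlet_window B b" and B: "B > 1" and l: "l \<in> band s B b j"
  shows "B ^ j \<le> 2 * B * real l" "real l \<le> (B + real_of_int \<bar>s\<bar> + 1) * B ^ j" "sqrt (spin_e s l) \<le> B ^ (j + 1)"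
proof -
  let ?e = "spin_e s l"
  have lm: "lmin s \<le> l" and nz: "b (sqrt ?e / B ^ j) \<noteq> 0" using l by (auto simp: band_def level_weight_def)
  have l1: "1 \<le> real l" using lm by (simp add: lmin_def)
  have e0: "0 \<le> ?e" by (rule spin_e_nonneg[OF lm])
  have Bj: "B ^ j \<ge> 1" using B by (intro one_le_power) simp
  have lo: "B ^ j \<le> B * sqrt ?e" and up: "sqrt ?e \<le> B * B ^ j"
    using window_support[OF w nz] B Bj by (auto simp: field_simps)
  then show "sqrt ?e \<le> B ^ (j + 1)" by simp
  have e: "?e = real l * real l + real l - real_of_int (s * (s + 1))"
    by (simp add: spin_e_def algebra_simps)
  have ss: "0 \<le> s * (s + 1)" by (cases "0 \<le> s") (auto intro: mult_nonneg_nonneg mult_nonpos_nonpos)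
  then have "?e \<le> real l * real l + real l" unfolding e by linarith
  also have "\<dots> \<le> (2 * real l)\<^sup>2"
    using mult_mono[OF l1 order_refl, of "real l"] by (simp add: power2_eq_square)
  finally have "sqrt ?e \<le> 2 * real l" by (intro real_le_lsqrt) auto
  then have "B * sqrt ?e \<le> B * (2 * real l)" using B by (intro mult_left_mono) auto
  with lo show "B ^ j \<le> 2 * B * real l" by simp
  let ?\<kappa> = "B + real_of_int \<bar>s\<bar> + 1"
  have "(real l)\<^sup>2 \<le> ?e + real_of_int (s * (s + 1))" unfolding e by (simp add: power2_eq_square)
  also have "?e \<le> (B * B ^ j)\<^sup>2" using power_mono[OF up, of 2] e0 by simp
  also have "real_of_int (s * (s + 1)) \<le> (real_of_int \<bar>s\<bar> + 1)\<^sup>2 * (B ^ j)\<^sup>2"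
  proof -
    have "s * (s + 1) \<le> (\<bar>s\<bar> + 1)\<^sup>2" by (cases "0 \<le> s") (auto simp: power2_eq_square algebra_simps)
    then have "real_of_int (s * (s + 1)) \<le> real_of_int ((\<bar>s\<bar> + 1)\<^sup>2)" by (simp only: of_int_le_iff)
    also have "\<dots> = (real_of_int \<bar>s\<bar> + 1)\<^sup>2 * 1" by simp
    also have "\<dots> \<le> (real_of_int \<bar>s\<bar> + 1)\<^sup>2 * (B ^ j)\<^sup>2"
      using Bj by (intro mult_left_mono power_mono[of 1 "B ^ j" 2, simplified]) auto
    finally show ?thesis .
  qed
  also have "(B * B ^ j)\<^sup>2 + (real_of_int \<bar>s\<bar> + 1)\<^sup>2 * (B ^ j)\<^sup>2 = (B\<^sup>2 + (real_of_int \<bar>s\<bar> + 1)\<^sup>2) * (B ^ j)\<^sup>2"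
    by (simp add: power_mult_distrib algebra_simps)
  also have "\<dots> \<le> ?\<kappa>\<^sup>2 * (B ^ j)\<^sup>2"
  proof (rule mult_right_mono)
    have "0 \<le> 2 * B * (real_of_int \<bar>s\<bar> + 1)" using B by simp
    then show "B\<^sup>2 + (real_of_int \<bar>s\<bar> + 1)\<^sup>2 \<le> ?\<kappa>\<^sup>2" by (simp add: power2_eq_square algebra_simps)
  qed simp
  finally have "(real l)\<^sup>2 \<le> (?\<kappa> * B ^ j)\<^sup>2" by (simp add: power_mult_distrib)
  then show "real l \<le> ?\<kappa> * B ^ j" by (rule power2_le_imp_le) (use B Bj in auto)
qed

lemma finite_band:
  assumes "needlet_window B b" "B > 1"
  shows "finite (band s B b j)"
proof (rule finite_subset)
  show "band s B b j \<subseteq> {..nat \<lceil>(B + real_of_int \<bar>s\<bar> + 1) * B ^ j\<rceil>}"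
  proof
    fix l assume "l \<in> band s B b j"
    then have "real l \<le> real (nat \<lceil>(B + real_of_int \<bar>s\<bar> + 1) * B ^ j\<rceil>)"
      using band_bounds(2)[OF assms] real_nat_ceiling_ge order_trans by blast
    then show "l \<in> {..nat \<lceil>(B + real_of_int \<bar>s\<bar> + 1) * B ^ j\<rceil>}" by simp
  qed
qed simp

lemma finite_band_indices: "needlet_window B b \<Longrightarrow> B > 1 \<Longrightarrow> finite (band_indices s B b j)"
  unfolding band_indices_def by (intro finite_SigmaI finite_band) auto

lemma band_indices_subset: "band_indices s B b j \<subseteq> harmonic_indices s"
  by (auto simp: band_indices_def band_def harmonic_indices_def)

section \<open>Needlet coefficients and cubature\<close>

lemma needlet_eq:
  assumes w: "needlet_window B b" and B: "B > 1"
  shows "needlet s B b \<xi> w j k x = complex_of_real (sqrt (w j k)) *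
     (\<Sum>i\<in>band_indices s B b j. complex_of_real (level_weight s B b j (fst i)) *
        (spin_Y s (fst i) (snd i) x * cnj (spin_Y s (fst i) (snd i) (\<xi> j k))))"
proof -
  let ?g = "\<lambda>l. complex_of_real (b (sqrt (spin_e s l) / B ^ j)) *
        (\<Sum>m = - int l..int l. spin_Y s l m x * cnj (spin_Y s l m (\<xi> j k)))"
  have "infsum ?g {lmin s..} = infsum ?g (band s B b j)"
    by (rule infsum_cong_neutral) (auto simp: band_def level_weight_def)
  also have "\<dots> = sum ?g (band s B b j)" using finite_band[OF w B] by (rule infsum_finite)
  also have "\<dots> = (\<Sum>l\<in>band s B b j. \<Sum>m = - int l..int l. complex_of_real (level_weight s B b j l) *
        (spin_Y s l m x * cnj (spin_Y s l m (\<xi> j k))))"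
    by (simp add: level_weight_def sum_distrib_left)
  also have "\<dots> = (\<Sum>i\<in>band_indices s B b j. complex_of_real (level_weight s B b j (fst i)) *
        (spin_Y s (fst i) (snd i) x * cnj (spin_Y s (fst i) (snd i) (\<xi> j k))))"
    unfolding band_indices_def by (subst sum.Sigma) (auto simp: finite_band[OF w B] case_prod_unfold)
  finally show ?thesis by (simp add: needlet_def)
qed

lemma needlet_coeff_eq:
  assumes w: "needlet_window B b" and B: "B > 1" and f: "integrable sphere_measure f"
  shows "needlet_coeff s B b \<xi> w j k f = (\<Sum>i\<in>band_indices s B b j.
     (complex_of_real (sqrt (w j k)) * complex_of_real (level_weight s B b j (fst i)) * spin_Y s (fst i) (snd i) (\<xi> j k)) *
       harmonic_coeff s i f)"
proof -
  let ?c = "\<lambda>i. complex_of_real (sqrt (w j k)) * complex_of_real (level_weight s B b j (fst i)) * spin_Y s (fst i) (snd i) (\<xi> j k)"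
  have "f x * cnj (needlet s B b \<xi> w j k x) = (\<Sum>i\<in>band_indices s B b j. ?c i * (f x * cnj (spin_Y s (fst i) (snd i) x)))" for x
    unfolding needlet_eq[OF w B] by (simp add: sum_distrib_left mult_ac)
  then have "needlet_coeff s B b \<xi> w j k f = (CLINT x|sphere_measure. (\<Sum>i\<in>band_indices s B b j. ?c i * (f x * cnj (spin_Y s (fst i) (snd i) x))))"
    by (simp add: needlet_coeff_def)
  also have "\<dots> = (\<Sum>i\<in>band_indices s B b j. ?c i * harmonic_coeff s i f)"
    by (subst Bochner_Integration.integral_sum)
      (auto intro!: integrable_mult_right integrable_mult_spin_Y(1) f simp: harmonic_coeff_def)
  finally show ?thesis .
qed

lemma measurable_needlet[measurable]:
  assumes "needlet_window B b" "B > 1"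
  shows "needlet s B b \<xi> w j k \<in> borel_measurable sphere_measure"
  unfolding needlet_eq[OF assms, abs_def] by measurable

lemma cubature_exact:
  assumes cub: "cubature s B K \<xi> w" and w: "needlet_window B b" and B: "B > 1"
    and i: "i \<in> band_indices s B b j" "i' \<in> band_indices s B b j"
  shows "(\<Sum>k<K j. complex_of_real (w j k) * spin_Y s (fst i) (snd i) (\<xi> j k) * cnj (spin_Y s (fst i') (snd i') (\<xi> j k))) =
     (if i = i' then 1 else 0)"
proof -
  have *: "\<bar>s\<bar> \<le> int (fst i) \<and> \<bar>snd i\<bar> \<le> int (fst i) \<and> sqrt (spin_e s (fst i)) \<le> B ^ (j + 1)"
    if "i \<in> band_indices s B b j" for i
    using that band_bounds(3)[OF w B, of "fst i" s j] by (auto simp: band_indices_def band_def lmin_def)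
  have "\<forall>j l l' m m'.
        \<bar>s\<bar> \<le> int l \<and> \<bar>s\<bar> \<le> int l' \<and> \<bar>m\<bar> \<le> int l \<and> \<bar>m'\<bar> \<le> int l' \<and>
        sqrt (spin_e s l) \<le> B ^ (j + 1) \<and> sqrt (spin_e s l') \<le> B ^ (j + 1) \<longrightarrow>
        (\<Sum>k<K j. complex_of_real (w j k) * spin_Y s l m (\<xi> j k) * cnj (spin_Y s l' m' (\<xi> j k))) =
        (if l = l' \<and> m = m' then 1 else 0)"
    using cub unfolding cubature_def by (elim conjE)
  then show ?thesis using *[OF i(1)] *[OF i(2)] by (simp add: prod_eq_iff)
qed

lemma cubature_weights_pos: "cubature s B K \<xi> w \<Longrightarrow> k < K j \<Longrightarrow> 0 < w j k"
  by (simp add: cubature_def)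

text \<open>A discrete Parseval identity: each of the two factors carries the square root of a
  cubature weight, and the weighted sum over the points acts on the band like the integral over the
  sphere.\<close>

lemma sum_needlet_products:
  fixes z z' :: "nat \<times> int \<Rightarrow> complex" and j :: nat
  assumes cub: "cubature s B K \<xi> w" and w: "needlet_window B b" and B: "B > 1"
  defines "c \<equiv> \<lambda>k i. complex_of_real (sqrt (w j k)) * complex_of_real (level_weight s B b j (fst i)) * spin_Y s (fst i) (snd i) (\<xi> j k)"
  shows "(\<Sum>k<K j. (\<Sum>i\<in>band_indices s B b j. c k i * z i) * cnj (\<Sum>i\<in>band_indices s B b j. c k i * z' i)) =
     (\<Sum>i\<in>band_indices s B b j. complex_of_real ((level_weight s B b j (fst i))\<^sup>2) * (z i * cnj (z' i)))"
proof -
  let ?I = "band_indices s B b j" and ?\<beta> = "\<lambda>i. complex_of_real (level_weight s B b j (fst i))"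
  have fin: "finite ?I" by (rule finite_band_indices[OF w B])
  have sq: "complex_of_real (sqrt (w j k)) * complex_of_real (sqrt (w j k)) = complex_of_real (w j k)" if "k < K j" for k
    using cubature_weights_pos[OF cub that] by (simp flip: of_real_mult)
  have "(\<Sum>k<K j. (\<Sum>i\<in>?I. c k i * z i) * cnj (\<Sum>i\<in>?I. c k i * z' i)) =
      (\<Sum>k<K j. \<Sum>i\<in>?I. \<Sum>i'\<in>?I. ?\<beta> i * ?\<beta> i' * (z i * cnj (z' i')) *
        (complex_of_real (w j k) * spin_Y s (fst i) (snd i) (\<xi> j k) * cnj (spin_Y s (fst i') (snd i') (\<xi> j k))))"
  proof (rule sum.cong[OF refl])
    fix k assume "k \<in> {..<K j}"
    then have k: "k < K j" by simp
    show "(\<Sum>i\<in>?I. c k i * z i) * cnj (\<Sum>i\<in>?I. c k i * z' i) = (\<Sum>i\<in>?I. \<Sum>i'\<in>?I. ?\<beta> i * ?\<beta> i' * (z i * cnj (z' i')) *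
        (complex_of_real (w j k) * spin_Y s (fst i) (snd i) (\<xi> j k) * cnj (spin_Y s (fst i') (snd i') (\<xi> j k))))"
      unfolding cnj_sum sum_product sq[OF k, symmetric] by (simp add: c_def mult_ac)
  qed
  also have "\<dots> = (\<Sum>i\<in>?I. \<Sum>i'\<in>?I. ?\<beta> i * ?\<beta> i' * (z i * cnj (z' i')) *
        (\<Sum>k<K j. complex_of_real (w j k) * spin_Y s (fst i) (snd i) (\<xi> j k) * cnj (spin_Y s (fst i') (snd i') (\<xi> j k))))"
    by (subst sum.swap, rule sum.cong[OF refl], subst sum.swap) (simp only: sum_distrib_left)
  also have "\<dots> = (\<Sum>i\<in>?I. \<Sum>i'\<in>?I. if i = i' then ?\<beta> i * ?\<beta> i' * (z i * cnj (z' i')) else 0)"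
    by (intro sum.cong refl) (simp add: cubature_exact[OF cub w B])
  also have "\<dots> = (\<Sum>i\<in>?I. complex_of_real ((level_weight s B b j (fst i))\<^sup>2) * (z i * cnj (z' i)))"
    using fin by (intro sum.cong refl) (simp add: power2_eq_square)
  finally show ?thesis .
qed

section \<open>The cross-power-spectrum estimator as a sum of independent quadratic forms\<close>

text \<open>The coefficients found by expanding the average of (x_0 + x_r) (x_0 + x_r') over ordered
  pairs of different channels. The signal square has total weight 1; x_0 x_r has weight 2 (D - 1) /
  (D (D - 1)) = 2 / D, shared by two symmetric entries; squared noise terms are absent.\<close>

definition cp_matrix :: "nat \<Rightarrow> nat \<Rightarrow> nat \<Rightarrow> real" where
  "cp_matrix D a b = (if a = 0 \<and> b = 0 then 1 else if a = 0 \<or> b = 0 then 1 / real D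
     else if a = b then 0 else 1 / (real D * (real D - 1)))"

lemma cp_matrix_sym: "cp_matrix D a b = cp_matrix D b a"
  by (auto simp: cp_matrix_def)

lemma cp_matrix_form:
  fixes x :: "nat \<Rightarrow> real"
  assumes D: "D \<ge> 2"
  shows "(\<Sum>a\<in>{0..D}. \<Sum>b\<in>{0..D}. cp_matrix D a b * (x a * x b)) =
     1 / (real D * (real D - 1)) * (\<Sum>r\<^sub>1 = 1..D. \<Sum>r\<^sub>2\<in>{1..D} - {r\<^sub>1}. (x 0 + x r\<^sub>1) * (x 0 + x r\<^sub>2))"
proof -
  \<comment> \<open>Both sides are polynomials in \<open>x 0\<close>, the sum \<open>S\<close> and
    the sum of squares \<open>Q\<close> of the noise parts, because the double sum over different
    channels is a full sum minus its diagonal.\<close>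
  define S where "S = (\<Sum>r = 1..D. x r)"
  define Q where "Q = (\<Sum>r = 1..D. x r * x r)"
  define d where "d = real D"
  have d: "d \<ge> 2" using D by (simp add: d_def)
  have split: "(\<Sum>a\<in>{0..D}. f a) = f 0 + (\<Sum>r = 1..D. f r)" for f :: "nat \<Rightarrow> real"
    by (simp add: sum.atLeast_Suc_atMost)
  have off: "(\<Sum>r\<^sub>2\<in>{1..D} - {r}. f r\<^sub>2) = (\<Sum>r = 1..D. f r) - f r" if "r \<in> {1..D}" for f :: "nat \<Rightarrow> real" and r
    using that by (simp add: sum_diff1)
  have row: "(\<Sum>b\<in>{0..D}. cp_matrix D a b * (x a * x b)) = x 0 * x a / d + (x a * S - x a * x a) / (d * (d - 1))"
    if "a \<in> {1..D}" for a
  proof -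
    have "(\<Sum>b = 1..D. cp_matrix D a b * (x a * x b)) = (\<Sum>b\<in>{1..D} - {a}. cp_matrix D a b * (x a * x b))"
      by (rule sum.mono_neutral_right) (use that in \<open>auto simp: cp_matrix_def\<close>)
    also have "\<dots> = (\<Sum>b\<in>{1..D} - {a}. x a * x b / (d * (d - 1)))"
      by (rule sum.cong) (use that in \<open>auto simp: cp_matrix_def d_def\<close>)
    also have "\<dots> = (x a * S - x a * x a) / (d * (d - 1))"
      unfolding off[OF that] by (simp add: S_def sum_distrib_left sum_divide_distrib diff_divide_distrib)
    finally show ?thesis
      unfolding split using that by (simp add: cp_matrix_def d_def mult.commute)
  qed
  have row0: "(\<Sum>b\<in>{0..D}. cp_matrix D 0 b * (x 0 * x b)) = x 0 * x 0 + x 0 * S / d"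
  proof -
    have "(\<Sum>b = 1..D. cp_matrix D 0 b * (x 0 * x b)) = (\<Sum>b = 1..D. x 0 * x b / d)"
      by (rule sum.cong) (auto simp: cp_matrix_def d_def)
    then show ?thesis unfolding split by (simp add: cp_matrix_def S_def sum_distrib_left sum_divide_distrib)
  qed
  have "(\<Sum>a\<in>{0..D}. \<Sum>b\<in>{0..D}. cp_matrix D a b * (x a * x b)) =
      (x 0 * x 0 + x 0 * S / d) + (\<Sum>a = 1..D. x 0 * x a / d + (x a * S - x a * x a) / (d * (d - 1)))"
    unfolding split[of "\<lambda>a. \<Sum>b\<in>{0..D}. cp_matrix D a b * (x a * x b)"] row0 using row by simp
  also have "(\<Sum>a = 1..D. x 0 * x a / d + (x a * S - x a * x a) / (d * (d - 1))) = x 0 * S / d + (S * S - Q) / (d * (d - 1))"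
    by (simp only: sum.distrib sum_divide_distrib[symmetric] sum_subtractf sum_distrib_left[symmetric]
        sum_distrib_right[symmetric] S_def[symmetric] Q_def[symmetric])
  finally have L: "(\<Sum>a\<in>{0..D}. \<Sum>b\<in>{0..D}. cp_matrix D a b * (x a * x b)) =
      x 0 * x 0 + x 0 * S / d + (x 0 * S / d + (S * S - Q) / (d * (d - 1)))" .
  have "(\<Sum>r\<^sub>1 = 1..D. \<Sum>r\<^sub>2\<in>{1..D} - {r\<^sub>1}. (x 0 + x r\<^sub>1) * (x 0 + x r\<^sub>2)) =
      (\<Sum>r = 1..D. (x 0 + x r) * ((d - 1) * x 0 + S - x r))"
  proof (rule sum.cong[OF refl])
    fix r assume r: "r \<in> {1..D}"
    have "(\<Sum>r\<^sub>2\<in>{1..D} - {r}. (x 0 + x r) * (x 0 + x r\<^sub>2)) = (x 0 + x r) * (\<Sum>r\<^sub>2\<in>{1..D} - {r}. x 0 + x r\<^sub>2)"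
      by (simp add: sum_distrib_left)
    also have "(\<Sum>r\<^sub>2\<in>{1..D} - {r}. x 0 + x r\<^sub>2) = (d - 1) * x 0 + S - x r"
      unfolding off[OF r] by (simp add: sum.distrib S_def d_def algebra_simps)
    finally show "(\<Sum>r\<^sub>2\<in>{1..D} - {r}. (x 0 + x r) * (x 0 + x r\<^sub>2)) = (x 0 + x r) * ((d - 1) * x 0 + S - x r)" .
  qed
  also have "\<dots> = (\<Sum>r = 1..D. ((d - 1) * x 0 + S) * x 0 + ((d - 2) * x 0 + S) * x r - x r * x r)"
    by (rule sum.cong) (auto simp: algebra_simps)
  also have "\<dots> = d * (((d - 1) * x 0 + S) * x 0) + ((d - 2) * x 0 + S) * S - Q"
    by (simp add: sum.distrib sum_subtractf S_def Q_def d_def sum_distrib_left[symmetric])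
  also have "1 / (d * (d - 1)) * \<dots> = x 0 * x 0 + x 0 * S / d + (x 0 * S / d + (S * S - Q) / (d * (d - 1)))"
  proof -
    have nz: "d \<noteq> 0" "d - 1 \<noteq> 0" using d by auto
    have "(x 0 * x 0 + x 0 * S / d + (x 0 * S / d + (S * S - Q) / (d * (d - 1)))) * (d * (d - 1)) =
       d * (((d - 1) * x 0 + S) * x 0) + ((d - 2) * x 0 + S) * S - Q"
      using nz by (simp add: distrib_right) (simp add: algebra_simps)
    then show ?thesis using nz by (simp add: field_simps)
  qed
  finally show ?thesis unfolding L by (simp add: d_def)
qed

lemma (in prob_space) expectation_square_sum_indep:
  fixes Y :: "'i \<Rightarrow> 'a \<Rightarrow> real"
  assumes I: "finite I" and indep: "indep_vars (\<lambda>_. borel) Y I"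
    and sq: "\<And>i. i \<in> I \<Longrightarrow> integrable M (\<lambda>\<omega>. (Y i \<omega>)\<^sup>2)" and mean: "\<And>i. i \<in> I \<Longrightarrow> expectation (Y i) = 0"
  shows "expectation (\<lambda>\<omega>. (\<Sum>i\<in>I. Y i \<omega>)\<^sup>2) = (\<Sum>i\<in>I. expectation (\<lambda>\<omega>. (Y i \<omega>)\<^sup>2))"
proof -
  have meas[measurable]: "Y i \<in> borel_measurable M" if "i \<in> I" for i
    using indep that by (auto simp: indep_vars_def)
  have int: "integrable M (Y i)" if "i \<in> I" for i
    by (rule square_integrable_imp_integrable[OF meas[OF that] sq[OF that]])
  have prod: "integrable M (\<lambda>\<omega>. Y i \<omega> * Y k \<omega>)"
    "expectation (\<lambda>\<omega>. Y i \<omega> * Y k \<omega>) = (if i = k then expectation (\<lambda>\<omega>. (Y i \<omega>)\<^sup>2) else 0)"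
    if "i \<in> I" "k \<in> I" for i k
  proof -
    have "integrable M (\<lambda>\<omega>. Y i \<omega> * Y k \<omega>) \<and> expectation (\<lambda>\<omega>. Y i \<omega> * Y k \<omega>) = (if i = k then expectation (\<lambda>\<omega>. (Y i \<omega>)\<^sup>2) else 0)"
    proof (cases "i = k")
      case True
      then show ?thesis using sq[OF that(1)] by (simp add: power2_eq_square)
    next
      case False
      have ind: "indep_vars (\<lambda>_. borel) Y {i, k}" by (rule indep_vars_subset[OF indep]) (use that in auto)
      have "integrable M (\<lambda>\<omega>. \<Prod>q\<in>{i, k}. Y q \<omega>)" "expectation (\<lambda>\<omega>. \<Prod>q\<in>{i, k}. Y q \<omega>) = (\<Prod>q\<in>{i, k}. expectation (Y q))"
        by (rule indep_vars_integrable[OF _ ind] indep_vars_lebesgue_integral[OF _ ind]; use int that in auto)+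
      then show ?thesis using False mean that by simp
    qed
    then show "integrable M (\<lambda>\<omega>. Y i \<omega> * Y k \<omega>)"
      "expectation (\<lambda>\<omega>. Y i \<omega> * Y k \<omega>) = (if i = k then expectation (\<lambda>\<omega>. (Y i \<omega>)\<^sup>2) else 0)" by auto
  qed
  have "expectation (\<lambda>\<omega>. (\<Sum>i\<in>I. Y i \<omega>)\<^sup>2) = expectation (\<lambda>\<omega>. \<Sum>p\<in>I \<times> I. Y (fst p) \<omega> * Y (snd p) \<omega>)"
    by (simp add: power2_eq_square sum_product sum.cartesian_product case_prod_unfold)
  also have "\<dots> = (\<Sum>p\<in>I \<times> I. expectation (\<lambda>\<omega>. Y (fst p) \<omega> * Y (snd p) \<omega>))"
    by (rule Bochner_Integration.integral_sum) (use prod(1) in auto)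
  also have "\<dots> = (\<Sum>i\<in>I. \<Sum>k\<in>I. expectation (\<lambda>\<omega>. Y i \<omega> * Y k \<omega>))"
    by (simp add: sum.cartesian_product case_prod_unfold)
  also have "\<dots> = (\<Sum>i\<in>I. \<Sum>k\<in>I. if i = k then expectation (\<lambda>\<omega>. (Y i \<omega>)\<^sup>2) else 0)"
    using prod(2) by (intro sum.cong refl) auto
  finally show ?thesis using I by simp
qed

locale cross_power = independent_spin_fields M s "{0..D}" C F a
  for M :: "'a measure" and s :: int and D :: nat and C :: "nat \<Rightarrow> nat \<Rightarrow> real"
    and F :: "nat \<Rightarrow> 'a \<Rightarrow> real^3 \<Rightarrow> complex" and a :: "nat \<Rightarrow> nat \<times> int \<Rightarrow> 'a \<Rightarrow> complex" +
  fixes B :: real and b :: "real \<Rightarrow> real" and K :: "nat \<Rightarrow> nat" and \<xi> :: "nat \<Rightarrow> nat \<Rightarrow> real^3"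
    and w :: "nat \<Rightarrow> nat \<Rightarrow> real" and T :: "nat \<Rightarrow> 'a \<Rightarrow> real^3 \<Rightarrow> complex"
  assumes D: "D \<ge> 2" and B: "B > 1" and window: "needlet_window B b" and cub: "cubature s B K \<xi> w"
    and T: "\<And>r \<omega> x. r \<in> {1..D} \<Longrightarrow> \<omega> \<in> space M \<Longrightarrow> x \<in> sphere 0 1 \<Longrightarrow> T r \<omega> x = F 0 \<omega> x + F r \<omega> x"
begin

abbreviation "\<beta> \<equiv> level_weight s B b"
abbreviation "blocks j \<equiv> band_indices s B b j \<times> (UNIV :: bool set)"
abbreviation "estimator \<equiv> cp_estimator s B b K \<xi> w D T"
abbreviation "h \<equiv> cp_matrix D"

lemma finite_blocks: "finite (blocks j)"
  using finite_band_indices[OF window B] by simp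

definition form :: "(nat \<times> int) \<times> bool \<Rightarrow> 'a \<Rightarrow> real" where
  "form p \<omega> = (\<Sum>r\<in>{0..D}. \<Sum>r'\<in>{0..D}. h r r' * (V (r, p) \<omega> * V (r', p) \<omega>))"

text \<open>The subtracted constant is the mean of \<open>form p\<close>: the diagonal of the matrix
  is 1 at the signal and 0 at every noise, and a part of a signal coefficient has variance
  \<open>C 0 l / 2\<close>.\<close>

definition Y :: "nat \<Rightarrow> (nat \<times> int) \<times> bool \<Rightarrow> 'a \<Rightarrow> real" where
  "Y j p \<omega> = (\<beta> j (fst (fst p)))\<^sup>2 * (form p \<omega> - C 0 (fst (fst p)) / 2)"

text \<open>The division by 2 combines the factor 2 of \<open>centred_form_variance\<close> with the
  two halved variances.\<close>

definition block_variance :: "nat \<Rightarrow> real" where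
  "block_variance l = (\<Sum>r\<in>{0..D}. \<Sum>r'\<in>{0..D}. (h r r')\<^sup>2 * (C r l * C r' l)) / 2"

lemma C_pos: "r \<le> D \<Longrightarrow> lmin s \<le> l \<Longrightarrow> C r l > 0"
  using expansion[of r] by (simp add: spin_expansion_def spin_expansion_axioms_def)

lemma block_variance_pos:
  assumes "lmin s \<le> l"
  shows "block_variance l > 0"
proof -
  have "(h 0 0)\<^sup>2 * (C 0 l * C 0 l) \<le> (\<Sum>r\<in>{0..D}. \<Sum>r'\<in>{0..D}. (h r r')\<^sup>2 * (C r l * C r' l))"
  proof -
    have nn: "0 \<le> (h r r')\<^sup>2 * (C r l * C r' l)" if "r \<in> {0..D}" "r' \<in> {0..D}" for r r'
      using C_pos[of r l] C_pos[of r' l] that assms by simp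
    have "(h 0 0)\<^sup>2 * (C 0 l * C 0 l) \<le> (\<Sum>r'\<in>{0..D}. (h 0 r')\<^sup>2 * (C 0 l * C r' l))"
      by (rule member_le_sum[of 0 "{0..D}" "\<lambda>r'. (h 0 r')\<^sup>2 * (C 0 l * C r' l)"]) (use nn in auto)
    also have "\<dots> \<le> (\<Sum>r\<in>{0..D}. \<Sum>r'\<in>{0..D}. (h r r')\<^sup>2 * (C r l * C r' l))"
      by (rule member_le_sum[of 0 "{0..D}" "\<lambda>r. \<Sum>r'\<in>{0..D}. (h r r')\<^sup>2 * (C r l * C r' l)"]) (use nn in \<open>auto intro!: sum_nonneg\<close>)
    finally show ?thesis .
  qed
  moreover have "C 0 l * C 0 l > 0" using C_pos[of 0 l] assms by simp
  ultimately show ?thesis by (simp add: block_variance_def cp_matrix_def)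
qed

text \<open>One block is a quadratic form in the \<open>D + 1\<close> variables with the same
  \<open>p\<close>, so \<open>centred_form_fourth\<close> counts (D + 1)^2 pairs and the cube gives
  the sixth power. The constant depends neither on the level nor on the block, as the central limit
  theorem demands.\<close>

lemma Y_moments:
  assumes p: "fst p \<in> harmonic_indices s"
  shows "integrable M (\<lambda>\<omega>. Y j p \<omega> ^ 4)" "integrable M (Y j p)" "expectation (Y j p) = 0"
    "expectation (\<lambda>\<omega>. (Y j p \<omega>)\<^sup>2) = \<beta> j (fst (fst p)) ^ 4 * block_variance (fst (fst p))"
    "expectation (\<lambda>\<omega>. Y j p \<omega> ^ 4) \<le> 212 * (real (D + 1)) ^ 6 * (expectation (\<lambda>\<omega>. (Y j p \<omega>)\<^sup>2))\<^sup>2"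
proof -
  let ?l = "fst (fst p)"
  have lm: "lmin s \<le> ?l" using p by (auto simp: harmonic_indices_def)
  interpret N: independent_normals M "{0..D} \<times> {p}" V "\<lambda>q. sqrt (C (fst q) ?l / 2)"
  proof
    show "finite ({0..D} \<times> {p})" by simp
    show "indep_vars (\<lambda>_. borel) V ({0..D} \<times> {p})"
      by (rule indep_vars_subset[OF V_indep[of "{fst p}"]]) (use p in \<open>auto simp: prod_eq_iff\<close>)
    fix q assume q: "q \<in> {0..D} \<times> {p}"
    then have "q = (fst q, fst p, snd p)" by auto
    then show "distributed M lborel (V q) (\<lambda>x. ennreal (normal_density 0 (sqrt (C (fst q) ?l / 2)) x))"
      using V_normal(1)[of "fst q" "fst p" "snd p"] q p by auto
    show "0 < sqrt (C (fst q) ?l / 2)" using C_pos[of "fst q" ?l] q lm by auto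
  qed
  let ?h = "\<lambda>q q'. h (fst q) (fst q')"
  have sum1: "(\<Sum>q\<in>{0..D} \<times> {p}. f q) = (\<Sum>r\<in>{0..D}. f (r, p))" for f :: "nat \<times> (nat \<times> int) \<times> bool \<Rightarrow> real"
    by (rule sum.reindex_bij_witness[of _ "\<lambda>r. (r, p)" fst]) auto
  have diag: "(\<Sum>r\<in>{0..D}. h r r * (C r ?l / 2)) = C 0 ?l / 2"
  proof -
    have "(\<Sum>r\<in>{0..D}. h r r * (C r ?l / 2)) = (\<Sum>r\<in>{0..D}. if r = 0 then C 0 ?l / 2 else 0)"
      by (rule sum.cong) (auto simp: cp_matrix_def)
    then show ?thesis by simp
  qed
  have sq: "(sqrt (C r ?l / 2))\<^sup>2 = C r ?l / 2" if "r \<in> {0..D}" for r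
    using C_pos[of r ?l] lm that by simp
  have cf: "N.centred_form ?h \<omega> = form p \<omega> - C 0 ?l / 2" for \<omega>
  proof -
    have "(\<Sum>r\<in>{0..D}. h r r * (sqrt (C r ?l / 2))\<^sup>2) = (\<Sum>r\<in>{0..D}. h r r * (C r ?l / 2))"
      using sq by (intro sum.cong) auto
    then show ?thesis unfolding N.centred_form_def sum1 form_def using diag by simp
  qed
  have Y: "Y j p = (\<lambda>\<omega>. (\<beta> j ?l)\<^sup>2 * N.centred_form ?h \<omega>)"
    by (simp add: fun_eq_iff Y_def cf)
  have sym: "?h q q' = ?h q' q" for q q' by (rule cp_matrix_sym)
  have p4: "((\<beta> j ?l)\<^sup>2)\<^sup>2 = \<beta> j ?l ^ 4" by (simp flip: power_mult)
  have var: "expectation (\<lambda>\<omega>. (N.centred_form ?h \<omega>)\<^sup>2) = block_variance ?l"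
  proof -
    have "(\<Sum>r\<in>{0..D}. \<Sum>r'\<in>{0..D}. (h r r')\<^sup>2 * ((sqrt (C r ?l / 2))\<^sup>2 * (sqrt (C r' ?l / 2))\<^sup>2)) =
       (\<Sum>r\<in>{0..D}. \<Sum>r'\<in>{0..D}. (h r r')\<^sup>2 * (C r ?l * C r' ?l) / 4)"
    proof (intro sum.cong refl)
      fix r r' assume "r \<in> {0..D}" "r' \<in> {0..D}"
      then show "(h r r')\<^sup>2 * ((sqrt (C r ?l / 2))\<^sup>2 * (sqrt (C r' ?l / 2))\<^sup>2) = (h r r')\<^sup>2 * (C r ?l * C r' ?l) / 4"
        unfolding sq[OF \<open>r \<in> {0..D}\<close>] sq[OF \<open>r' \<in> {0..D}\<close>] by simp
    qed
    then show ?thesis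
      unfolding N.centred_form_variance[OF sym] sum1 by (simp add: block_variance_def sum_divide_distrib[symmetric])
  qed
  show "integrable M (\<lambda>\<omega>. Y j p \<omega> ^ 4)"
    unfolding Y power_mult_distrib by (intro integrable_mult_right N.centred_form_fourth(1)[OF sym])
  show "integrable M (Y j p)" unfolding Y by (intro integrable_mult_right N.centred_form_mean(1))
  show "expectation (Y j p) = 0" unfolding Y using N.centred_form_mean(2)[of ?h] by simp
  show EY2: "expectation (\<lambda>\<omega>. (Y j p \<omega>)\<^sup>2) = \<beta> j ?l ^ 4 * block_variance ?l"
    unfolding Y power_mult_distrib p4 integral_mult_right_zero var ..
  have "expectation (\<lambda>\<omega>. Y j p \<omega> ^ 4) = ((\<beta> j ?l)\<^sup>2) ^ 4 * expectation (\<lambda>\<omega>. N.centred_form ?h \<omega> ^ 4)"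
    unfolding Y power_mult_distrib integral_mult_right_zero ..
  also have "\<dots> \<le> ((\<beta> j ?l)\<^sup>2) ^ 4 * (212 * real (card (({0..D} \<times> {p}) \<times> ({0..D} \<times> {p}))) ^ 3 * (block_variance ?l)\<^sup>2)"
    using N.centred_form_fourth(2)[of ?h, OF sym] unfolding var by (intro mult_left_mono) auto
  also have "real (card (({0..D} \<times> {p}) \<times> ({0..D} \<times> {p}))) ^ 3 = (real (D + 1)) ^ 6"
    by (simp add: card_cartesian_product power2_eq_square[symmetric] flip: power_mult)
  also have "((\<beta> j ?l)\<^sup>2) ^ 4 * (212 * (real (D + 1)) ^ 6 * (block_variance ?l)\<^sup>2) =
      212 * (real (D + 1)) ^ 6 * (expectation (\<lambda>\<omega>. (Y j p \<omega>)\<^sup>2))\<^sup>2"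
    unfolding EY2 by (simp add: power_mult_distrib flip: power_mult)
  finally show "expectation (\<lambda>\<omega>. Y j p \<omega> ^ 4) \<le> 212 * (real (D + 1)) ^ 6 * (expectation (\<lambda>\<omega>. (Y j p \<omega>)\<^sup>2))\<^sup>2" .
qed

lemma blocks_harmonic: "p \<in> blocks j \<Longrightarrow> fst p \<in> harmonic_indices s"
  using band_indices_subset[of s B b j] by auto

text \<open>Different blocks are functions of disjoint groups of the independent variables
  \<open>V\<close>.\<close>

lemma Y_indep: "indep_vars (\<lambda>_. borel) (Y j) (blocks j)"
proof -
  have 1: "indep_vars (\<lambda>_. borel) V ({0..D} \<times> blocks j)"
    by (rule V_indep[OF finite_band_indices[OF window B] band_indices_subset])
  have 2: "indep_vars (\<lambda>p. PiM ({0..D} \<times> {p}) (\<lambda>_. borel)) (\<lambda>p \<omega>. restrict (\<lambda>q. V q \<omega>) ({0..D} \<times> {p})) (blocks j)"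
    by (rule indep_vars_restrict[OF 1]) (auto simp: disjoint_family_on_def)
  let ?f = "\<lambda>p v. (\<beta> j (fst (fst p)))\<^sup>2 * ((\<Sum>r\<in>{0..D}. \<Sum>r'\<in>{0..D}. h r r' * (v (r, p) * v (r', p))) - C 0 (fst (fst p)) / 2)"
  have "indep_vars (\<lambda>_. borel) (\<lambda>p \<omega>. ?f p (restrict (\<lambda>q. V q \<omega>) ({0..D} \<times> {p}))) (blocks j)"
  proof (rule indep_vars_compose2[OF 2])
    fix p assume "p \<in> blocks j"
    have [measurable]: "(\<lambda>v. v (r, p)) \<in> borel_measurable (PiM ({0..D} \<times> {p}) (\<lambda>_. borel))" if "r \<in> {0..D}" for r
      by (rule measurable_component_singleton) (use that in auto)
    show "?f p \<in> borel_measurable (PiM ({0..D} \<times> {p}) (\<lambda>_. borel))" by measurable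
  qed
  then show ?thesis
    by (rule indep_vars_cong[THEN iffD1, rotated -1]) (auto simp: Y_def form_def fun_eq_iff)
qed

end

section \<open>Exact decomposition and variance of the estimator\<close>

lemma sum_times_bool:
  fixes f :: "'i \<times> bool \<Rightarrow> 'b :: comm_monoid_add"
  shows "(\<Sum>p\<in>A \<times> UNIV. f p) = (\<Sum>i\<in>A. f (i, True) + f (i, False))"
proof -
  have "(\<Sum>p\<in>A \<times> UNIV. f p) = (\<Sum>i\<in>A. \<Sum>c\<in>UNIV. f (i, c))"
    by (simp add: sum.cartesian_product case_prod_unfold)
  then show ?thesis by (simp add: UNIV_bool add.commute)
qed

context cross_power
begin

lemma AE_paths:
  "AE \<omega> in M. \<forall>r\<in>{0..D}. integrable sphere_measure (F r \<omega>) \<and> (\<forall>i\<in>band_indices s B b j. harmonic_coeff s i (F r \<omega>) = a r i \<omega>)"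
proof (rule AE_finite_allI)
  fix r assume "r \<in> {0..D}"
  then interpret E: spin_expansion M s "C r" "F r" "a r" by (rule expansion)
  have "AE \<omega> in M. \<forall>i\<in>band_indices s B b j. harmonic_coeff s i (F r \<omega>) = a r i \<omega>"
    using finite_band_indices[OF window B] band_indices_subset E.AE_harmonic_coeff by (intro AE_finite_allI) blast+
  with E.AE_path_integrable
  show "AE \<omega> in M. integrable sphere_measure (F r \<omega>) \<and> (\<forall>i\<in>band_indices s B b j. harmonic_coeff s i (F r \<omega>) = a r i \<omega>)"
    by eventually_elim auto
qed simp

lemma needlet_coeff_T:
  assumes "r \<in> {1..D}" "\<omega> \<in> space M"
  shows "needlet_coeff s B b \<xi> w j k (T r \<omega>) = needlet_coeff s B b \<xi> w j k (\<lambda>x. F 0 \<omega> x + F r \<omega> x)"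
  unfolding needlet_coeff_def by (rule Bochner_Integration.integral_cong) (use T[OF assms] in auto)

text \<open>Measurability is inherited from \<open>F 0 + F r\<close>, with which \<open>T r\<close>
  agrees on the space of \<open>M\<close> and on the sphere.\<close>

lemma needlet_coeff_T_meas: "r \<in> {1..D} \<Longrightarrow> (\<lambda>\<omega>. needlet_coeff s B b \<xi> w j k (T r \<omega>)) \<in> borel_measurable M"
proof -
  assume r: "r \<in> {1..D}"
  interpret E0: spin_expansion M s "C 0" "F 0" "a 0" by (rule expansion) simp
  interpret E: spin_expansion M s "C r" "F r" "a r" by (rule expansion) (use r in simp)
  have [measurable]: "needlet s B b \<xi> w j k \<in> borel_measurable sphere_measure"
    by (rule measurable_needlet[OF window B])
  have "(\<lambda>\<omega>. needlet_coeff s B b \<xi> w j k (\<lambda>x. F 0 \<omega> x + F r \<omega> x)) \<in> borel_measurable M"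
    unfolding needlet_coeff_def
    by (rule sphere.borel_measurable_lebesgue_integral) (simp add: case_prod_unfold)
  then show ?thesis
    by (subst measurable_cong[OF needlet_coeff_T[OF r]])
qed

lemma estimator_meas: "estimator j \<in> borel_measurable M"
proof -
  have [measurable]: "(\<lambda>\<omega>. needlet_coeff s B b \<xi> w j k (T r \<omega>)) \<in> borel_measurable M" if "r \<in> {1..D}" for k r
    by (rule needlet_coeff_T_meas[OF that])
  have [measurable]: "(\<lambda>\<omega>. needlet_coeff s B b \<xi> w j k (T r \<omega>)) \<in> borel_measurable M" if "r \<in> {1..D} - {r'}" for k r r'
    by (rule needlet_coeff_T_meas) (use that in auto)
  show ?thesis unfolding cp_estimator_def[abs_def] cp_sum_def by measurable
qed

text \<open>Cubature exactness with equal indices makes the weighted squares of each harmonic sum to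
  1. The halves appear because a block set lists every \<open>(l, m)\<close> twice, once for each
  part.\<close>

lemma needlet_power_eq:
  "needlet_power M s B b K \<xi> w (F 0) j = (\<Sum>p\<in>blocks j. (\<beta> j (fst (fst p)))\<^sup>2 * (C 0 (fst (fst p)) / 2))"
proof -
  interpret E0: spin_expansion M s "C 0" "F 0" "a 0" by (rule expansion) simp
  let ?I = "band_indices s B b j"
  let ?c = "\<lambda>k i. complex_of_real (sqrt (w j k)) * complex_of_real (\<beta> j (fst i)) * spin_Y s (fst i) (snd i) (\<xi> j k)"
  have meas[measurable]: "(\<lambda>\<omega>. needlet_coeff s B b \<xi> w j k (F 0 \<omega>)) \<in> borel_measurable M" for k
  proof -
    have [measurable]: "needlet s B b \<xi> w j k \<in> borel_measurable sphere_measure"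
      by (rule measurable_needlet[OF window B])
    show ?thesis
      unfolding needlet_coeff_def
      by (rule sphere.borel_measurable_lebesgue_integral) (simp add: case_prod_unfold)
  qed
  have a_meas[measurable]: "a 0 i \<in> borel_measurable M" if "i \<in> ?I" for i
    by (rule E0.a_meas) (use that band_indices_subset in blast)
  have "(LINT \<omega>|M. (cmod (needlet_coeff s B b \<xi> w j k (F 0 \<omega>)))\<^sup>2) = (\<Sum>i\<in>?I. (cmod (?c k i))\<^sup>2 * C 0 (fst i))" for k
  proof -
    have "AE \<omega> in M. (cmod (needlet_coeff s B b \<xi> w j k (F 0 \<omega>)))\<^sup>2 = (cmod (\<Sum>i\<in>?I. ?c k i * a 0 i \<omega>))\<^sup>2"
      using AE_paths[of j] by eventually_elim (simp add: needlet_coeff_eq[OF window B])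
    then have "(LINT \<omega>|M. (cmod (needlet_coeff s B b \<xi> w j k (F 0 \<omega>)))\<^sup>2) = (LINT \<omega>|M. (cmod (\<Sum>i\<in>?I. ?c k i * a 0 i \<omega>))\<^sup>2)"
      by (rule integral_cong_AE[rotated 2]) measurable
    also have "\<dots> = (\<Sum>i\<in>?I. (cmod (?c k i))\<^sup>2 * C 0 (fst i))"
      by (rule E0.linear_combination(5)[OF finite_band_indices[OF window B] band_indices_subset])
    finally show ?thesis .
  qed
  then have "needlet_power M s B b K \<xi> w (F 0) j = (\<Sum>k<K j. \<Sum>i\<in>?I. (cmod (?c k i))\<^sup>2 * C 0 (fst i))"
    by (simp add: needlet_power_def)
  also have "\<dots> = (\<Sum>i\<in>?I. (\<beta> j (fst i))\<^sup>2 * C 0 (fst i) * (\<Sum>k<K j. w j k * (cmod (spin_Y s (fst i) (snd i) (\<xi> j k)))\<^sup>2))"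
  proof (subst sum.swap, rule sum.cong[OF refl], unfold sum_distrib_left, rule sum.cong[OF refl])
    fix i k assume "k \<in> {..<K j}"
    then have "(sqrt (w j k))\<^sup>2 = w j k" using cubature_weights_pos[OF cub, of k j] by simp
    then show "(cmod (?c k i))\<^sup>2 * C 0 (fst i) = (\<beta> j (fst i))\<^sup>2 * C 0 (fst i) * (w j k * (cmod (spin_Y s (fst i) (snd i) (\<xi> j k)))\<^sup>2)"
      by (simp add: norm_mult power_mult_distrib mult_ac)
  qed
  also have "\<dots> = (\<Sum>i\<in>?I. (\<beta> j (fst i))\<^sup>2 * C 0 (fst i))"
  proof (rule sum.cong[OF refl])
    fix i assume i: "i \<in> ?I"
    have "complex_of_real (\<Sum>k<K j. w j k * (cmod (spin_Y s (fst i) (snd i) (\<xi> j k)))\<^sup>2) =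
      (\<Sum>k<K j. complex_of_real (w j k) * spin_Y s (fst i) (snd i) (\<xi> j k) * cnj (spin_Y s (fst i) (snd i) (\<xi> j k)))"
      unfolding of_real_sum of_real_mult complex_norm_square by (simp only: mult.assoc)
    also have "\<dots> = 1" using cubature_exact[OF cub window B i i] by simp
    finally have "(\<Sum>k<K j. w j k * (cmod (spin_Y s (fst i) (snd i) (\<xi> j k)))\<^sup>2) = 1" by (simp only: of_real_eq_1_iff)
    then show "(\<beta> j (fst i))\<^sup>2 * C 0 (fst i) * (\<Sum>k<K j. w j k * (cmod (spin_Y s (fst i) (snd i) (\<xi> j k)))\<^sup>2) = (\<beta> j (fst i))\<^sup>2 * C 0 (fst i)"
      by simp
  qed
  also have "\<dots> = (\<Sum>p\<in>blocks j. (\<beta> j (fst (fst p)))\<^sup>2 * (C 0 (fst (fst p)) / 2))"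
    unfolding sum_times_bool by (rule sum.cong) auto
  finally show ?thesis .
qed

text \<open>Summation over the points leaves products of coefficients with the same
  \<open>(l, m)\<close>. As Re (z cnj z') = Re z Re z' + Im z Im z', the two parts separate, and
  \<open>cp_matrix_form\<close> turns the sum over channels into \<open>form\<close>. The identity
  is almost sure because the coefficients agree with the path integrals only almost surely.\<close>

theorem estimator_decomposition:
  "AE \<omega> in M. estimator j \<omega> = needlet_power M s B b K \<xi> w (F 0) j + (\<Sum>p\<in>blocks j. Y j p \<omega>)"
  using AE_paths[of j] AE_space
proof eventually_elim
  case (elim \<omega>)
  let ?I = "band_indices s B b j" and ?pre = "1 / (real D * (real D - 1))"
  let ?c = "\<lambda>k i. complex_of_real (sqrt (w j k)) * complex_of_real (\<beta> j (fst i)) * spin_Y s (fst i) (snd i) (\<xi> j k)"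
  define z where "z r i = a 0 i \<omega> + a r i \<omega>" for r i
  have nc: "needlet_coeff s B b \<xi> w j k (T r \<omega>) = (\<Sum>i\<in>?I. ?c k i * z r i)" if r: "r \<in> {1..D}" for r k
  proof -
    have int: "integrable sphere_measure (F 0 \<omega>)" "integrable sphere_measure (F r \<omega>)" using elim(1) r by auto
    have "needlet_coeff s B b \<xi> w j k (T r \<omega>) = (\<Sum>i\<in>?I. ?c k i * harmonic_coeff s i (\<lambda>x. F 0 \<omega> x + F r \<omega> x))"
      unfolding needlet_coeff_T[OF r elim(2)]
      by (rule needlet_coeff_eq[OF window B]) (intro Bochner_Integration.integrable_add int)
    also have "\<dots> = (\<Sum>i\<in>?I. ?c k i * z r i)"
      unfolding harmonic_coeff_add[OF int] z_def using elim(1) r by (intro sum.cong) auto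
    finally show ?thesis .
  qed
  define t where "t i r r' = Re (z r i * cnj (z r' i))" for i r r'
  have "cp_sum s B b K \<xi> w D T j \<omega> = complex_of_real ?pre *
     (\<Sum>k<K j. \<Sum>r\<^sub>1 = 1..D. \<Sum>r\<^sub>2\<in>{1..D} - {r\<^sub>1}. (\<Sum>i\<in>?I. ?c k i * z r\<^sub>1 i) * cnj (\<Sum>i\<in>?I. ?c k i * z r\<^sub>2 i))"
    unfolding cp_sum_def using nc by simp
  also have "(\<Sum>k<K j. \<Sum>r\<^sub>1 = 1..D. \<Sum>r\<^sub>2\<in>{1..D} - {r\<^sub>1}. (\<Sum>i\<in>?I. ?c k i * z r\<^sub>1 i) * cnj (\<Sum>i\<in>?I. ?c k i * z r\<^sub>2 i)) =
     (\<Sum>r\<^sub>1 = 1..D. \<Sum>r\<^sub>2\<in>{1..D} - {r\<^sub>1}. \<Sum>k<K j. (\<Sum>i\<in>?I. ?c k i * z r\<^sub>1 i) * cnj (\<Sum>i\<in>?I. ?c k i * z r\<^sub>2 i))"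
    by (subst sum.swap, rule sum.cong[OF refl], rule sum.swap)
  also have "\<dots> = (\<Sum>r\<^sub>1 = 1..D. \<Sum>r\<^sub>2\<in>{1..D} - {r\<^sub>1}. \<Sum>i\<in>?I. complex_of_real ((\<beta> j (fst i))\<^sup>2) * (z r\<^sub>1 i * cnj (z r\<^sub>2 i)))"
    by (simp only: sum_needlet_products[OF cub window B])
  finally have "estimator j \<omega> = ?pre * (\<Sum>r\<^sub>1 = 1..D. \<Sum>r\<^sub>2\<in>{1..D} - {r\<^sub>1}. \<Sum>i\<in>?I. (\<beta> j (fst i))\<^sup>2 * t i r\<^sub>1 r\<^sub>2)"
  proof -
    assume eq: "cp_sum s B b K \<xi> w D T j \<omega> = complex_of_real ?pre *
      (\<Sum>r\<^sub>1 = 1..D. \<Sum>r\<^sub>2\<in>{1..D} - {r\<^sub>1}. \<Sum>i\<in>?I. complex_of_real ((\<beta> j (fst i))\<^sup>2) * (z r\<^sub>1 i * cnj (z r\<^sub>2 i)))"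
    have "Re (complex_of_real x * y) = x * Re y" for x y by simp
    then show ?thesis unfolding cp_estimator_def t_def eq by (simp only: Re_sum)
  qed
  also have "\<dots> = (\<Sum>i\<in>?I. (\<beta> j (fst i))\<^sup>2 * (?pre * (\<Sum>r\<^sub>1 = 1..D. \<Sum>r\<^sub>2\<in>{1..D} - {r\<^sub>1}. t i r\<^sub>1 r\<^sub>2)))"
  proof -
    have "(\<Sum>r\<^sub>1 = 1..D. \<Sum>r\<^sub>2\<in>{1..D} - {r\<^sub>1}. \<Sum>i\<in>?I. (\<beta> j (fst i))\<^sup>2 * t i r\<^sub>1 r\<^sub>2) =
      (\<Sum>r\<^sub>1 = 1..D. \<Sum>i\<in>?I. \<Sum>r\<^sub>2\<in>{1..D} - {r\<^sub>1}. (\<beta> j (fst i))\<^sup>2 * t i r\<^sub>1 r\<^sub>2)"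
      by (rule sum.cong[OF refl], rule sum.swap)
    also have "\<dots> = (\<Sum>i\<in>?I. \<Sum>r\<^sub>1 = 1..D. \<Sum>r\<^sub>2\<in>{1..D} - {r\<^sub>1}. (\<beta> j (fst i))\<^sup>2 * t i r\<^sub>1 r\<^sub>2)"
      by (rule sum.swap)
    finally show ?thesis by (simp only: sum_distrib_left mult.left_commute)
  qed
  also have "\<dots> = (\<Sum>i\<in>?I. (\<beta> j (fst i))\<^sup>2 * (form (i, True) \<omega> + form (i, False) \<omega>))"
  proof (intro sum.cong refl arg_cong2[of _ _ _ _ "(*)"])
    fix i
    have "t i r r' = (V (0, i, True) \<omega> + V (r, i, True) \<omega>) * (V (0, i, True) \<omega> + V (r', i, True) \<omega>) +
        (V (0, i, False) \<omega> + V (r, i, False) \<omega>) * (V (0, i, False) \<omega> + V (r', i, False) \<omega>)" for r r'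
      by (simp add: t_def z_def V_def re_im_def algebra_simps)
    then show "?pre * (\<Sum>r\<^sub>1 = 1..D. \<Sum>r\<^sub>2\<in>{1..D} - {r\<^sub>1}. t i r\<^sub>1 r\<^sub>2) = form (i, True) \<omega> + form (i, False) \<omega>"
      unfolding form_def cp_matrix_form[OF D] by (simp only: sum.distrib distrib_left)
  qed
  also have "\<dots> = (\<Sum>p\<in>blocks j. (\<beta> j (fst (fst p)))\<^sup>2 * form p \<omega>)"
    unfolding sum_times_bool by (simp add: distrib_left)
  also have "\<dots> = needlet_power M s B b K \<xi> w (F 0) j + (\<Sum>p\<in>blocks j. Y j p \<omega>)"
    unfolding needlet_power_eq sum.distrib[symmetric] Y_def by (simp add: algebra_simps)
  finally show ?case .
qed

definition level_variance :: "nat \<Rightarrow> real" where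
  "level_variance j = (\<Sum>p\<in>blocks j. expectation (\<lambda>\<omega>. (Y j p \<omega>)\<^sup>2))"

lemma Y_square_integrable:
  assumes "p \<in> blocks j"
  shows "integrable M (\<lambda>\<omega>. (Y j p \<omega>)\<^sup>2)"
  using integrable_power_le_4[of "Y j p" 2] Y_moments(1,2)[OF blocks_harmonic[OF assms], of j] by simp

lemma variance_estimator: "variance (estimator j) = level_variance j"
proof -
  let ?\<Gamma> = "needlet_power M s B b K \<xi> w (F 0) j" and ?S = "\<lambda>\<omega>. \<Sum>p\<in>blocks j. Y j p \<omega>"
  have [measurable]: "estimator j \<in> borel_measurable M" by (rule estimator_meas)
  have iY: "integrable M (Y j p)" if "p \<in> blocks j" for p by (rule Y_moments(2)[OF blocks_harmonic[OF that]])
  have iS: "integrable M ?S" using iY by (intro Bochner_Integration.integrable_sum)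
  have [measurable]: "?S \<in> borel_measurable M" using iS by simp
  have ES: "expectation ?S = 0"
    using iY Y_moments(3) blocks_harmonic by (subst Bochner_Integration.integral_sum) auto
  have "expectation (estimator j) = expectation (\<lambda>\<omega>. ?\<Gamma> + ?S \<omega>)"
    by (rule integral_cong_AE[OF _ _ estimator_decomposition]) measurable
  also have "\<dots> = ?\<Gamma>" using iS ES by (simp add: prob_space)
  finally have E: "expectation (estimator j) = ?\<Gamma>" .
  have "variance (estimator j) = expectation (\<lambda>\<omega>. (?S \<omega>)\<^sup>2)"
    unfolding E
  proof (rule integral_cong_AE)
    show "AE \<omega> in M. (estimator j \<omega> - ?\<Gamma>)\<^sup>2 = (?S \<omega>)\<^sup>2"
      using estimator_decomposition[of j] by eventually_elim simp
  qed measurable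
  also have "\<dots> = level_variance j"
    unfolding level_variance_def
    by (rule expectation_square_sum_indep[OF finite_blocks Y_indep])
      (use Y_square_integrable Y_moments(3) blocks_harmonic in auto)
  finally show ?thesis .
qed

lemma level_variance_eq:
  "level_variance j = (\<Sum>l\<in>band s B b j. 2 * (2 * real l + 1) * (\<beta> j l ^ 4 * block_variance l))"
proof -
  have "level_variance j = (\<Sum>p\<in>blocks j. \<beta> j (fst (fst p)) ^ 4 * block_variance (fst (fst p)))"
    unfolding level_variance_def using Y_moments(4) blocks_harmonic by (intro sum.cong) auto
  also have "\<dots> = (\<Sum>i\<in>band_indices s B b j. 2 * (\<beta> j (fst i) ^ 4 * block_variance (fst i)))"
    unfolding sum_times_bool by (simp add: mult_ac)
  also have "\<dots> = (\<Sum>l\<in>band s B b j. \<Sum>m = - int l..int l. 2 * (\<beta> j l ^ 4 * block_variance l))"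
    unfolding band_indices_def by (subst sum.Sigma) (auto simp: finite_band[OF window B] case_prod_unfold)
  also have "\<dots> = (\<Sum>l\<in>band s B b j. 2 * (2 * real l + 1) * (\<beta> j l ^ 4 * block_variance l))"
    by (rule sum.cong) auto
  finally show ?thesis .
qed

lemma term_pos: "l \<in> band s B b j \<Longrightarrow> 0 < \<beta> j l ^ 4 * block_variance l"
  using block_variance_pos[of l] by (auto simp: band_def zero_less_power_eq intro!: mult_pos_pos)

text \<open>Each variance is repeated \<open>2 (2l + 1)\<close> times, so no single summand contributes much.\<close>

lemma block_negligible:
  assumes p: "p \<in> blocks j"
  shows "expectation (\<lambda>\<omega>. (Y j p \<omega>)\<^sup>2) \<le> (B / B ^ j) * level_variance j"
proof -
  let ?l = "fst (fst p)"
  have l: "?l \<in> band s B b j" using p by (auto simp: band_indices_def)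
  let ?t = "\<lambda>l. \<beta> j l ^ 4 * block_variance l"
  have "2 * (2 * real ?l + 1) * ?t ?l \<le> level_variance j"
    unfolding level_variance_eq
    by (rule member_le_sum[OF l, of "\<lambda>l. 2 * (2 * real l + 1) * ?t l"])
      (use term_pos finite_band[OF window B] in \<open>auto intro!: mult_nonneg_nonneg less_imp_le[OF term_pos]\<close>)
  \<comment> \<open>The rate \<open>B / B ^ j\<close> is the reciprocal of this lower bound for the
    multiplicity, which comes from the lower end of the band.\<close>
  moreover have "B ^ j / B \<le> 2 * (2 * real ?l + 1)"
  proof -
    have "2 * B * real ?l \<le> 2 * (2 * real ?l + 1) * B" using B by (simp add: algebra_simps)
    then have "B ^ j \<le> 2 * (2 * real ?l + 1) * B" using band_bounds(1)[OF window B l] by linarith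
    then show ?thesis using B by (simp add: pos_divide_le_eq)
  qed
  then have "B ^ j / B * ?t ?l \<le> 2 * (2 * real ?l + 1) * ?t ?l"
    using term_pos[OF l] by (intro mult_right_mono) auto
  ultimately have "B ^ j / B * ?t ?l \<le> level_variance j" by linarith
  then have "?t ?l \<le> (B / B ^ j) * level_variance j"
    using B by (simp add: field_simps)
  then show ?thesis using Y_moments(4)[OF blocks_harmonic[OF p], of j] by simp
qed

lemma level_variance_pos: "band s B b j \<noteq> {} \<Longrightarrow> level_variance j > 0"
  unfolding level_variance_eq
  using finite_band[OF window B] term_pos by (intro sum_pos) (auto intro!: mult_pos_pos)

end

section \<open>Asymptotics\<close>

context cross_power
begin

text \<open>The partition of unity at 1 provides some u > 0 with b u nonzero, and \<open>b\<close>
  is continuous. For l the integer part of u B^j the argument of the window tends to u, so this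
  multipole eventually belongs to the band.\<close>

lemma eventually_band_nonempty: "eventually (\<lambda>j. band s B b j \<noteq> {}) sequentially"
proof -
  have "((\<lambda>j::int. (b (1 / B powi j))\<^sup>2) has_sum 1) UNIV"
    using window unfolding needlet_window_def by (elim conjE allE[of _ 1] impE) simp_all
  then have "\<exists>i::int. b (1 / B powi i) \<noteq> 0"
  proof (rule contrapos_pp)
    assume "\<not> (\<exists>i::int. b (1 / B powi i) \<noteq> 0)"
    then have "(\<lambda>j::int. (b (1 / B powi j))\<^sup>2) = (\<lambda>_. 0)" by simp
    moreover have "((\<lambda>_::int. 0::real) has_sum 0) UNIV" by simp
    ultimately show "\<not> ((\<lambda>j::int. (b (1 / B powi j))\<^sup>2) has_sum 1) UNIV"
      by (metis has_sum_unique zero_neq_one)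
  qed
  then obtain i :: int where i: "b (1 / B powi i) \<noteq> 0" by blast
  define u where "u = 1 / B powi i"
  have u: "u > 0" "b u \<noteq> 0" using i B by (auto simp: u_def)
  have "smooth_on UNIV b" using window unfolding needlet_window_def by (elim conjE)
  then have "(deriv ^^ 0) b field_differentiable (at u)" unfolding smooth_on_def by blast
  then have cont: "isCont b u" using field_differentiable_imp_continuous_at by simp
  define x where "x j = B ^ j" for j :: nat
  have x_pos: "x j > 0" for j using B by (simp add: x_def)
  have x_lim: "filterlim x at_top sequentially"
  proof (rule filterlim_at_infinity_imp_filterlim_at_top)
    show "filterlim x at_infinity sequentially"
      unfolding x_def using B by (intro filterlim_realpow_sequentially_gt1) simp
    show "eventually (\<lambda>j. x j > 0) sequentially" using x_pos by simp
  qed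
  have inv_lim: "(\<lambda>j. c / x j) \<longlonglongrightarrow> 0" for c
    by (rule real_tendsto_divide_at_top[OF tendsto_const x_lim])
  define l where "l j = nat \<lfloor>u * x j\<rfloor>" for j
  have l_eq: "real (l j) = of_int \<lfloor>u * x j\<rfloor>" for j
    using u x_pos[of j] by (simp add: l_def)
  have ratio: "(\<lambda>j. real (l j) / x j) \<longlonglongrightarrow> u"
  proof (rule real_tendsto_sandwich)
    show "eventually (\<lambda>j. u - 1 / x j \<le> real (l j) / x j) sequentially"
    proof (rule always_eventually, rule allI)
      fix j
      have "u * x j - 1 \<le> real (l j)" unfolding l_eq by linarith
      then have "(u * x j - 1) / x j \<le> real (l j) / x j" using x_pos[of j] by (intro divide_right_mono) auto
      then show "u - 1 / x j \<le> real (l j) / x j" using x_pos[of j] by (simp add: diff_divide_distrib)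
    qed
    show "eventually (\<lambda>j. real (l j) / x j \<le> u) sequentially"
      using x_pos by (intro always_eventually allI) (simp add: l_eq pos_divide_le_eq)
    show "(\<lambda>j. u - 1 / x j) \<longlonglongrightarrow> u" using tendsto_diff[OF tendsto_const inv_lim[of 1], of u] by simp
  qed simp
  have "(\<lambda>j. (real (l j) / x j - real_of_int s / x j) * (real (l j) / x j + (real_of_int s + 1) / x j)) \<longlonglongrightarrow> (u - 0) * (u + 0)"
    by (intro tendsto_intros ratio inv_lim)
  moreover have "(real (l j) / x j - real_of_int s / x j) * (real (l j) / x j + (real_of_int s + 1) / x j) = spin_e s (l j) / (x j)\<^sup>2" for j
    by (simp add: spin_e_def power2_eq_square add_divide_distrib[symmetric] diff_divide_distrib[symmetric] add.assoc)
  ultimately have "(\<lambda>j. sqrt (spin_e s (l j) / (x j)\<^sup>2)) \<longlonglongrightarrow> sqrt (u * u)"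
    by (intro tendsto_real_sqrt) simp
  moreover have "sqrt (spin_e s (l j) / (x j)\<^sup>2) = sqrt (spin_e s (l j)) / B ^ j" for j
    using x_pos[of j] by (simp add: real_sqrt_divide x_def)
  ultimately have "(\<lambda>j. sqrt (spin_e s (l j)) / B ^ j) \<longlonglongrightarrow> u" using u by simp
  then have "(\<lambda>j. level_weight s B b j (l j)) \<longlonglongrightarrow> b u"
    unfolding level_weight_def by (rule isCont_tendsto_compose[OF cont])
  then have ne: "eventually (\<lambda>j. level_weight s B b j (l j) \<noteq> 0) sequentially"
    by (rule tendsto_imp_eventually_ne[OF _ u(2)])
  have "filterlim (\<lambda>j. u * x j) at_top sequentially"
    by (rule filterlim_tendsto_pos_mult_at_top[OF tendsto_const u(1) x_lim])
  then have "eventually (\<lambda>j. u * x j \<ge> real (lmin s)) sequentially" by (simp add: filterlim_at_top)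
  then have "eventually (\<lambda>j. lmin s \<le> l j) sequentially"
    by eventually_elim (simp add: l_def le_nat_iff le_floor_iff)
  with ne show ?thesis by eventually_elim (auto simp: band_def)
qed

lemma cp_matrix_square_le_1: "(h r r')\<^sup>2 \<le> 1"
proof -
  have "\<bar>h r r'\<bar> \<le> 1"
  proof -
    have "1 \<le> real D * (real D - 1)" using D mult_mono[of 1 "real D" 1 "real D - 1"] by simp
    then show ?thesis using D by (auto simp: cp_matrix_def)
  qed
  then show ?thesis by (simp add: abs_square_le_1)
qed

lemma card_band: "real (card (band s B b j)) \<le> (B + real_of_int \<bar>s\<bar> + 1) * B ^ j"
proof -
  let ?x = "(B + real_of_int \<bar>s\<bar> + 1) * B ^ j"
  have x: "0 \<le> ?x" using B by simp
  have "band s B b j \<subseteq> {1..nat \<lfloor>?x\<rfloor>}"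
  proof
    fix l assume l: "l \<in> band s B b j"
    have "l \<le> nat \<lfloor>?x\<rfloor>" by (rule le_nat_floor[OF band_bounds(2)[OF window B l]])
    then show "l \<in> {1..nat \<lfloor>?x\<rfloor>}" using l by (simp add: band_def lmin_def)
  qed
  then have "card (band s B b j) \<le> nat \<lfloor>?x\<rfloor>" using card_mono[of "{1..nat \<lfloor>?x\<rfloor>}"] by simp
  then have "real (card (band s B b j)) \<le> real (nat \<lfloor>?x\<rfloor>)" by simp
  also have "\<dots> \<le> ?x" using x by simp
  finally show ?thesis .
qed

text \<open>The exponent is a sum of three: the size of the band and the multiplicity of one l each
  give a factor of order B^j, and the block variance gives B^(-2 \<mu> j).\<close>

lemma level_variance_bound:
  assumes c: "\<And>r l. r \<le> D \<Longrightarrow> lmin s \<le> l \<Longrightarrow> C r l \<le> c * real l powr (- \<mu>)" and \<mu>: "\<mu> > 0"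
  shows "level_variance \<in> O(\<lambda>j. B powr (2 * (1 - \<mu>) * real j))"
proof -
  let ?\<kappa> = "B + real_of_int \<bar>s\<bar> + 1"
  \<comment> \<open>There are (D + 1)^2 matrix entries, each of modulus at most 1; the 2 is the one
    in \<open>block_variance\<close>.\<close>
  define A where "A = (real (D + 1))\<^sup>2 * c\<^sup>2 / 2"
  have A0: "A \<ge> 0" by (simp add: A_def)
  have bv: "block_variance l \<le> A * real l powr (- 2 * \<mu>)" if l: "lmin s \<le> l" for l
  proof -
    let ?q = "c * real l powr (- \<mu>)"
    have "(h r r')\<^sup>2 * (C r l * C r' l) \<le> 1 * (?q * ?q)" if "r \<in> {0..D}" "r' \<in> {0..D}" for r r'
    proof (rule mult_mono)
      show "C r l * C r' l \<le> ?q * ?q"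
        using c[of r l] c[of r' l] C_pos[of r l] C_pos[of r' l] that l
        by (intro mult_mono) (auto intro: order_trans[OF less_imp_le])
      show "0 \<le> C r l * C r' l" using C_pos[of r l] C_pos[of r' l] that l by simp
    qed (use cp_matrix_square_le_1 in auto)
    then have "(\<Sum>r\<in>{0..D}. \<Sum>r'\<in>{0..D}. (h r r')\<^sup>2 * (C r l * C r' l)) \<le> (\<Sum>r\<in>{0..D}. \<Sum>r'\<in>{0..D}. 1 * (?q * ?q))"
      by (intro sum_mono) auto
    also have "\<dots> = 2 * A * (real l powr (- \<mu>) * real l powr (- \<mu>))"
      by (simp add: A_def power2_eq_square mult_ac)
    also have "real l powr (- \<mu>) * real l powr (- \<mu>) = real l powr (- 2 * \<mu>)"
      by (simp flip: powr_add)
    finally show ?thesis by (simp add: block_variance_def)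
  qed
  have main: "level_variance j \<le> (6 * ?\<kappa>\<^sup>2 * A * (2 * B) powr (2 * \<mu>)) * B powr (2 * (1 - \<mu>) * real j)" for j
  proof -
    define x where "x = B ^ j"
    have x: "x > 0" using B by (simp add: x_def)
    \<comment> \<open>A bound uniform over the band: 2 (2 l + 1) <= 6 l uses the upper end of the
      band, and the decreasing power l^(-2 \<mu>) uses the lower end B^j / (2 B).\<close>
    let ?M = "6 * (?\<kappa> * x) * (A * (x / (2 * B)) powr (- 2 * \<mu>))"
    have "2 * (2 * real l + 1) * (\<beta> j l ^ 4 * block_variance l) \<le> ?M" if l: "l \<in> band s B b j" for l
    proof -
      have lm: "lmin s \<le> l" using l by (simp add: band_def)
      then have l1: "real l \<ge> 1" by (simp add: lmin_def)
      have "2 * (2 * real l + 1) \<le> 6 * real l" using l1 by (simp add: algebra_simps)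
      also have "\<dots> \<le> 6 * (?\<kappa> * x)"
        using band_bounds(2)[OF window B l] unfolding x_def by (rule mult_left_mono) simp
      finally have "2 * (2 * real l + 1) \<le> 6 * (?\<kappa> * x)" .
      moreover have "\<beta> j l ^ 4 * block_variance l \<le> A * (x / (2 * B)) powr (- 2 * \<mu>)"
      proof -
        have "\<beta> j l ^ 4 \<le> 1"
          unfolding level_weight_def by (rule power_le_one) (use window_nonneg[OF window] window_le_1[OF window B] in auto)
        then have "\<beta> j l ^ 4 * block_variance l \<le> 1 * block_variance l"
          using block_variance_pos[OF lm] by (intro mult_right_mono) auto
        also have "\<dots> \<le> A * real l powr (- 2 * \<mu>)" using bv[OF lm] by simp
        also have "\<dots> \<le> A * (x / (2 * B)) powr (- 2 * \<mu>)"
        proof (rule mult_left_mono[OF _ A0], rule powr_mono2')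
          show "x / (2 * B) \<le> real l" using band_bounds(1)[OF window B l] B by (simp add: x_def pos_divide_le_eq mult_ac)
        qed (use x B \<mu> in auto)
        finally show ?thesis .
      qed
      moreover have "0 \<le> 6 * (?\<kappa> * x)" using B x by simp
      ultimately show ?thesis
        by (rule mult_mono) (rule less_imp_le[OF term_pos[OF l]])
    qed
    then have "level_variance j \<le> real (card (band s B b j)) * ?M"
      unfolding level_variance_eq by (rule sum_bounded_above)
    also have "\<dots> \<le> (?\<kappa> * x) * ?M"
    proof (rule mult_right_mono)
      show "real (card (band s B b j)) \<le> ?\<kappa> * x" unfolding x_def by (rule card_band)
      show "0 \<le> ?M" using A0 x B by (intro mult_nonneg_nonneg) auto
    qed
    also have "(x / (2 * B)) powr (- 2 * \<mu>) = (2 * B) powr (2 * \<mu>) * x powr (- 2 * \<mu>)"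
    proof -
      have "(x / (2 * B)) powr (- 2 * \<mu>) = x powr (- 2 * \<mu>) / (2 * B) powr (- 2 * \<mu>)"
        by (rule powr_divide)
      also have "(2 * B) powr (- 2 * \<mu>) = inverse ((2 * B) powr (2 * \<mu>))"
        using powr_minus[of "2 * B" "2 * \<mu>"] by simp
      finally have "(x / (2 * B)) powr (- 2 * \<mu>) = x powr (- 2 * \<mu>) / inverse ((2 * B) powr (2 * \<mu>))" .
      moreover have "y / inverse z = z * y" for y z :: real by (simp add: divide_inverse mult.commute)
      ultimately show ?thesis by (simp only:)
    qed
    also have "(?\<kappa> * x) * (6 * (?\<kappa> * x) * (A * ((2 * B) powr (2 * \<mu>) * x powr (- 2 * \<mu>)))) =
        (6 * ?\<kappa>\<^sup>2 * A * (2 * B) powr (2 * \<mu>)) * (x powr 2 * x powr (- 2 * \<mu>))"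
    proof -
      have "x powr 2 = x * x" using x by (simp add: power2_eq_square)
      then show ?thesis by (simp only: power2_eq_square mult_ac)
    qed
    also have "x powr 2 * x powr (- 2 * \<mu>) = B powr (2 * (1 - \<mu>) * real j)"
    proof -
      have "x = B powr real j" using B by (simp add: x_def powr_realpow)
      then have "x powr 2 * x powr (- 2 * \<mu>) = B powr (real j * 2) * B powr (real j * (- 2 * \<mu>))"
        by (simp only: powr_powr)
      also have "\<dots> = B powr (2 * (1 - \<mu>) * real j)"
        unfolding powr_add[symmetric] by (simp add: algebra_simps)
      finally show ?thesis .
    qed
    finally show ?thesis .
  qed
  have nn: "level_variance j \<ge> 0" for j
    unfolding level_variance_def by (intro sum_nonneg integral_nonneg_AE) simp
  show ?thesis
    by (rule bigoI[of _ "6 * ?\<kappa>\<^sup>2 * A * (2 * B) powr (2 * \<mu>)"]) (use main nn in auto)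
qed

theorem estimator_clt:
  "weak_conv_m (\<lambda>j. distr M borel (\<lambda>\<omega>. (estimator j \<omega> - needlet_power M s B b K \<xi> w (F 0) j) / sqrt (variance (estimator j))))
     std_normal_distribution"
proof -
  let ?Z = "\<lambda>j \<omega>. (\<Sum>p\<in>blocks j. Y j p \<omega>) / sqrt (level_variance j)"
  have "weak_conv_m (\<lambda>j. distr M borel (\<lambda>\<omega>. (\<Sum>p\<in>blocks j. Y j p \<omega>) / sqrt (\<Sum>p\<in>blocks j. expectation (\<lambda>\<omega>. (Y j p \<omega>)\<^sup>2))))
     std_normal_distribution"
  proof (rule lyapunov_central_limit[where \<epsilon> = "\<lambda>j. B / B ^ j" and \<kappa> = "212 * (real (D + 1)) ^ 6"])
    show "(\<lambda>j. B / B ^ j) \<longlonglongrightarrow> 0" using B by (rule LIMSEQ_divide_realpow_zero)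
    show "\<forall>\<^sub>F j in sequentially. 0 < (\<Sum>p\<in>blocks j. expectation (\<lambda>\<omega>. (Y j p \<omega>)\<^sup>2))"
      using eventually_band_nonempty by eventually_elim (use level_variance_pos in \<open>simp add: level_variance_def\<close>)
    show "expectation (\<lambda>\<omega>. (Y j p \<omega>)\<^sup>2) \<le> B / B ^ j * (\<Sum>p\<in>blocks j. expectation (\<lambda>\<omega>. (Y j p \<omega>)\<^sup>2))" if "p \<in> blocks j" for j p
      using block_negligible[OF that] by (simp add: level_variance_def)
  qed (use Y_indep finite_blocks Y_moments blocks_harmonic B in auto)
  \<comment> \<open>The decomposition holds almost surely, which is enough for equality of the
    laws.\<close>
  moreover have "distr M borel (\<lambda>\<omega>. (estimator j \<omega> - needlet_power M s B b K \<xi> w (F 0) j) / sqrt (variance (estimator j))) =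
      distr M borel (?Z j)" for j
  proof (rule distr_cong_AE)
    have [measurable]: "estimator j \<in> borel_measurable M" by (rule estimator_meas)
    have [measurable]: "Y j p \<in> borel_measurable M" if "p \<in> blocks j" for p
      using Y_moments(2)[OF blocks_harmonic[OF that]] by auto
    show "AE \<omega> in M. (estimator j \<omega> - needlet_power M s B b K \<xi> w (F 0) j) / sqrt (variance (estimator j)) = ?Z j \<omega>"
      unfolding variance_estimator using estimator_decomposition[of j] by eventually_elim simp
    show "(\<lambda>\<omega>. (estimator j \<omega> - needlet_power M s B b K \<xi> w (F 0) j) / sqrt (variance (estimator j))) \<in> borel_measurable M" by measurable
    show "?Z j \<in> borel_measurable M" by measurable
  qed auto
  ultimately show ?thesis by (simp add: level_variance_def)
qed

end

section \<open>Bounds on the spectra and the conclusion\<close>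

lemma regular_spectrum_pos: "regular_spectrum s \<alpha> C \<Longrightarrow> lmin s \<le> l \<Longrightarrow> C l > 0"
  unfolding regular_spectrum_def by blast

text \<open>Since l >= 1, lowering the exponent weakens the bound. This puts signal and noise under
  the common exponent min \<alpha> \<gamma>.\<close>

lemma regular_spectrum_le:
  assumes "regular_spectrum s \<alpha> C" "\<mu> \<le> \<alpha>"
  shows "\<exists>c>0. \<forall>l\<ge>lmin s. C l \<le> c * real l powr (- \<mu>)"
proof -
  obtain g c where g: "\<And>l. l \<ge> lmin s \<Longrightarrow> C l = real l powr (- \<alpha>) * g (real l)" and c: "c > 0" "\<And>l. l \<ge> lmin s \<Longrightarrow> g (real l) \<le> c"
    using assms(1) unfolding regular_spectrum_def by blast
  have "C l \<le> c * real l powr (- \<mu>)" if l: "l \<ge> lmin s" for l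
  proof -
    have "real l \<ge> 1" using l by (simp add: lmin_def)
    then have "real l powr (- \<alpha>) \<le> real l powr (- \<mu>)" using assms(2) by (intro powr_mono) auto
    then have "real l powr (- \<alpha>) * g (real l) \<le> real l powr (- \<mu>) * c"
      using c l less_imp_le[OF regular_spectrum_pos[OF assms(1) l]]
      by (smt (verit) mult_left_mono mult_right_mono powr_ge_zero)
    then show ?thesis using g[OF l] by (simp add: mult.commute)
  qed
  then show ?thesis using c(1) by blast
qed

theorem proposition14:
  fixes M :: "'w measure"
    and s :: int and D :: nat and B \<alpha> \<gamma> :: real
    and b :: "real \<Rightarrow> real"
    and K :: "nat \<Rightarrow> nat" and \<xi> :: "nat \<Rightarrow> nat \<Rightarrow> real^3" and w :: "nat \<Rightarrow> nat \<Rightarrow> real"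
    and P :: "'w \<Rightarrow> real^3 \<Rightarrow> complex" and N T :: "nat \<Rightarrow> 'w \<Rightarrow> real^3 \<Rightarrow> complex"
    and C :: "nat \<Rightarrow> real" and CN :: "nat \<Rightarrow> nat \<Rightarrow> real"
  assumes "prob_space M"
    and "D \<ge> 2"
    and "B > 1" and "needlet_window B b" and "cubature s B K \<xi> w"
    and "gaussian_spin_field M s C P"
    and "\<And>r. r \<in> {1..D} \<Longrightarrow> gaussian_spin_field M s (CN r) (N r)"
    and "prob_space.indep_vars M
           (\<lambda>_. \<Pi>\<^sub>M x\<in>sphere 0 1. borel)
           (\<lambda>r \<omega>. restrict (if r = 0 then P \<omega> else N r \<omega>) (sphere 0 1)) {0..D}"
    and "\<alpha> > 2" and "regular_spectrum s \<alpha> C"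
    and "\<gamma> > 2" and "\<And>r. r \<in> {1..D} \<Longrightarrow> regular_spectrum s \<gamma> (CN r)"
    and "\<And>r \<omega> x. r \<in> {1..D} \<Longrightarrow> \<omega> \<in> space M \<Longrightarrow> x \<in> sphere 0 1 \<Longrightarrow> T r \<omega> x = P \<omega> x + N r \<omega> x"
  shows "weak_conv_m
           (\<lambda>j. distr M borel (\<lambda>\<omega>.
              (cp_estimator s B b K \<xi> w D T j \<omega> - needlet_power M s B b K \<xi> w P j) /
              sqrt (prob_space.variance M (cp_estimator s B b K \<xi> w D T j))))
           std_normal_distribution \<and>
         (\<lambda>j. prob_space.variance M (cp_estimator s B b K \<xi> w D T j))
           \<in> O(\<lambda>j. B powr (2 * (1 - min \<alpha> \<gamma>) * real j))"
proof -
  interpret prob_space M by fact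
  \<comment> \<open>Signal and noises form one family with the signal at index 0, as in the
    independence hypothesis.\<close>
  let ?F = "\<lambda>r \<omega>. if r = 0 then P \<omega> else N r \<omega>" and ?C = "\<lambda>r. if r = 0 then C else CN r"
  let ?\<mu> = "min \<alpha> \<gamma>"
  have \<mu>: "?\<mu> > 0" using assms(9,11) by simp
  have reg: "regular_spectrum s (if r = 0 then \<alpha> else \<gamma>) (?C r)" if "r \<in> {0..D}" for r
    using assms that by auto
  have "\<exists>a. spin_expansion M s (?C r) (?F r) a" if r: "r \<in> {0..D}" for r
  proof -
    have "gaussian_spin_field M s (?C r) (?F r)" using assms(6,7) r by (cases "r = 0") auto
    then show ?thesis using regular_spectrum_pos[OF reg[OF r]] by (rule spin_expansionI) blast+
  qed
  then obtain a where a: "\<And>r. r \<in> {0..D} \<Longrightarrow> spin_expansion M s (?C r) (?F r) (a r)" by metis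
  interpret cross_power M s D ?C ?F a B b K \<xi> w T
  proof (intro cross_power.intro independent_spin_fields.intro independent_spin_fields_axioms.intro
      cross_power_axioms.intro prob_space_axioms)
    show "spin_expansion M s (?C r) (?F r) (a r)" if "r \<in> {0..D}" for r by (rule a[OF that])
    show "indep_vars (\<lambda>_. \<Pi>\<^sub>M x\<in>sphere 0 1. borel) (\<lambda>r \<omega>. restrict (?F r \<omega>) (sphere 0 1)) {0..D}" by (rule assms(8))
    show "T r \<omega> x = ?F 0 \<omega> x + ?F r \<omega> x" if "r \<in> {1..D}" "\<omega> \<in> space M" "x \<in> sphere 0 1" for r \<omega> x
      using assms(13)[OF that] that by simp
  qed (rule finite_atLeastAtMost assms)+
  have "\<forall>r\<in>{0..D}. \<exists>c. \<forall>l\<ge>lmin s. ?C r l \<le> c * real l powr (- ?\<mu>)"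
  proof
    fix r assume "r \<in> {0..D}"
    have "?\<mu> \<le> (if r = 0 then \<alpha> else \<gamma>)" by simp
    then show "\<exists>c. \<forall>l\<ge>lmin s. ?C r l \<le> c * real l powr (- ?\<mu>)"
      using regular_spectrum_le[OF reg[OF \<open>r \<in> {0..D}\<close>]] by blast
  qed
  from bchoice[OF this] obtain c where c: "\<And>r l. r \<in> {0..D} \<Longrightarrow> lmin s \<le> l \<Longrightarrow> ?C r l \<le> c r * real l powr (- ?\<mu>)"
    by blast
  \<comment> \<open>A single constant for the finitely many spectra, as
    \<open>level_variance_bound\<close> requires.\<close>
  have bound: "?C r l \<le> Max (c ` {0..D}) * real l powr (- ?\<mu>)" if "r \<le> D" "lmin s \<le> l" for r l
  proof -
    have "c r * real l powr (- ?\<mu>) \<le> Max (c ` {0..D}) * real l powr (- ?\<mu>)"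
      using that by (intro mult_right_mono Max_ge) auto
    moreover have "?C r l \<le> c r * real l powr (- ?\<mu>)" by (rule c) (use that in auto)
    ultimately show ?thesis by (rule order_trans[rotated])
  qed
  have "level_variance \<in> O(\<lambda>j. B powr (2 * (1 - ?\<mu>) * real j))"
    by (rule level_variance_bound[OF bound \<mu>])
  moreover have "(\<lambda>j. variance (cp_estimator s B b K \<xi> w D T j)) = level_variance"
    by (rule ext) (rule variance_estimator)
  ultimately show ?thesis using estimator_clt by simp
qed

end
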